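(* Let $\mathcal C$ be a concrete monoidal $W^*$-category with a semi-regular (respectively, regular) braiding $c$, let $L\in\mathcal C$ be an object with underlying Hilbert space $\mathscr L$, and let $F\in\mathcal U_{\mathcal C}(L\otimes L)$ be a semi-regular (respectively, regular) multiplicative unitary in $\mathcal C$. Then the braiding $\Phi$ on the category ${}_F\mathcal{YD}^F(\mathcal C)$ of Yetter-Drinfeld modules of $F$ is semi-regular (respectively, regular).
   Context: A $W^*$-category is a $C^*$-category whose Hom-spaces are dual Banach spaces; a functor between $W^*$-categories is normal if it is ultraweakly continuous on Hom-spaces. A concrete monoidal $W^*$-category is a monoidal $W^*$-category $(\mathcal C,\otimes,\mathbb 1)$ (with normal bifunctor $\otimes$) together with a normal strong monoidal ($*$-preserving) functor to the category of Hilbert spaces and bounded maps with the Hilbert space tensor product. The Hilbert space underlying $H,K,L\in\mathcal C$ is denoted $\mathscr H,\mathscr K,\mathscr L$; coherence isomorphisms are suppressed and morphisms are identified with the bounded operators they induce. $\mathcal U_{\mathcal C}(X)$ is the set of unitary endomorphisms of $X$ in $\mathcal C$. A braiding $c$ on $\mathcal C$ is a family of natural isomorphisms $c_{X,Y}:X\otimes Y\to Y\otimes X$ with $c_{U,V\otimes W}=(\mathrm{id}_V\otimes c_{U,W})(c_{U,V}\otimes \mathrm{id}_W)$ and $c_{U\otimes V,W}=(c_{U,W}\otimes\mathrm{id}_V)(\mathrm{id}_U\otimes c_{V,W})$. $[X]$ denotes the norm-closed linear span; $\mathcal K(\cdot,\cdot)$ the compact operators; $\mathcal B(\mathscr H,\mathscr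 K)_*$ the predual (normal functionals). For $X\in\mathcal B(\mathscr H\otimes\mathscr K,\mathscr H'\otimes\mathscr K')$ and $\omega\in\mathcal B(\mathscr K,\mathscr K')_*$, $(\mathrm{id}\otimes\omega)(X)\in\mathcal B(\mathscr H,\mathscr H')$ is the slice. A braiding $c$ on a concrete monoidal $W^*$-category is semi-regular if it is unitary and $\mathcal K(\mathscr H,\mathscr K)\subseteq[(\mathrm{id}\otimes\omega)(c_{H,K})\mid\omega\in\mathcal B(\mathscr K,\mathscr H)_*]$ for all objects $H,K$; it is regular if equality holds for all $H,K$. Leg notation: on a triple tensor product, $X_{12}=X\otimes\mathrm{id}$, $X_{23}=\mathrm{id}\otimes X$. For $X\in\mathrm{End}_{\mathcal C}(A\otimes B)$ and an object $M$ between them, define on $A\otimes M\otimes B$ $$X_{13}:=(c_{A,M}^{-1})_{12}X_{23}(c_{A,M})_{12},\qquad X_{\underline{13}}:=(c_{M,A})_{12}X_{23}(c_{M,A}^{-1})_{12}.$$ $F\in\mathcal U_{\mathcal C}(L\otimes L)$ is a multiplicative unitary in $\mathcal C$ if $F_{23}F_{12}=F_{12}F_{13}F_{23}$ on $L\otimes L\otimes L$. It is semi-regular if $C(F):=[(\mathrm{id}\otimes\omega)(c_{L,L}^{-1}\circ F)\mid\omega\in\mathcal B(\mathscr L)_*]\supseteq\mathcal K(\mathscr L)$, and regular if $C(F)=\mathcal K(\mathscr L)$. ${}_F\mathcal{YD}^F(\mathcal C)$: objects are triples $(H,U,V)$ with $H\in\mathcal C$, $U\in\mathcal U_{\mathcal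 C}(H\otimes L)$ satisfying $F_{23}U_{12}=U_{12}U_{13}F_{23}$ on $H\otimes L\otimes L$, $V\in\mathcal U_{\mathcal C}(L\otimes H)$ satisfying $V_{23}F_{12}=F_{12}V_{13}V_{23}$ on $L\otimes L\otimes H$, and $V_{12}F_{13}U_{23}=U_{23}F_{\underline{13}}V_{12}$ on $L\otimes H\otimes L$. Morphisms $(H_1,U_1,V_1)\to(H_2,U_2,V_2)$ are $f\in\mathrm{Hom}_{\mathcal C}(H_1,H_2)$ with $(f\otimes\mathrm{id}_L)U_1=U_2(f\otimes\mathrm{id}_L)$ and $(\mathrm{id}_L\otimes f)V_1=V_2(\mathrm{id}_L\otimes f)$. The tensor product is $(H_1,U_1,V_1)\otimes(H_2,U_2,V_2)=(H_1\otimes H_2,\,(U_1)_{13}(U_2)_{23},\,(V_2)_{\underline{13}}(V_1)_{12})$. It is a concrete monoidal $W^*$-category via the underlying Hilbert space $\mathscr H$ of $H$. Semi-regular multiplicative unitaries $F$ are such that for all objects $(H,U_H,V_H),(K,U_K,V_K)$ of ${}_F\mathcal{YD}^F(\mathcal C)$ there is a unique unitary $V_K\ast U_H\in\mathcal U_{\mathcal C}(H\otimes K)$ with $$(V_K\ast U_H)_{13}=(U_H)_{12}^*\,(V_K)_{23}\,(U_H)_{12}\,(V_K)_{23}^*\quad\text{on }H\otimes L\otimes K,$$ and ${}_F\mathcal{YD}^F(\mathcal C)$ is unitarily braided by $\Phi_{H,K}:=c_{K,H}^{-1}\circ(V_K\ast U_H):H\otimes K\to K\otimes H$. This is the braiding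 $\Phi$ in the claim. *)

theory Defs
  imports "HOL-Analysis.Analysis"
begin

section \<open>Complex Hilbert spaces and bounded operators\<close>

text \<open>The inner product is antilinear in the first and linear in the second argument.\<close>

class complex_hilbert_space = banach +
  fixes scaleC :: "complex \<Rightarrow> 'a \<Rightarrow> 'a" (infixr \<open>*\<^sub>C\<close> 75)
    and cinner :: "'a \<Rightarrow> 'a \<Rightarrow> complex"
  assumes scaleC_add_right: "a *\<^sub>C (x + y) = a *\<^sub>C x + a *\<^sub>C y"
    and scaleC_add_left: "(a + b) *\<^sub>C x = a *\<^sub>C x + b *\<^sub>C x"
    and scaleC_scaleC: "a *\<^sub>C b *\<^sub>C x = (a * b) *\<^sub>C x"
    and scaleR_scaleC: "r *\<^sub>R x = complex_of_real r *\<^sub>C x"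
    and cinner_commute: "cinner x y = cnj (cinner y x)"
    and cinner_add_right: "cinner x (y + z) = cinner x y + cinner x z"
    and cinner_scaleC_right: "cinner x (a *\<^sub>C y) = a * cinner x y"
    and cinner_self: "cinner x x = complex_of_real ((norm x)\<^sup>2)"

lemma norm_scaleC: "norm (a *\<^sub>C x) = cmod a * norm (x :: 'a :: complex_hilbert_space)"
proof -
  have "cinner (a *\<^sub>C x) x = cnj a * cinner x x"
    by (subst cinner_commute, subst cinner_scaleC_right, subst (2) cinner_commute) simp
  then have "cinner (a *\<^sub>C x) (a *\<^sub>C x) = a * cnj a * cinner x x"
    by (simp add: cinner_scaleC_right)
  then have "complex_of_real ((norm (a *\<^sub>C x))\<^sup>2) = complex_of_real ((cmod a * norm x)\<^sup>2)"
    by (simp add: cinner_self complex_norm_square[symmetric] power_mult_distrib)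
  then have "(norm (a *\<^sub>C x))\<^sup>2 = (cmod a * norm x)\<^sup>2"
    by (simp only: of_real_eq_iff)
  then show ?thesis
    by (simp add: power2_eq_iff_nonneg)
qed

global_interpretation cvec: vector_space "scaleC :: complex \<Rightarrow> 'a \<Rightarrow> 'a :: complex_hilbert_space"
proof
  fix x :: 'a
  show "1 *\<^sub>C x = x" using scaleR_scaleC[of 1 x] by simp
qed (simp_all add: scaleC_add_left scaleC_add_right scaleC_scaleC)

text \<open>
  All Hilbert spaces that occur are closed subspaces of one ambient Hilbert space. A bounded
  operator between closed subspaces \<open>A\<close> and \<open>B\<close> is represented by its extension by zero on the
  orthogonal complement of \<open>A\<close>, so that \<open>\<B>(A, B)\<close> is a corner of the bounded operators of the
  ambient space, with the same norm. In particular the identity of \<open>A\<close> is represented by the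
  orthogonal projection onto \<open>A\<close>, and adjoints may be computed in the ambient space.
  The type of operators \<open>'v \<Rightarrow>\<^sub>L 'v\<close> is that of real-linear maps; complex linearity is imposed in
  the definition of \<open>\<B>(A, B)\<close>.
\<close>

type_synonym 'v oper = "'v \<Rightarrow>\<^sub>L 'v"

lift_definition scaleC_oper :: "complex \<Rightarrow> 'v oper \<Rightarrow> 'v :: complex_hilbert_space oper"
  is "\<lambda>a T x. a *\<^sub>C T x"
proof -
  fix a :: complex and T :: "'v \<Rightarrow> 'v"
  assume T: "bounded_linear T"
  have "bounded_linear (\<lambda>x :: 'v. a *\<^sub>C x)"
    by (rule bounded_linear_intro[where K = "cmod a"])
      (simp_all add: scaleC_add_right scaleR_scaleC scaleC_scaleC mult.commute norm_scaleC)
  from bounded_linear_compose[OF this T] show "bounded_linear (\<lambda>x. a *\<^sub>C T x)" .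
qed

global_interpretation coper: vector_space "scaleC_oper :: complex \<Rightarrow> 'v oper \<Rightarrow> 'v :: complex_hilbert_space oper"
  by unfold_locales
    (transfer, simp add: fun_eq_iff scaleC_add_left scaleC_add_right scaleC_scaleC)+

definition closed_csubspace :: "'v :: complex_hilbert_space set \<Rightarrow> bool" where
  "closed_csubspace A \<longleftrightarrow> cvec.subspace A \<and> closed A"

definition bounded_ops :: "'v set \<Rightarrow> 'v set \<Rightarrow> 'v :: complex_hilbert_space oper set" where
  "bounded_ops A B = {T :: 'v oper. (\<forall>a x. T (a *\<^sub>C x) = a *\<^sub>C T x) \<and> (\<forall>x\<in>A. T x \<in> B)
     \<and> (\<forall>x. (\<forall>a\<in>A. cinner a x = 0) \<longrightarrow> T x = 0)}"

definition id_op :: "'v set \<Rightarrow> 'v :: complex_hilbert_space oper" where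
  "id_op A = (THE P :: 'v oper. P \<in> bounded_ops A A \<and> (\<forall>x\<in>A. P x = x))"

definition adj :: "'v oper \<Rightarrow> 'v :: complex_hilbert_space oper" where
  "adj T = (THE S :: 'v oper. \<forall>x y. cinner y (T x) = cinner (S y) x)"

definition inv_op :: "'v set \<Rightarrow> 'v set \<Rightarrow> 'v oper \<Rightarrow> 'v :: complex_hilbert_space oper" where
  "inv_op A B T = (THE S :: 'v oper. S \<in> bounded_ops B A \<and> S o\<^sub>L T = id_op A \<and> T o\<^sub>L S = id_op B)"

definition unitary_op :: "'v set \<Rightarrow> 'v set \<Rightarrow> 'v :: complex_hilbert_space oper \<Rightarrow> bool" where
  "unitary_op A B T \<longleftrightarrow> T \<in> bounded_ops A B \<and> adj T o\<^sub>L T = id_op A \<and> T o\<^sub>L adj T = id_op B"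

definition compact_ops :: "'v set \<Rightarrow> 'v set \<Rightarrow> 'v :: complex_hilbert_space oper set" where
  "compact_ops A B = {T \<in> bounded_ops A B. compact (closure (blinfun_apply T ` (A \<inter> cball 0 1)))}"

definition closed_span :: "'v oper set \<Rightarrow> 'v :: complex_hilbert_space oper set" where
  "closed_span M = closure (coper.span M)"

text \<open>
  The normal functionals on \<open>\<B>(A, B)\<close>: the ultraweakly continuous ones, i.e. those of the form
  \<open>T \<mapsto> \<Sum>n. \<langle>y\<^sub>n, T x\<^sub>n\<rangle>\<close> with square-summable sequences \<open>x\<close> in \<open>A\<close> and \<open>y\<close> in \<open>B\<close>.
\<close>

definition predual :: "'v set \<Rightarrow> 'v set \<Rightarrow> ('v :: complex_hilbert_space oper \<Rightarrow> complex) set" where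
  "predual A B = {(\<lambda>T :: 'v oper. \<Sum>n. cinner (y n) (T (x n))) | x y :: nat \<Rightarrow> 'v.
     range x \<subseteq> A \<and> range y \<subseteq> B \<and> summable (\<lambda>n. (norm (x n))\<^sup>2) \<and> summable (\<lambda>n. (norm (y n))\<^sup>2)}"

definition ultraweakly_closed :: "'v set \<Rightarrow> 'v set \<Rightarrow> 'v :: complex_hilbert_space oper set \<Rightarrow> bool" where
  "ultraweakly_closed A B M \<longleftrightarrow>
     (\<forall>T\<in>bounded_ops A B.
        (\<forall>\<Omega> \<epsilon>. finite \<Omega> \<and> \<Omega> \<subseteq> predual A B \<and> \<epsilon> > 0 \<longrightarrow> (\<exists>S\<in>M. \<forall>\<omega>\<in>\<Omega>. cmod (\<omega> S - \<omega> T) < \<epsilon>))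
        \<longrightarrow> T \<in> M)"

text \<open>
  \<open>t\<close> exhibits \<open>D\<close> as the Hilbert space tensor product of \<open>A\<close> and \<open>B\<close>. Bilinearity of \<open>t\<close> on
  \<open>A \<times> B\<close> is forced by the formula for the inner product.
\<close>

definition is_tensor_product ::
  "'v set \<Rightarrow> 'v set \<Rightarrow> 'v set \<Rightarrow> ('v \<Rightarrow> 'v \<Rightarrow> 'v :: complex_hilbert_space) \<Rightarrow> bool" where
  "is_tensor_product A B D t \<longleftrightarrow>
     (\<forall>a\<in>A. \<forall>b\<in>B. t a b \<in> D) \<and>
     (\<forall>a\<in>A. \<forall>b\<in>B. \<forall>a'\<in>A. \<forall>b'\<in>B. cinner (t a b) (t a' b') = cinner a a' * cinner b b') \<and>
     closure (cvec.span {t a b | a b. a \<in> A \<and> b \<in> B}) = D"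


section \<open>Concrete monoidal \<open>W\<^sup>*\<close>-categories\<close>

text \<open>
  Morphisms are identified with the operators they induce. The field \<open>tvec X Y\<close> is the structure
  map of the strong monoidal functor to Hilbert spaces, given as the map
  \<open>(x, y) \<mapsto> x \<otimes> y\<close> into the Hilbert space of \<open>X \<otimes> Y\<close>; the unit vector \<open>uvec\<close> is the image of
  \<open>1\<close> under the structure map from the complex numbers to the Hilbert space of the unit object.
\<close>

record (overloaded) ('o, 'v :: complex_hilbert_space) cmcat =
  Obj :: "'o set"
  Hilb :: "'o \<Rightarrow> 'v set"
  Hom :: "'o \<Rightarrow> 'o \<Rightarrow> 'v oper set"
  tobj :: "'o \<Rightarrow> 'o \<Rightarrow> 'o"
  uobj :: "'o"
  tvec :: "'o \<Rightarrow> 'o \<Rightarrow> 'v \<Rightarrow> 'v \<Rightarrow> 'v"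
  uvec :: "'v"


abbreviation Hilb2 :: "('o, 'v :: complex_hilbert_space) cmcat \<Rightarrow> 'o \<Rightarrow> 'o \<Rightarrow> 'v set" where
  "Hilb2 C X Y \<equiv> Hilb C (tobj C X Y)"

text \<open>\<open>tmor C X X' Y Y' f g\<close> is \<open>f \<otimes> g : X \<otimes> Y \<rightarrow> X' \<otimes> Y'\<close> for \<open>f : X \<rightarrow> X'\<close> and \<open>g : Y \<rightarrow> Y'\<close>.\<close>

definition tmor ::
  "('o, 'v :: complex_hilbert_space) cmcat \<Rightarrow> 'o \<Rightarrow> 'o \<Rightarrow> 'o \<Rightarrow> 'o \<Rightarrow> 'v oper \<Rightarrow> 'v oper \<Rightarrow> 'v oper" where
  "tmor C X X' Y Y' f g = (THE T :: 'v oper. T \<in> bounded_ops (Hilb2 C X Y) (Hilb2 C X' Y') \<and>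
     (\<forall>x\<in>Hilb C X. \<forall>y\<in>Hilb C Y. T (tvec C X Y x y) = tvec C X' Y' (f x) (g y)))"

abbreviation idm :: "('o, 'v :: complex_hilbert_space) cmcat \<Rightarrow> 'o \<Rightarrow> 'v oper" where
  "idm C X \<equiv> id_op (Hilb C X)"

text \<open>
  Since the functor to Hilbert spaces is strong monoidal, the coherence isomorphisms of the category
  induce the canonical ones of Hilbert spaces. Hence they are no extra data, and pentagon, triangle
  and naturality hold automatically; the requirement is that they are morphisms.
  \<open>assoc C X Y Z : (X \<otimes> Y) \<otimes> Z \<rightarrow> X \<otimes> (Y \<otimes> Z)\<close> is unitary, so its inverse is its adjoint.
\<close>

definition assoc :: "('o, 'v :: complex_hilbert_space) cmcat \<Rightarrow> 'o \<Rightarrow> 'o \<Rightarrow> 'o \<Rightarrow> 'v oper" where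
  "assoc C X Y Z = (THE T :: 'v oper. T \<in> bounded_ops (Hilb2 C (tobj C X Y) Z) (Hilb2 C X (tobj C Y Z)) \<and>
     (\<forall>x\<in>Hilb C X. \<forall>y\<in>Hilb C Y. \<forall>z\<in>Hilb C Z.
        T (tvec C (tobj C X Y) Z (tvec C X Y x y) z) = tvec C X (tobj C Y Z) x (tvec C Y Z y z)))"

abbreviation assoc_inv :: "('o, 'v :: complex_hilbert_space) cmcat \<Rightarrow> 'o \<Rightarrow> 'o \<Rightarrow> 'o \<Rightarrow> 'v oper" where
  "assoc_inv C X Y Z \<equiv> adj (assoc C X Y Z)"

definition lunit :: "('o, 'v :: complex_hilbert_space) cmcat \<Rightarrow> 'o \<Rightarrow> 'v oper" where
  "lunit C X = (THE T :: 'v oper. T \<in> bounded_ops (Hilb2 C (uobj C) X) (Hilb C X) \<and>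
     (\<forall>x\<in>Hilb C X. T (tvec C (uobj C) X (uvec C) x) = x))"

definition runit :: "('o, 'v :: complex_hilbert_space) cmcat \<Rightarrow> 'o \<Rightarrow> 'v oper" where
  "runit C X = (THE T :: 'v oper. T \<in> bounded_ops (Hilb2 C X (uobj C)) (Hilb C X) \<and>
     (\<forall>x\<in>Hilb C X. T (tvec C X (uobj C) x (uvec C)) = x))"

text \<open>
  A faithful normal \<open>*\<close>-functor from a \<open>W\<^sup>*\<close>-category to Hilbert spaces identifies the Hom-spaces
  with ultraweakly closed subspaces of operators. The tensor product of operators is automatically
  bilinear, \<open>*\<close>-preserving and normal.
\<close>

locale concrete_monoidal_wstar_category =
  fixes C :: "('o, 'v :: complex_hilbert_space) cmcat"
  assumes Hilb_closed: "X \<in> Obj C \<Longrightarrow> closed_csubspace (Hilb C X)"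
    and Hom_bounded: "\<lbrakk>X \<in> Obj C; Y \<in> Obj C\<rbrakk> \<Longrightarrow> Hom C X Y \<subseteq> bounded_ops (Hilb C X) (Hilb C Y)"
    and Hom_subspace: "\<lbrakk>X \<in> Obj C; Y \<in> Obj C\<rbrakk> \<Longrightarrow> coper.subspace (Hom C X Y)"
    and Hom_ultraweakly_closed:
      "\<lbrakk>X \<in> Obj C; Y \<in> Obj C\<rbrakk> \<Longrightarrow> ultraweakly_closed (Hilb C X) (Hilb C Y) (Hom C X Y)"
    and Hom_id: "X \<in> Obj C \<Longrightarrow> idm C X \<in> Hom C X X"
    and Hom_comp: "\<lbrakk>X \<in> Obj C; Y \<in> Obj C; Z \<in> Obj C; f \<in> Hom C X Y; g \<in> Hom C Y Z\<rbrakk>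
      \<Longrightarrow> g o\<^sub>L f \<in> Hom C X Z"
    and Hom_adj: "\<lbrakk>X \<in> Obj C; Y \<in> Obj C; f \<in> Hom C X Y\<rbrakk> \<Longrightarrow> adj f \<in> Hom C Y X"
    and tobj_Obj: "\<lbrakk>X \<in> Obj C; Y \<in> Obj C\<rbrakk> \<Longrightarrow> tobj C X Y \<in> Obj C"
    and tvec_tensor: "\<lbrakk>X \<in> Obj C; Y \<in> Obj C\<rbrakk>
      \<Longrightarrow> is_tensor_product (Hilb C X) (Hilb C Y) (Hilb2 C X Y) (tvec C X Y)"
    and tmor_Hom: "\<lbrakk>X \<in> Obj C; X' \<in> Obj C; Y \<in> Obj C; Y' \<in> Obj C; f \<in> Hom C X X'; g \<in> Hom C Y Y'\<rbrakk>
      \<Longrightarrow> tmor C X X' Y Y' f g \<in> Hom C (tobj C X Y) (tobj C X' Y')"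
    and uobj_Obj: "uobj C \<in> Obj C"
    and Hilb_uobj: "norm (uvec C) = 1" "Hilb C (uobj C) = range (\<lambda>a. a *\<^sub>C uvec C)"
    and assoc_Hom: "\<lbrakk>X \<in> Obj C; Y \<in> Obj C; Z \<in> Obj C\<rbrakk>
      \<Longrightarrow> assoc C X Y Z \<in> Hom C (tobj C (tobj C X Y) Z) (tobj C X (tobj C Y Z))"
    and lunit_Hom: "X \<in> Obj C \<Longrightarrow> lunit C X \<in> Hom C (tobj C (uobj C) X) X"
    and runit_Hom: "X \<in> Obj C \<Longrightarrow> runit C X \<in> Hom C (tobj C X (uobj C)) X"

definition unitaries :: "('o, 'v :: complex_hilbert_space) cmcat \<Rightarrow> 'o \<Rightarrow> 'v oper set" where
  "unitaries C X = {T \<in> Hom C X X. unitary_op (Hilb C X) (Hilb C X) T}"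


section \<open>Braidings and leg notation\<close>

type_synonym ('o, 'v) braid = "'o \<Rightarrow> 'o \<Rightarrow> 'v oper"

text \<open>The last two conditions are the hexagon identities, with the associators written out.\<close>

definition braiding :: "('o, 'v :: complex_hilbert_space) cmcat \<Rightarrow> ('o, 'v) braid \<Rightarrow> bool" where
  "braiding C c \<longleftrightarrow>
     (\<forall>X\<in>Obj C. \<forall>Y\<in>Obj C. c X Y \<in> Hom C (tobj C X Y) (tobj C Y X) \<and>
        (\<exists>d\<in>Hom C (tobj C Y X) (tobj C X Y).
           d o\<^sub>L c X Y = idm C (tobj C X Y) \<and> c X Y o\<^sub>L d = idm C (tobj C Y X))) \<and>
     (\<forall>X\<in>Obj C. \<forall>X'\<in>Obj C. \<forall>Y\<in>Obj C. \<forall>Y'\<in>Obj C. \<forall>f\<in>Hom C X X'. \<forall>g\<in>Hom C Y Y'.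
        c X' Y' o\<^sub>L tmor C X X' Y Y' f g = tmor C Y Y' X X' g f o\<^sub>L c X Y) \<and>
     (\<forall>U\<in>Obj C. \<forall>V\<in>Obj C. \<forall>W\<in>Obj C.
        assoc C V W U o\<^sub>L c U (tobj C V W) o\<^sub>L assoc C U V W =
        tmor C V V (tobj C U W) (tobj C W U) (idm C V) (c U W) o\<^sub>L assoc C V U W o\<^sub>L
        tmor C (tobj C U V) (tobj C V U) W W (c U V) (idm C W)) \<and>
     (\<forall>U\<in>Obj C. \<forall>V\<in>Obj C. \<forall>W\<in>Obj C.
        assoc_inv C W U V o\<^sub>L c (tobj C U V) W o\<^sub>L assoc_inv C U V W =
        tmor C (tobj C U W) (tobj C W U) V V (c U W) (idm C V) o\<^sub>L assoc_inv C U W V o\<^sub>L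
        tmor C U U (tobj C V W) (tobj C W V) (idm C U) (c V W))"

abbreviation binv :: "('o, 'v :: complex_hilbert_space) cmcat \<Rightarrow> ('o, 'v) braid \<Rightarrow> ('o, 'v) braid" where
  "binv C c X Y \<equiv> inv_op (Hilb2 C X Y) (Hilb2 C Y X) (c X Y)"

text \<open>
  Triple tensor products are bracketed to the left. For \<open>T : A \<otimes> B \<rightarrow> A' \<otimes> B'\<close>,
  \<open>leg12 C A B A' B' D T\<close> is \<open>T\<^sub>1\<^sub>2 : (A \<otimes> B) \<otimes> D \<rightarrow> (A' \<otimes> B') \<otimes> D\<close>; for an endomorphism
  \<open>T\<close> of \<open>B \<otimes> D\<close>, \<open>leg23 C A B D T\<close> is \<open>T\<^sub>2\<^sub>3\<close> on \<open>(A \<otimes> B) \<otimes> D\<close>; for an endomorphism \<open>T\<close> of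
  \<open>A \<otimes> B\<close>, \<open>leg13 C c A M B T\<close> and \<open>leg13u C c A M B T\<close> are \<open>T\<^sub>1\<^sub>3\<close> and its underlined variant on
  \<open>(A \<otimes> M) \<otimes> B\<close>.
\<close>

definition leg12 :: "('o, 'v :: complex_hilbert_space) cmcat \<Rightarrow>
    'o \<Rightarrow> 'o \<Rightarrow> 'o \<Rightarrow> 'o \<Rightarrow> 'o \<Rightarrow> 'v oper \<Rightarrow> 'v oper" where
  "leg12 C A B A' B' D T = tmor C (tobj C A B) (tobj C A' B') D D T (idm C D)"

definition leg23 :: "('o, 'v :: complex_hilbert_space) cmcat \<Rightarrow> 'o \<Rightarrow> 'o \<Rightarrow> 'o \<Rightarrow> 'v oper \<Rightarrow> 'v oper" where
  "leg23 C A B D T =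
     assoc_inv C A B D o\<^sub>L tmor C A A (tobj C B D) (tobj C B D) (idm C A) T o\<^sub>L assoc C A B D"

definition leg13 :: "('o, 'v :: complex_hilbert_space) cmcat \<Rightarrow> ('o, 'v) braid \<Rightarrow>
    'o \<Rightarrow> 'o \<Rightarrow> 'o \<Rightarrow> 'v oper \<Rightarrow> 'v oper" where
  "leg13 C c A M B T =
     leg12 C M A A M B (binv C c A M) o\<^sub>L leg23 C M A B T o\<^sub>L leg12 C A M M A B (c A M)"

definition leg13u :: "('o, 'v :: complex_hilbert_space) cmcat \<Rightarrow> ('o, 'v) braid \<Rightarrow>
    'o \<Rightarrow> 'o \<Rightarrow> 'o \<Rightarrow> 'v oper \<Rightarrow> 'v oper" where
  "leg13u C c A M B T =
     leg12 C M A A M B (c M A) o\<^sub>L leg23 C M A B T o\<^sub>L leg12 C A M M A B (binv C c M A)"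


section \<open>Slices and regularity\<close>

text \<open>
  \<open>lcreate C X Y x\<close> is the operator \<open>y \<mapsto> x \<otimes> y\<close>. For \<open>T : X \<otimes> Y \<rightarrow> X' \<otimes> Y'\<close> and a normal functional
  \<open>\<omega>\<close> on \<open>\<B>(Y, Y')\<close>, \<open>slice C X Y X' Y' \<omega> T\<close> is \<open>(id \<otimes> \<omega>)(T) : X \<rightarrow> X'\<close>.
\<close>

definition lcreate :: "('o, 'v :: complex_hilbert_space) cmcat \<Rightarrow> 'o \<Rightarrow> 'o \<Rightarrow> 'v \<Rightarrow> 'v oper" where
  "lcreate C X Y x = (THE R :: 'v oper. R \<in> bounded_ops (Hilb C Y) (Hilb2 C X Y) \<and>
     (\<forall>y\<in>Hilb C Y. R y = tvec C X Y x y))"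

definition slice :: "('o, 'v :: complex_hilbert_space) cmcat \<Rightarrow> 'o \<Rightarrow> 'o \<Rightarrow> 'o \<Rightarrow> 'o \<Rightarrow>
    ('v oper \<Rightarrow> complex) \<Rightarrow> 'v oper \<Rightarrow> 'v oper" where
  "slice C X Y X' Y' \<omega> T = (THE S :: 'v oper. S \<in> bounded_ops (Hilb C X) (Hilb C X') \<and>
     (\<forall>x\<in>Hilb C X. \<forall>x'\<in>Hilb C X'.
        cinner x' (S x) = \<omega> (adj (lcreate C X' Y' x') o\<^sub>L T o\<^sub>L lcreate C X Y x)))"

definition slice_span :: "('o, 'v :: complex_hilbert_space) cmcat \<Rightarrow> 'o \<Rightarrow> 'o \<Rightarrow> 'o \<Rightarrow> 'o \<Rightarrow>
    'v oper \<Rightarrow> 'v oper set" where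
  "slice_span C X Y X' Y' T =
     closed_span ((\<lambda>\<omega>. slice C X Y X' Y' \<omega> T) ` predual (Hilb C Y) (Hilb C Y'))"

text \<open>Regularity conditions on a family \<open>c\<close> that is a braiding on \<open>C\<close>.\<close>

definition semi_regular_braiding :: "('o, 'v :: complex_hilbert_space) cmcat \<Rightarrow> ('o, 'v) braid \<Rightarrow> bool" where
  "semi_regular_braiding C c \<longleftrightarrow> (\<forall>X\<in>Obj C. \<forall>Y\<in>Obj C.
     unitary_op (Hilb2 C X Y) (Hilb2 C Y X) (c X Y) \<and>
     compact_ops (Hilb C X) (Hilb C Y) \<subseteq> slice_span C X Y Y X (c X Y))"

definition regular_braiding :: "('o, 'v :: complex_hilbert_space) cmcat \<Rightarrow> ('o, 'v) braid \<Rightarrow> bool" where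
  "regular_braiding C c \<longleftrightarrow> (\<forall>X\<in>Obj C. \<forall>Y\<in>Obj C.
     unitary_op (Hilb2 C X Y) (Hilb2 C Y X) (c X Y) \<and>
     compact_ops (Hilb C X) (Hilb C Y) = slice_span C X Y Y X (c X Y))"


section \<open>Multiplicative unitaries and Yetter-Drinfeld modules\<close>

definition multiplicative_unitary :: "('o, 'v :: complex_hilbert_space) cmcat \<Rightarrow> ('o, 'v) braid \<Rightarrow>
    'o \<Rightarrow> 'v oper \<Rightarrow> bool" where
  "multiplicative_unitary C c L F \<longleftrightarrow> F \<in> unitaries C (tobj C L L) \<and>
     leg23 C L L L F o\<^sub>L leg12 C L L L L L F =
     leg12 C L L L L L F o\<^sub>L leg13 C c L L L F o\<^sub>L leg23 C L L L F"

definition mu_algebra :: "('o, 'v :: complex_hilbert_space) cmcat \<Rightarrow> ('o, 'v) braid \<Rightarrow>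
    'o \<Rightarrow> 'v oper \<Rightarrow> 'v oper set" where
  "mu_algebra C c L F = slice_span C L L L L (binv C c L L o\<^sub>L F)"

definition semi_regular_mu :: "('o, 'v :: complex_hilbert_space) cmcat \<Rightarrow> ('o, 'v) braid \<Rightarrow>
    'o \<Rightarrow> 'v oper \<Rightarrow> bool" where
  "semi_regular_mu C c L F \<longleftrightarrow>
     multiplicative_unitary C c L F \<and> compact_ops (Hilb C L) (Hilb C L) \<subseteq> mu_algebra C c L F"

definition regular_mu :: "('o, 'v :: complex_hilbert_space) cmcat \<Rightarrow> ('o, 'v) braid \<Rightarrow>
    'o \<Rightarrow> 'v oper \<Rightarrow> bool" where
  "regular_mu C c L F \<longleftrightarrow>
     multiplicative_unitary C c L F \<and> mu_algebra C c L F = compact_ops (Hilb C L) (Hilb C L)"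

type_synonym ('o, 'v) ydobj = "'o \<times> 'v oper \<times> 'v oper"

definition yd_module :: "('o, 'v :: complex_hilbert_space) cmcat \<Rightarrow> ('o, 'v) braid \<Rightarrow>
    'o \<Rightarrow> 'v oper \<Rightarrow> ('o, 'v) ydobj \<Rightarrow> bool" where
  "yd_module C c L F = (\<lambda>(H, U, V).
     H \<in> Obj C \<and> U \<in> unitaries C (tobj C H L) \<and> V \<in> unitaries C (tobj C L H) \<and>
     leg23 C H L L F o\<^sub>L leg12 C H L H L L U =
       leg12 C H L H L L U o\<^sub>L leg13 C c H L L U o\<^sub>L leg23 C H L L F \<and>
     leg23 C L L H V o\<^sub>L leg12 C L L L L H F =
       leg12 C L L L L H F o\<^sub>L leg13 C c L L H V o\<^sub>L leg23 C L L H V \<and>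
     leg12 C L H L H L V o\<^sub>L leg13 C c L H L F o\<^sub>L leg23 C L H L U =
       leg23 C L H L U o\<^sub>L leg13u C c L H L F o\<^sub>L leg12 C L H L H L V)"

definition yd_hom :: "('o, 'v :: complex_hilbert_space) cmcat \<Rightarrow> 'o \<Rightarrow>
    ('o, 'v) ydobj \<Rightarrow> ('o, 'v) ydobj \<Rightarrow> 'v oper set" where
  "yd_hom C L = (\<lambda>(H1, U1, V1) (H2, U2, V2). {f \<in> Hom C H1 H2.
     tmor C H1 H2 L L f (idm C L) o\<^sub>L U1 = U2 o\<^sub>L tmor C H1 H2 L L f (idm C L) \<and>
     tmor C L L H1 H2 (idm C L) f o\<^sub>L V1 = V2 o\<^sub>L tmor C L L H1 H2 (idm C L) f})"

text \<open>
  The second operator of a tensor product acts on \<open>L \<otimes> (H1 \<otimes> H2)\<close>, whereas legs are taken on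
  \<open>(L \<otimes> H1) \<otimes> H2\<close>; hence the conjugation by an associator.
\<close>

definition yd_tensor :: "('o, 'v :: complex_hilbert_space) cmcat \<Rightarrow> ('o, 'v) braid \<Rightarrow> 'o \<Rightarrow>
    ('o, 'v) ydobj \<Rightarrow> ('o, 'v) ydobj \<Rightarrow> ('o, 'v) ydobj" where
  "yd_tensor C c L = (\<lambda>(H1, U1, V1) (H2, U2, V2).
     (tobj C H1 H2,
      leg13 C c H1 H2 L U1 o\<^sub>L leg23 C H1 H2 L U2,
      assoc C L H1 H2 o\<^sub>L leg13u C c L H1 H2 V2 o\<^sub>L leg12 C L H1 L H1 H2 V1
        o\<^sub>L assoc_inv C L H1 H2))"

definition yd :: "('o, 'v :: complex_hilbert_space) cmcat \<Rightarrow> ('o, 'v) braid \<Rightarrow> 'o \<Rightarrow> 'v oper \<Rightarrow>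
    (('o, 'v) ydobj, 'v) cmcat" where
  "yd C c L F = \<lparr>
     Obj = Collect (yd_module C c L F),
     Hilb = (\<lambda>x. Hilb C (fst x)),
     Hom = yd_hom C L,
     tobj = yd_tensor C c L,
     uobj = (uobj C, idm C (tobj C (uobj C) L), idm C (tobj C L (uobj C))),
     tvec = (\<lambda>x y. tvec C (fst x) (fst y)),
     uvec = uvec C\<rparr>"

text \<open>\<open>yd_star_eq C c L x y W\<close>: \<open>W\<close> has the characterizing property of the unitary \<open>V\<^sub>K * U\<^sub>H\<close>.
  The definite description below is meaningful only if exactly one such \<open>W\<close> exists. This fails,
  for instance, if the Hilbert space of \<open>L\<close> is zero, and a \<open>W\<close> that exists as an operator need
  not be a morphism of \<open>C\<close>.\<close>

definition yd_star_eq :: "('o, 'v :: complex_hilbert_space) cmcat \<Rightarrow> ('o, 'v) braid \<Rightarrow> 'o \<Rightarrow>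
    ('o, 'v) ydobj \<Rightarrow> ('o, 'v) ydobj \<Rightarrow> 'v oper \<Rightarrow> bool" where
  "yd_star_eq C c L = (\<lambda>(H, UH, VH) (K, UK, VK) W.
     W \<in> unitaries C (tobj C H K) \<and>
     leg13 C c H L K W =
       adj (leg12 C H L H L K UH) o\<^sub>L leg23 C H L K VK o\<^sub>L
       leg12 C H L H L K UH o\<^sub>L adj (leg23 C H L K VK))"

definition yd_star :: "('o, 'v :: complex_hilbert_space) cmcat \<Rightarrow> ('o, 'v) braid \<Rightarrow> 'o \<Rightarrow>
    ('o, 'v) ydobj \<Rightarrow> ('o, 'v) ydobj \<Rightarrow> 'v oper" where
  "yd_star C c L x y = (THE W. yd_star_eq C c L x y W)"

definition yd_braiding :: "('o, 'v :: complex_hilbert_space) cmcat \<Rightarrow> ('o, 'v) braid \<Rightarrow> 'o \<Rightarrow>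
    (('o, 'v) ydobj, 'v) braid" where
  "yd_braiding C c L x y = binv C c (fst y) (fst x) o\<^sub>L yd_star C c L x y"

end

(*
  Put U' = c^-1 U for a unitary U on a tensor product of two objects. Naturality and the hexagon
  identities turn the equation V_23 U_12 = U_12 X_13 V_23 on H, L, K into the braid relation
    V'_12 (c^-1)_23 U'_12 = U'_23 X'_12 V'_23.
  Slice both sides in the last two legs with vector functionals and take closed spans. On the right
  the outer unitaries act on the sliced legs only, which leaves the span S(X) of the slices of X'.
  On the left, a rank-one slice of c^-1 in the middle splits the expression into a product of a
  slice of V' and a slice of U'. Hence S(X) contains S(V) S(U) if c is semi-regular, and equals its
  closed span if c is regular. The cases (V, U, X) = (F, U, U), (V, F, V)
  and (V, U, V * U) transfer the hypothesis on S(F) to S(U) and S(V), and then to S(V * U), the slices of the braiding.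
*)

theory Submission
  imports Defs
begin

section \<open>Hilbert space geometry\<close>

text \<open>Products S(V) S(U) alone do not produce compact operators from a hypothesis on S(F). In
  the case (F, U, U) one obtains |l><u^* l'| for u in S(U) and l, l' in L; since U' is unitary, the
  vectors u^* l' are total in H, and so S(U) contains all rank-one operators in its closed span. The
  case (V, F, V) is the mirror image. In the regular case an upper bound is needed for S(V) only:
  S(V) lies in the closed span of S(V) S(F), hence in the compact operators, and these absorb the
  bounded factor from S(U) in the last step. The middle factor is an inverse braiding while
  regularity speaks of c; as c is unitary, taking adjoints exchanges the slices of c_{K,H} and those
  of its inverse. Recovering S(X) from the sliced right side needs a nonzero vector of L. If L is
  the zero space, uniqueness of V * U forces V * U = 0, so that H \<otimes> K vanishes and nothing
  is left to show.\<close>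

lemma cinner_add_left: "cinner (x + y) z = cinner x z + cinner y (z :: 'v :: complex_hilbert_space)"
  by (metis cinner_add_right cinner_commute complex_cnj_add)

lemma cinner_scaleC_left: "cinner (a *\<^sub>C x) y = cnj a * cinner x (y :: 'v :: complex_hilbert_space)"
  by (metis cinner_scaleC_right cinner_commute complex_cnj_mult)

lemma cinner_zero_right [simp]: "cinner x (0 :: 'v :: complex_hilbert_space) = 0"
  using cinner_add_right[of x 0 0] by simp

lemma cinner_zero_left [simp]: "cinner (0 :: 'v :: complex_hilbert_space) x = 0"
  using cinner_add_left[of 0 0 x] by simp

lemma cinner_minus_right: "cinner x (- y :: 'v :: complex_hilbert_space) = - cinner x y"
  using cinner_add_right[of x y "- y"] by (simp add: eq_neg_iff_add_eq_0 add.commute)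

lemma cinner_minus_left: "cinner (- x :: 'v :: complex_hilbert_space) y = - cinner x y"
  using cinner_add_left[of x "- x" y] by (simp add: eq_neg_iff_add_eq_0 add.commute)

lemma cinner_diff_right: "cinner x (y - z :: 'v :: complex_hilbert_space) = cinner x y - cinner x z"
  using cinner_add_right[of x y "- z"] by (simp add: cinner_minus_right)

lemma cinner_diff_left: "cinner (x - y :: 'v :: complex_hilbert_space) z = cinner x z - cinner y z"
  using cinner_add_left[of x "- y" z] by (simp add: cinner_minus_left)

lemmas cinner_expand = cinner_add_left cinner_add_right cinner_diff_left cinner_diff_right
  cinner_scaleC_left cinner_scaleC_right

lemma cinner_sum_right: "cinner x (\<Sum>i\<in>I. f i) = (\<Sum>i\<in>I. cinner x (f i :: 'v :: complex_hilbert_space))"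
  by (induction I rule: infinite_finite_induct) (simp_all add: cinner_add_right)

lemma cinner_sum_left: "cinner (\<Sum>i\<in>I. f i) x = (\<Sum>i\<in>I. cinner (f i :: 'v :: complex_hilbert_space) x)"
  by (induction I rule: infinite_finite_induct) (simp_all add: cinner_add_left)

lemma cinner_eq_zero_iff [simp]: "cinner x x = 0 \<longleftrightarrow> x = (0 :: 'v :: complex_hilbert_space)"
  by (simp add: cinner_self)

lemma norm_sq_cinner: "(norm (x :: 'v :: complex_hilbert_space))\<^sup>2 = Re (cinner x x)"
  by (simp add: cinner_self)

lemma cinner_zero_commute: "cinner x y = 0 \<longleftrightarrow> cinner y (x :: 'v :: complex_hilbert_space) = 0"
  by (metis cinner_commute complex_cnj_zero)

lemma norm_add_orthogonal:
  fixes x y :: "'v :: complex_hilbert_space"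
  assumes "cinner x y = 0"
  shows "(norm (x + y))\<^sup>2 = (norm x)\<^sup>2 + (norm y)\<^sup>2"
  using assms cinner_zero_commute[of x y] by (simp add: norm_sq_cinner cinner_expand)

lemma norm_le_add_orthogonal:
  fixes x y :: "'v :: complex_hilbert_space"
  assumes "cinner x y = 0"
  shows "norm x \<le> norm (x + y)"
  by (rule power2_le_imp_le) (simp_all add: norm_add_orthogonal[OF assms])

text \<open>The component of y along x is orthogonal to the remainder, so Pythagoras bounds its norm
  by that of y.\<close>

lemma cauchy_schwarz: "cmod (cinner x y) \<le> norm x * norm (y :: 'v :: complex_hilbert_space)"
proof (cases "x = 0")
  case False
  \<comment> \<open>The coefficient of the orthogonal projection of y to the line through x.\<close>
  define a where "a = cinner x y / cinner x x"
  have "cinner (a *\<^sub>C x) (y - a *\<^sub>C x) = 0"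
    using False by (simp add: a_def cinner_expand)
  then have "norm (a *\<^sub>C x) \<le> norm y"
    using norm_le_add_orthogonal[of "a *\<^sub>C x" "y - a *\<^sub>C x"] by simp
  moreover have "cmod a * (norm x)\<^sup>2 = cmod (cinner x y)"
    using False by (simp add: a_def norm_divide cinner_self norm_power)
  moreover have "norm (a *\<^sub>C x) * norm x = cmod a * (norm x)\<^sup>2"
    by (simp add: norm_scaleC power2_eq_square)
  ultimately show ?thesis
    by (metis mult.commute mult_right_mono norm_ge_zero)
qed simp

lemma bounded_bilinear_cinner: "bounded_bilinear (cinner :: 'v \<Rightarrow> 'v :: complex_hilbert_space \<Rightarrow> complex)"
proof (rule bounded_bilinear.intro)
  show "\<exists>K. \<forall>a b. cmod (cinner a b) \<le> norm a * norm (b :: 'v) * K"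
    by (rule exI[of _ 1]) (simp add: cauchy_schwarz)
qed (simp_all add: cinner_expand scaleR_scaleC scaleR_conv_of_real)

lemmas bounded_linear_cinner_right = bounded_bilinear.bounded_linear_right[OF bounded_bilinear_cinner]

lemma continuous_on_cinner [continuous_intros]:
  "continuous_on S f \<Longrightarrow> continuous_on S g \<Longrightarrow>
    continuous_on S (\<lambda>x. cinner (f x) (g x :: 'v :: complex_hilbert_space))"
  by (rule bounded_bilinear.continuous_on[OF bounded_bilinear_cinner])

lemma bounded_bilinear_scaleC: "bounded_bilinear (scaleC :: complex \<Rightarrow> 'v \<Rightarrow> 'v :: complex_hilbert_space)"
proof (rule bounded_bilinear.intro)
  show "\<exists>K. \<forall>a b. norm (a *\<^sub>C (b :: 'v)) \<le> norm a * norm b * K"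
    by (rule exI[of _ 1]) (simp add: norm_scaleC)
qed (simp_all add: scaleC_add_left scaleC_add_right scaleR_scaleC scaleC_scaleC scaleR_conv_of_real mult.commute)

lemma cinner_right_ext:
  "(\<And>z. cinner z x = cinner z y) \<Longrightarrow> x = (y :: 'v :: complex_hilbert_space)"
  using cinner_eq_zero_iff[of "x - y"] by (simp add: cinner_diff_right)

lemma cinner_left_ext:
  "(\<And>z. cinner x z = cinner y z) \<Longrightarrow> x = (y :: 'v :: complex_hilbert_space)"
  using cinner_eq_zero_iff[of "x - y"] by (simp add: cinner_diff_left)

lemma closed_csubspaceD:
  assumes "closed_csubspace A"
  shows "0 \<in> A" "x \<in> A \<Longrightarrow> y \<in> A \<Longrightarrow> x + y \<in> A" "x \<in> A \<Longrightarrow> a *\<^sub>C x \<in> A" "closed A"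
    "x \<in> A \<Longrightarrow> y \<in> A \<Longrightarrow> x - y \<in> A"
  using assms cvec.subspace_diff
  by (auto simp: closed_csubspace_def cvec.subspace_def)

lemma closed_csubspace_sum:
  "closed_csubspace A \<Longrightarrow> (\<And>i. i \<in> I \<Longrightarrow> f i \<in> A) \<Longrightarrow> (\<Sum>i\<in>I. f i) \<in> A"
  by (simp add: closed_csubspace_def cvec.subspace_sum)

lemma closed_csubspace_closure_span: "closed_csubspace (closure (cvec.span (S :: 'v :: complex_hilbert_space set)))"
proof -
  let ?S = "cvec.span S"
  have "x + y \<in> closure ?S" if xy: "x \<in> closure ?S" "y \<in> closure ?S" for x y
  proof -
    from xy obtain f g where "\<forall>n. f n \<in> ?S" "f \<longlonglongrightarrow> x" "\<forall>n. g n \<in> ?S" "g \<longlonglongrightarrow> y"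
      by (auto simp: closure_sequential)
    then show ?thesis unfolding closure_sequential
      by (intro exI[of _ "\<lambda>n. f n + g n"]) (auto intro: cvec.span_add tendsto_add)
  qed
  moreover have "a *\<^sub>C x \<in> closure ?S" if x: "x \<in> closure ?S" for x a
  proof -
    from x obtain f where "\<forall>n. f n \<in> ?S" "f \<longlonglongrightarrow> x"
      by (auto simp: closure_sequential)
    then show ?thesis unfolding closure_sequential
      by (intro exI[of _ "\<lambda>n. a *\<^sub>C f n"])
        (auto intro: cvec.span_scale bounded_bilinear.tendsto[OF bounded_bilinear_scaleC tendsto_const])
  qed
  moreover have "0 \<in> closure ?S"
    using cvec.span_zero closure_subset by blast
  ultimately show ?thesis
    by (auto simp: closed_csubspace_def cvec.subspace_def)
qed

text \<open>The density principle behind most proofs below: a property whose solution set is a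
  closed subspace need only be checked on a total set.\<close>

lemma closure_span_minimal:
  "closed_csubspace A \<Longrightarrow> S \<subseteq> A \<Longrightarrow> closure (cvec.span S) \<subseteq> A"
  by (simp add: closed_csubspace_def closure_minimal cvec.span_minimal)

lemma closure_span_superset: "S \<subseteq> closure (cvec.span S)"
  using closure_subset cvec.span_superset by blast

section \<open>Orthogonal projections and the Riesz representation theorem\<close>

lemma parallelogram:
  fixes x y :: "'v :: complex_hilbert_space"
  shows "(norm (x + y))\<^sup>2 + (norm (x - y))\<^sup>2 = 2 * (norm x)\<^sup>2 + 2 * (norm y)\<^sup>2"
  by (simp add: norm_sq_cinner cinner_expand)

text \<open>A minimizing sequence is Cauchy: the midpoint of two of its members lies in A and is no
  closer to x than the infimum, so the parallelogram law bounds their distance.\<close>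

lemma exists_nearest_point:
  fixes A :: "'v :: complex_hilbert_space set"
  assumes A: "closed_csubspace A"
  shows "\<exists>p\<in>A. \<forall>a\<in>A. norm (x - p) \<le> norm (x - a)"
proof -
  define d where "d = (INF a\<in>A. (norm (x - a))\<^sup>2)"
  have ne: "A \<noteq> {}" using closed_csubspaceD(1)[OF A] by auto
  have bdd: "bdd_below ((\<lambda>a. (norm (x - a))\<^sup>2) ` A)" by (rule bdd_belowI[of _ 0]) auto
  have d_le: "d \<le> (norm (x - a))\<^sup>2" if "a \<in> A" for a
    unfolding d_def by (rule cINF_lower[OF bdd that])
  have "\<exists>a\<in>A. (norm (x - a))\<^sup>2 < d + 1 / Suc n" for n
    using cINF_less_iff[OF ne bdd, of "d + 1 / Suc n"] by (simp add: d_def)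
  then obtain f where f: "\<And>n. f n \<in> A" "\<And>n. (norm (x - f n))\<^sup>2 < d + 1 / Suc n" by metis
  have diff: "(norm (f m - f n))\<^sup>2 \<le> 2 / Suc m + 2 / Suc n" for m n
  proof -
    let ?h = "(1/2) *\<^sub>R (f m + f n)"
    have "?h \<in> A" by (simp add: scaleR_scaleC closed_csubspaceD[OF A] f)
    have "(x - f m) + (x - f n) = 2 *\<^sub>R (x - ?h)"
      by (simp add: algebra_simps scaleR_2)
    then have "(norm ((x - f m) + (x - f n)))\<^sup>2 = 4 * (norm (x - ?h))\<^sup>2"
      by (simp add: power2_eq_square)
    moreover have "d \<le> (norm (x - ?h))\<^sup>2" using d_le[OF \<open>?h \<in> A\<close>] .
    ultimately have "4 * d + (norm ((x - f m) - (x - f n)))\<^sup>2 \<le> 2 * (norm (x - f m))\<^sup>2 + 2 * (norm (x - f n))\<^sup>2"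
      using parallelogram[of "x - f m" "x - f n"] by linarith
    moreover have "norm ((x - f m) - (x - f n)) = norm (f m - f n)"
      by (simp add: norm_minus_commute)
    moreover have "2 * (1 / real (Suc m)) = 2 / Suc m" "2 * (1 / real (Suc n)) = 2 / Suc n" by simp_all
    ultimately show ?thesis using f(2)[of m] f(2)[of n] by (smt (verit))
  qed
  have "Cauchy f"
  proof (rule CauchyI)
    fix e :: real assume e: "e > 0"
    \<comment> \<open>For m, n \<ge> M the bound \<open>diff\<close> is at most 4 / (M + 1), hence
      the quarter.\<close>
    obtain M where M: "1 / Suc M < e\<^sup>2 / 4" using nat_approx_posE[of "e\<^sup>2 / 4"] e by auto
    have "norm (f m - f n) < e" if "m \<ge> M" "n \<ge> M" for m n
    proof -
      have "1 / Suc m \<le> 1 / Suc M" "1 / Suc n \<le> 1 / Suc M" using that by (simp_all add: frac_le)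
      moreover have "2 / real (Suc m) = 2 * (1 / real (Suc m))" "2 / real (Suc n) = 2 * (1 / real (Suc n))"
        by simp_all
      ultimately have "(norm (f m - f n))\<^sup>2 < e\<^sup>2" using diff[of m n] M by linarith
      then show ?thesis using e by (simp add: power_less_imp_less_base)
    qed
    then show "\<exists>M. \<forall>m\<ge>M. \<forall>n\<ge>M. norm (f m - f n) < e" by blast
  qed
  then obtain p where p: "f \<longlonglongrightarrow> p" by (auto simp: Cauchy_convergent_iff convergent_def)
  have "p \<in> A" using closed_sequentially[OF closed_csubspaceD(4)[OF A] _ p] f(1) by blast
  moreover have "(norm (x - p))\<^sup>2 \<le> d"
  proof (rule LIMSEQ_le)
    show "(\<lambda>n. (norm (x - f n))\<^sup>2) \<longlonglongrightarrow> (norm (x - p))\<^sup>2" by (intro tendsto_intros p)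
    have "(\<lambda>n. d + 1 / Suc n) \<longlonglongrightarrow> d + 0"
      by (intro tendsto_intros LIMSEQ_Suc[OF lim_1_over_n])
    then show "(\<lambda>n. d + 1 / Suc n) \<longlonglongrightarrow> d" by simp
    show "\<exists>N. \<forall>n\<ge>N. (norm (x - f n))\<^sup>2 \<le> d + 1 / real (Suc n)" using f(2) less_imp_le by blast
  qed
  then have "norm (x - p) \<le> norm (x - a)" if "a \<in> A" for a
    by (meson order_trans d_le[OF that] power2_le_imp_le norm_ge_zero)
  ultimately show ?thesis by blast
qed

text \<open>If x - p had a nonzero component s a along some a in A, then p + s a would be closer to
  x than p, by Pythagoras.\<close>

lemma exists_projection:
  fixes A :: "'v :: complex_hilbert_space set"
  assumes A: "closed_csubspace A"
  shows "\<exists>p\<in>A. \<forall>a\<in>A. cinner a (x - p) = 0"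
proof -
  obtain p where p: "p \<in> A" "\<And>a. a \<in> A \<Longrightarrow> norm (x - p) \<le> norm (x - a)"
    using exists_nearest_point[OF A] by blast
  have "cinner a (x - p) = 0" if a: "a \<in> A" for a
  proof (cases "a = 0")
    case False
    define s where "s = cinner a (x - p) / cinner a a"
    have orth: "cinner (x - (p + s *\<^sub>C a)) (s *\<^sub>C a) = 0"
      using False cinner_zero_commute[of a "x - (p + s *\<^sub>C a)"] by (simp add: s_def cinner_expand field_simps)
    have "(norm (x - p))\<^sup>2 = (norm (x - (p + s *\<^sub>C a)))\<^sup>2 + (norm (s *\<^sub>C a))\<^sup>2"
      using norm_add_orthogonal[OF orth] by simp
    moreover have "(norm (x - p))\<^sup>2 \<le> (norm (x - (p + s *\<^sub>C a)))\<^sup>2"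
      by (intro power_mono p(2)) (simp_all add: closed_csubspaceD[OF A] p(1) a)
    ultimately have "s *\<^sub>C a = 0" by simp
    then have "s = 0" using False by (metis norm_scaleC norm_eq_zero mult_eq_0_iff)
    then show ?thesis using False by (simp add: s_def)
  qed simp
  then show ?thesis using p(1) by blast
qed

text \<open>A vector orthogonal to the kernel, a closed hyperplane unless f = 0, represents f up to
  a scalar.\<close>

lemma riesz:
  fixes f :: "'v :: complex_hilbert_space \<Rightarrow> complex"
  assumes f: "bounded_linear f" and fC: "\<And>a x. f (a *\<^sub>C x) = a * f x"
  shows "\<exists>w. \<forall>x. f x = cinner w x"
proof (cases "\<exists>z. f z \<noteq> 0")
  case True
  then obtain z where z: "f z \<noteq> 0" by blast
  note lin = linear_0[OF bounded_linear.linear[OF f]] linear_add[OF bounded_linear.linear[OF f]]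
    linear_diff[OF bounded_linear.linear[OF f]]
  have "closed {x. f x = 0}"
    by (intro closed_Collect_eq bounded_linear.continuous_on[OF f] continuous_intros)
  then have ker: "closed_csubspace {x. f x = 0}"
    by (simp add: closed_csubspace_def cvec.subspace_def lin fC)
  obtain p where p: "f p = 0" "\<And>a. f a = 0 \<Longrightarrow> cinner a (z - p) = 0"
    using exists_projection[OF ker, of z] by auto
  define w where "w = z - p"
  have fw: "f w \<noteq> 0" using z p by (simp add: w_def lin)
  then have w: "w \<noteq> 0" by (auto simp: lin)
  \<comment> \<open>The scalar is fixed by the value of f at w; it is conjugated because the inner
    product is antilinear in its first argument.\<close>
  have "f x = cinner ((cnj (f w) / cinner w w) *\<^sub>C w) x" for x
  proof -
    have "f (x - (f x / f w) *\<^sub>C w) = 0" using fw by (simp add: lin fC)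
    from p(2)[OF this] have "cinner w (x - (f x / f w) *\<^sub>C w) = 0"
      by (simp add: w_def cinner_zero_commute)
    then have "cinner w x = f x / f w * cinner w w" by (simp add: cinner_expand)
    moreover have "cnj (cinner w w) = cinner w w" using cinner_commute[of w w] by simp
    ultimately show ?thesis using w fw by (simp add: cinner_expand)
  qed
  then show ?thesis by blast
next
  case False
  then show ?thesis by (intro exI[of _ 0]) simp
qed

section \<open>Adjoints and corners of the operator algebra\<close>

text \<open>The operator type only knows real linearity. Complex linearity is what makes the
  functionals x \<mapsto> <y, T x> accessible to the Riesz theorem, hence \<open>adj\<close>
  meaningful.\<close>

definition clin :: "'v :: complex_hilbert_space oper \<Rightarrow> bool" where
  "clin T \<longleftrightarrow> (\<forall>a x. T (a *\<^sub>C x) = a *\<^sub>C T x)"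

lemma scaleC_oper_apply [simp]: "blinfun_apply (scaleC_oper a T) x = a *\<^sub>C T x"
  by transfer simp

lemma clinD: "clin T \<Longrightarrow> T (a *\<^sub>C x) = a *\<^sub>C T x"
  by (simp add: clin_def)

lemma clin_intros [intro, simp]:
  "clin 0" "clin S \<Longrightarrow> clin T \<Longrightarrow> clin (S + T)" "clin S \<Longrightarrow> clin T \<Longrightarrow> clin (S - T)"
  "clin T \<Longrightarrow> clin (scaleC_oper b T)" "clin S \<Longrightarrow> clin T \<Longrightarrow> clin (S o\<^sub>L T)"
  by (simp_all add: clin_def blinfun.add_left blinfun.diff_left cvec.scale_right_distrib
      cvec.scale_right_diff_distrib scaleC_scaleC mult.commute)

text \<open>The Riesz theorem is applied to x \<mapsto> <y, T x> for each y; the norm bound follows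
  from Cauchy-Schwarz at x = s y.\<close>

lemma adj_exists:
  assumes T: "clin (T :: 'v :: complex_hilbert_space oper)"
  shows "\<exists>S :: 'v oper. \<forall>x y. cinner y (T x) = cinner (S y) x"
proof -
  have "\<exists>w. \<forall>x. cinner y (T x) = cinner w x" for y
    by (rule riesz)
      (auto intro: bounded_linear_compose[OF bounded_linear_cinner_right blinfun.bounded_linear_right]
        simp: clinD[OF T] cinner_expand)
  then obtain s where s: "\<And>x y. cinner y (T x) = cinner (s y) x" by metis
  have "bounded_linear s"
  proof (rule bounded_linear_intro)
    show "s (x + y) = s x + s y" for x y
      by (rule cinner_left_ext) (simp add: cinner_expand s[symmetric])
    show "s (r *\<^sub>R x) = r *\<^sub>R s x" for r x
      by (rule cinner_left_ext) (simp add: scaleR_scaleC cinner_expand s[symmetric])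
    show "norm (s y) \<le> norm y * norm T" for y
    proof (cases "s y = 0")
      case False
      have "(norm (s y))\<^sup>2 = cmod (cinner (s y) (s y))" by (simp add: cinner_self norm_power)
      also have "\<dots> \<le> norm y * (norm T * norm (s y))"
        using cauchy_schwarz[of y "T (s y)"] norm_blinfun[of T "s y"]
        by (simp add: s[symmetric]) (meson mult_left_mono norm_ge_zero order_trans)
      finally show ?thesis using False by (simp add: power2_eq_square mult.assoc[symmetric])
    qed simp
  qed
  then show ?thesis using s by (intro exI[of _ "Blinfun s"]) (simp add: bounded_linear_Blinfun_apply)
qed

text \<open>Inner products separate vectors, so the adjoint relation has at most one solution and
  the definite description can be evaluated by exhibiting one.\<close>

lemma adj_eqI:
  fixes S T :: "'v :: complex_hilbert_space oper"
  shows "(\<And>x y. cinner y (T x) = cinner (S y) x) \<Longrightarrow> adj T = S"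
  unfolding adj_def
  by (rule the_equality, blast, rule blinfun_eqI, rule cinner_left_ext, metis)

lemma cinner_adj: "clin T \<Longrightarrow> cinner y (T x) = cinner (adj T y) x"
  using adj_exists[of T] adj_eqI[of T] by metis

lemma cinner_adj': "clin T \<Longrightarrow> cinner (T x) y = cinner x (adj T y)"
  by (metis cinner_adj cinner_commute)

lemma clin_adj [intro, simp]: "clin T \<Longrightarrow> clin (adj T)"
  unfolding clin_def[of "adj T"]
  by (intro allI impI cinner_left_ext) (simp add: cinner_adj[symmetric] cinner_expand)

lemma adj_adj [simp]: "clin T \<Longrightarrow> adj (adj T) = T"
  by (rule adj_eqI) (simp add: cinner_adj')

lemma adj_comp: "clin S \<Longrightarrow> clin T \<Longrightarrow> adj (S o\<^sub>L T) = adj T o\<^sub>L adj S"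
  by (rule adj_eqI) (simp add: cinner_adj)

lemma adj_add: "clin S \<Longrightarrow> clin T \<Longrightarrow> adj (S + T) = adj S + adj T"
  by (rule adj_eqI) (simp add: cinner_adj blinfun.add_left cinner_expand)

lemma adj_scaleC: "clin T \<Longrightarrow> adj (scaleC_oper a T) = scaleC_oper (cnj a) (adj T)"
  by (rule adj_eqI) (simp add: cinner_adj cinner_expand)

text \<open>The square of |T^* y| is the inner product of y and T T^* y, and one factor |T^* y|
  cancels. This gives the continuity of the adjoint.\<close>

lemma norm_adj_le: "clin T \<Longrightarrow> norm (adj T) \<le> norm T"
proof (rule norm_blinfun_bound)
  fix y assume T: "clin T"
  show "norm (adj T y) \<le> norm T * norm y"
  proof (cases "adj T y = 0")
    case False
    have "(norm (adj T y))\<^sup>2 = cmod (cinner y (T (adj T y)))"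
      by (simp add: cinner_adj[OF T] cinner_self norm_power)
    also have "\<dots> \<le> norm y * (norm T * norm (adj T y))"
      using cauchy_schwarz[of y "T (adj T y)"] norm_blinfun[of T "adj T y"]
      by (meson mult_left_mono norm_ge_zero order_trans)
    finally show ?thesis using False by (simp add: power2_eq_square mult.assoc[symmetric] mult.commute)
  qed simp
qed simp

section \<open>Corners of bounded operators between closed subspaces\<close>

lemma bounded_opsD:
  assumes "T \<in> bounded_ops A B"
  shows "clin T" "x \<in> A \<Longrightarrow> T x \<in> B" "(\<And>a. a \<in> A \<Longrightarrow> cinner a x = 0) \<Longrightarrow> T x = 0"
  using assms by (auto simp: bounded_ops_def clin_def)

lemma bounded_opsI:
  assumes "clin T" "\<And>x. x \<in> A \<Longrightarrow> T x \<in> B" "\<And>x. (\<And>a. a \<in> A \<Longrightarrow> cinner a x = 0) \<Longrightarrow> T x = 0"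
  shows "T \<in> bounded_ops A B"
  using assms by (auto simp: bounded_ops_def clin_def)

lemma projection_unique:
  fixes A :: "'v :: complex_hilbert_space set"
  assumes A: "closed_csubspace A" and "p \<in> A" "q \<in> A"
    "\<And>a. a \<in> A \<Longrightarrow> cinner a (x - p) = 0" "\<And>a. a \<in> A \<Longrightarrow> cinner a (x - q) = 0"
  shows "p = q"
proof -
  have "cinner (p - q) (p - q) = cinner (p - q) (x - q) - cinner (p - q) (x - p)"
    by (simp add: cinner_diff_right)
  also have "\<dots> = 0" using assms closed_csubspaceD(5)[OF A] by simp
  finally show ?thesis by simp
qed

text \<open>Uniqueness of the orthogonal projection yields its additivity and homogeneity;
  Pythagoras yields the norm bound.\<close>

lemma id_op_exists:
  fixes A :: "'v :: complex_hilbert_space set"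
  assumes A: "closed_csubspace A"
  shows "\<exists>P :: 'v oper. clin P \<and> (\<forall>x. P x \<in> A) \<and> (\<forall>x. \<forall>a\<in>A. cinner a (x - P x) = 0)"
proof -
  obtain p where p: "\<And>x. p x \<in> A" "\<And>x a. a \<in> A \<Longrightarrow> cinner a (x - p x) = 0"
    using exists_projection[OF A] by metis
  have sc: "p (r *\<^sub>C x) = r *\<^sub>C p x" for r x
    by (rule projection_unique[OF A p(1) _ p(2)])
      (use p in \<open>auto simp: closed_csubspaceD[OF A] cvec.scale_right_diff_distrib[symmetric] cinner_scaleC_right\<close>)
  have "bounded_linear p"
  proof (rule bounded_linear_intro)
    show "p (x + y) = p x + p y" for x y
      by (rule projection_unique[OF A p(1) _ p(2)])
        (use p in \<open>auto simp: closed_csubspaceD[OF A] add_diff_add cinner_add_right\<close>)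
    show "p (r *\<^sub>R x) = r *\<^sub>R p x" for r x by (simp add: scaleR_scaleC sc)
    show "norm (p x) \<le> norm x * 1" for x
      using norm_le_add_orthogonal[OF p(2)[OF p(1)], of x x] by simp
  qed
  then show ?thesis
    using p sc by (intro exI[of _ "Blinfun p"]) (simp add: bounded_linear_Blinfun_apply clin_def)
qed

text \<open>An operator of the corner vanishes on the orthogonal complement of A, so its values on A
  determine it.\<close>

lemma id_op_eqI:
  fixes A :: "'v :: complex_hilbert_space set"
  assumes A: "closed_csubspace A" and P: "P \<in> bounded_ops A A" "\<And>x. x \<in> A \<Longrightarrow> P x = x"
  shows "id_op A = P"
  unfolding id_op_def
proof (rule the_equality)
  fix Q assume Q: "Q \<in> bounded_ops A A \<and> (\<forall>x\<in>A. Q x = x)"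
  show "Q = P"
  proof (rule blinfun_eqI)
    fix x
    obtain p where p: "p \<in> A" "\<And>a. a \<in> A \<Longrightarrow> cinner a (x - p) = 0"
      using exists_projection[OF A] by blast
    have "Q (x - p) = 0" "P (x - p) = 0" using p Q P bounded_opsD(3) by blast+
    then show "Q x = P x" using p Q P by (simp add: blinfun.diff_right)
  qed
qed (use P in blast)

lemma id_op:
  fixes A :: "'v :: complex_hilbert_space set"
  assumes A: "closed_csubspace A"
  shows "id_op A \<in> bounded_ops A A" "x \<in> A \<Longrightarrow> id_op A x = x" "id_op A x \<in> A"
    "a \<in> A \<Longrightarrow> cinner a (x - id_op A x) = 0" "clin (id_op A)" "norm (id_op A x) \<le> norm x"
proof -
  obtain P :: "'v oper" where P: "clin P" "\<And>x. P x \<in> A" "\<And>x a. a \<in> A \<Longrightarrow> cinner a (x - P x) = 0"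
    using id_op_exists[OF A] by blast
  have PA: "P x = x" if "x \<in> A" for x
    by (rule projection_unique[OF A P(2) that P(3)]) simp_all
  have "P x = 0" if "\<And>a. a \<in> A \<Longrightarrow> cinner a x = 0" for x
    by (rule projection_unique[OF A P(2) _ P(3)]) (use that closed_csubspaceD[OF A] in simp_all)
  then have PB: "P \<in> bounded_ops A A" using P by (auto intro: bounded_opsI)
  have eq: "id_op A = P" by (rule id_op_eqI[OF A PB PA])
  show "id_op A \<in> bounded_ops A A" "x \<in> A \<Longrightarrow> id_op A x = x" "id_op A x \<in> A"
    "a \<in> A \<Longrightarrow> cinner a (x - id_op A x) = 0" "clin (id_op A)"
    using P PB PA by (auto simp: eq)
  show "norm (id_op A x) \<le> norm x"
    using norm_le_add_orthogonal[OF P(3)[OF P(2)], of x x] by (simp add: eq)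
qed

lemma adj_id_op:
  fixes A :: "'v :: complex_hilbert_space set"
  assumes A: "closed_csubspace A"
  shows "adj (id_op A) = id_op A"
proof (rule adj_eqI)
  fix x y :: 'v
  have "cinner (id_op A y) (x - id_op A x) = 0" "cinner (id_op A x) (y - id_op A y) = 0"
    by (rule id_op(4)[OF A id_op(3)[OF A]])+
  then show "cinner y (id_op A x) = cinner (id_op A y) x"
    using cinner_commute[of y "id_op A x"] cinner_commute[of "id_op A y" "id_op A x"]
    by (simp add: cinner_diff_right)
qed

lemma bounded_ops_id_right:
  assumes A: "closed_csubspace A" and T: "T \<in> bounded_ops A B"
  shows "T o\<^sub>L id_op A = T"
proof (rule blinfun_eqI)
  fix x
  have "T (x - id_op A x) = 0" using bounded_opsD(3)[OF T] id_op(4)[OF A] by blast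
  then show "(T o\<^sub>L id_op A) x = T x" by (simp add: blinfun.diff_right)
qed

lemma bounded_ops_apply_id: "closed_csubspace A \<Longrightarrow> T \<in> bounded_ops A B \<Longrightarrow> T (id_op A x) = T x"
  by (metis bounded_ops_id_right blinfun_apply_blinfun_compose)

lemma bounded_ops_range: "closed_csubspace A \<Longrightarrow> T \<in> bounded_ops A B \<Longrightarrow> T x \<in> B"
  by (metis bounded_ops_apply_id bounded_opsD(2) id_op(3))

lemma bounded_ops_id_left:
  "closed_csubspace A \<Longrightarrow> closed_csubspace B \<Longrightarrow> T \<in> bounded_ops A B \<Longrightarrow> id_op B o\<^sub>L T = T"
  by (auto intro!: blinfun_eqI simp: id_op bounded_ops_range)

lemma bounded_ops_comp:
  assumes T: "T \<in> bounded_ops A B" and S: "S \<in> bounded_ops B D"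
  shows "S o\<^sub>L T \<in> bounded_ops A D"
proof (rule bounded_opsI)
  show "clin (S o\<^sub>L T)" using bounded_opsD(1) S T by blast
  show "(S o\<^sub>L T) x \<in> D" if "x \<in> A" for x
    using bounded_opsD(2)[OF S bounded_opsD(2)[OF T that]] by simp
  show "(S o\<^sub>L T) x = 0" if "\<And>a. a \<in> A \<Longrightarrow> cinner a x = 0" for x
    using bounded_opsD(3)[OF T that] by (simp add: blinfun.zero_right)
qed

lemma bounded_ops_adj:
  assumes A: "closed_csubspace A" and B: "closed_csubspace B" and T: "T \<in> bounded_ops A B"
  shows "adj T \<in> bounded_ops B A"
proof (rule bounded_opsI)
  note cT = bounded_opsD(1)[OF T]
  show "clin (adj T)" using cT by simp
  have "adj T = id_op A o\<^sub>L adj T"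
    using adj_comp[OF cT id_op(5)[OF A]] by (simp add: bounded_ops_id_right[OF A T] adj_id_op[OF A])
  then show "adj T x \<in> A" for x using id_op(3)[OF A] by (metis blinfun_apply_blinfun_compose)
  show "adj T x = 0" if "\<And>b. b \<in> B \<Longrightarrow> cinner b x = 0" for x
    by (rule cinner_right_ext) (simp add: cinner_adj'[OF cT, symmetric] that bounded_ops_range[OF A T])
qed

text \<open>The vectors on which two operators agree form a closed subspace; if it contains a total
  set of A it contains A, and on the orthogonal complement of A both vanish. The targets may differ,
  as only values are compared.\<close>

lemma bounded_ops_eqI:
  assumes A: "closed_csubspace A" and "S \<in> bounded_ops A B" "T \<in> bounded_ops A B'"
    and G: "closure (cvec.span G) = A" and eq: "\<And>x. x \<in> G \<Longrightarrow> S x = T x"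
  shows "S = T"
proof -
  have cl: "clin S" "clin T" using assms bounded_opsD(1) by blast+
  have "closed {x. S x = T x}"
    by (intro closed_Collect_eq continuous_intros)
  then have "closed_csubspace {x. S x = T x}"
    by (auto simp: closed_csubspace_def cvec.subspace_def blinfun.add_right clinD[OF cl(1)] clinD[OF cl(2)]
        blinfun.zero_right)
  then have "A \<subseteq> {x. S x = T x}"
    using closure_span_minimal[of "{x. S x = T x}" G] eq G by auto
  then have "S x = T x" for x
    using bounded_ops_apply_id[OF A, of S B x] bounded_ops_apply_id[OF A, of T B' x] id_op(3)[OF A, of x] assms
    by auto
  then show ?thesis by (rule blinfun_eqI)
qed

lemma closure_span_self: "closed_csubspace A \<Longrightarrow> closure (cvec.span A) = A"
  by (metis closure_span_minimal closure_span_superset subset_antisym subset_refl)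

lemma bounded_bilinear_scaleC_oper:
  "bounded_bilinear (scaleC_oper :: complex \<Rightarrow> 'v oper \<Rightarrow> 'v :: complex_hilbert_space oper)"
proof (rule bounded_bilinear.intro)
  have "norm (scaleC_oper a T) \<le> norm a * norm T * 1" for a and T :: "'v oper"
  proof (rule norm_blinfun_bound)
    fix x
    have "norm (scaleC_oper a T x) = norm a * norm (T x)"
      by (simp add: norm_scaleC)
    also have "\<dots> \<le> norm a * (norm T * norm x)"
      by (intro mult_left_mono norm_blinfun norm_ge_zero)
    finally show "norm (scaleC_oper a T x) \<le> norm a * norm T * 1 * norm x" by simp
  qed simp
  then show "\<exists>K. \<forall>a b. norm (scaleC_oper a (b :: 'v oper)) \<le> norm a * norm b * K"
    by blast
qed (auto intro!: blinfun_eqI simp: blinfun.add_left blinfun.scaleR_left scaleC_add_left scaleC_add_right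
    scaleR_scaleC scaleC_scaleC scaleR_conv_of_real mult.commute)

section \<open>Closed linear spans of operators\<close>

definition closed_osubspace :: "'v :: complex_hilbert_space oper set \<Rightarrow> bool" where
  "closed_osubspace N \<longleftrightarrow> coper.subspace N \<and> closed N"

lemma closed_osubspace_closed_span: "closed_osubspace (closed_span (M :: 'v :: complex_hilbert_space oper set))"
proof -
  let ?S = "coper.span M"
  have "x + y \<in> closure ?S" if xy: "x \<in> closure ?S" "y \<in> closure ?S" for x y
  proof -
    from xy obtain f g where "\<forall>n. f n \<in> ?S" "f \<longlonglongrightarrow> x" "\<forall>n. g n \<in> ?S" "g \<longlonglongrightarrow> y"
      by (auto simp: closure_sequential)
    then show ?thesis unfolding closure_sequential
      by (intro exI[of _ "\<lambda>n. f n + g n"]) (auto intro: coper.span_add tendsto_add)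
  qed
  moreover have "scaleC_oper a x \<in> closure ?S" if x: "x \<in> closure ?S" for x a
  proof -
    from x obtain f where "\<forall>n. f n \<in> ?S" "f \<longlonglongrightarrow> x"
      by (auto simp: closure_sequential)
    then show ?thesis unfolding closure_sequential
      by (intro exI[of _ "\<lambda>n. scaleC_oper a (f n)"])
        (auto intro: coper.span_scale bounded_bilinear.tendsto[OF bounded_bilinear_scaleC_oper tendsto_const])
  qed
  moreover have "0 \<in> closure ?S"
    using coper.span_zero closure_subset by blast
  ultimately show ?thesis
    by (auto simp: closed_osubspace_def closed_span_def coper.subspace_def)
qed

lemma closed_span_superset: "M \<subseteq> closed_span M"
  unfolding closed_span_def using closure_subset coper.span_superset by blast

lemma closed_span_minimal: "closed_osubspace N \<Longrightarrow> M \<subseteq> N \<Longrightarrow> closed_span M \<subseteq> N"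
  by (simp add: closed_osubspace_def closed_span_def closure_minimal coper.span_minimal)

lemma closed_span_le: "M \<subseteq> closed_span N \<Longrightarrow> closed_span M \<subseteq> closed_span N"
  by (rule closed_span_minimal[OF closed_osubspace_closed_span])

lemma closed_span_scale: "T \<in> closed_span M \<Longrightarrow> scaleC_oper a T \<in> closed_span M"
  using closed_osubspace_closed_span[of M] by (simp add: closed_osubspace_def coper.subspace_scale)

lemma closed_osubspace_vimage:
  assumes N: "closed_osubspace N" and \<phi>: "bounded_linear \<phi>"
    and \<phi>C: "\<And>a x. \<exists>b. \<phi> (scaleC_oper a x) = scaleC_oper b (\<phi> x)"
  shows "closed_osubspace {x. \<phi> x \<in> N}"
proof -
  have "closed (\<phi> -` N)"
    using N by (intro closed_vimage) (auto simp: closed_osubspace_def intro: bounded_linear.continuous_on[OF \<phi>])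
  moreover have "\<phi> (scaleC_oper a x) \<in> N" if "\<phi> x \<in> N" for a x
    using \<phi>C[of a x] that N by (auto simp: closed_osubspace_def coper.subspace_scale)
  ultimately show ?thesis using N linear_0[OF bounded_linear.linear[OF \<phi>]]
    by (auto simp: closed_osubspace_def coper.subspace_def linear_add[OF bounded_linear.linear[OF \<phi>]] vimage_def)
qed

text \<open>The scalar hypothesis covers both linear and antilinear maps.\<close>

lemma closed_span_image:
  assumes "bounded_linear \<phi>"
    and "\<And>a x. \<exists>b. \<phi> (scaleC_oper a x) = scaleC_oper b (\<phi> x)"
    and "\<And>x. x \<in> M \<Longrightarrow> \<phi> x \<in> closed_span N" and "x \<in> closed_span M"
  shows "\<phi> x \<in> closed_span N"
  using closed_span_minimal[OF closed_osubspace_vimage[OF closed_osubspace_closed_span assms(1,2)], of M N] assms(3,4)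
  by blast

text \<open>The analogue for a family of operators indexed by vectors. The scalar b is left open so
  that slices and rank-one operators may depend linearly or antilinearly on the vector.\<close>

lemma closed_span_vector_image:
  fixes \<phi> :: "'v :: complex_hilbert_space \<Rightarrow> 'v oper"
  assumes \<phi>: "bounded_linear \<phi>"
    and \<phi>C: "\<And>a x. \<exists>b. \<phi> (a *\<^sub>C x) = scaleC_oper b (\<phi> x)"
    and G: "\<And>x. x \<in> G \<Longrightarrow> \<phi> x \<in> closed_span N" and x: "x \<in> closure (cvec.span G)"
  shows "\<phi> x \<in> closed_span N"
proof -
  note N = closed_osubspace_closed_span[of N, unfolded closed_osubspace_def]
  have "closed (\<phi> -` closed_span N)"
    using N by (intro closed_vimage) (auto intro: bounded_linear.continuous_on[OF \<phi>])
  moreover have "\<phi> (a *\<^sub>C x) \<in> closed_span N" if "\<phi> x \<in> closed_span N" for a x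
    using \<phi>C[of a x] that by (auto simp: closed_span_scale)
  ultimately have "closed_csubspace {x. \<phi> x \<in> closed_span N}"
    using N linear_0[OF bounded_linear.linear[OF \<phi>]]
    by (auto simp: closed_csubspace_def cvec.subspace_def coper.subspace_def
        linear_add[OF bounded_linear.linear[OF \<phi>]] vimage_def)
  from closure_span_minimal[OF this, of G] G x show ?thesis by blast
qed

lemma scaleC_oper_comp_left: "scaleC_oper a S o\<^sub>L T = scaleC_oper a (S o\<^sub>L T)"
  by (rule blinfun_eqI) simp

lemma scaleC_oper_comp_right: "clin S \<Longrightarrow> S o\<^sub>L scaleC_oper a T = scaleC_oper a (S o\<^sub>L T)"
  by (rule blinfun_eqI) (simp add: clinD)

lemma bounded_linear_comp_left: "bounded_linear (\<lambda>T. S o\<^sub>L T)"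
  by (rule bounded_bilinear.bounded_linear_right[OF bounded_bilinear_blinfun_compose])

lemma bounded_linear_comp_right: "bounded_linear (\<lambda>T. T o\<^sub>L S)"
  by (rule bounded_bilinear.bounded_linear_left[OF bounded_bilinear_blinfun_compose])

lemma closed_span_comp_left:
  assumes "clin S" "\<And>T. T \<in> M \<Longrightarrow> S o\<^sub>L T \<in> closed_span N" "T \<in> closed_span M"
  shows "S o\<^sub>L T \<in> closed_span N"
  by (rule closed_span_image[where \<phi> = "\<lambda>T. S o\<^sub>L T", OF bounded_linear_comp_left _ assms(2,3)])
    (auto simp: scaleC_oper_comp_right[OF assms(1)])

lemma closed_span_comp_right:
  assumes "\<And>T. T \<in> M \<Longrightarrow> T o\<^sub>L S \<in> closed_span N" "T \<in> closed_span M"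
  shows "T o\<^sub>L S \<in> closed_span N"
  by (rule closed_span_image[where \<phi> = "\<lambda>T. T o\<^sub>L S", OF bounded_linear_comp_right _ assms])
    (auto simp: scaleC_oper_comp_left)

lemma closed_clin: "closed {T :: 'v :: complex_hilbert_space oper. clin T}"
proof -
  have "closed {T :: 'v oper. T (a *\<^sub>C x) = a *\<^sub>C T x}" for a x
    by (intro closed_Collect_eq bounded_bilinear.continuous_on[OF bounded_bilinear_scaleC] continuous_intros)
  then show ?thesis
    unfolding clin_def by (intro closed_Collect_all)
qed

text \<open>Each defining condition is closed because evaluation at a vector is continuous in the
  operator norm.\<close>

lemma closed_osubspace_bounded_ops:
  assumes "closed_csubspace B"
  shows "closed_osubspace (bounded_ops A (B :: 'v :: complex_hilbert_space set))"
proof -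
  note B = closed_csubspaceD[OF assms]
  have ev: "continuous_on UNIV (\<lambda>T :: 'v oper. T x)" for x
    by (intro continuous_intros)
  have "bounded_ops A B = {T. clin T} \<inter> (\<Inter>x\<in>A. (\<lambda>T. blinfun_apply T x) -` B)
    \<inter> (\<Inter>x\<in>{x. \<forall>a\<in>A. cinner a x = 0}. {T. blinfun_apply T x = 0})"
    by (auto simp: bounded_ops_def clin_def)
  moreover have "closed {T :: 'v oper. T x = 0}" for x
    by (intro closed_Collect_eq ev continuous_on_const)
  ultimately have "closed (bounded_ops A B)"
    by (auto intro!: closed_Int closed_INT closed_vimage closed_clin B ev)
  then show ?thesis
    by (auto simp: closed_osubspace_def coper.subspace_def bounded_ops_def blinfun.add_left
      cvec.scale_right_distrib scaleC_scaleC mult.commute B)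
qed

lemma adj_zero [simp]: "adj (0 :: 'v :: complex_hilbert_space oper) = 0"
  by (rule adj_eqI) simp

text \<open>Adjunction is antilinear and norm non-increasing on the complex-linear operators, where
  \<open>adj\<close> has its meaning. The argument therefore runs inside the closed set of
  complex-linear operators.\<close>

lemma closed_span_adj:
  assumes M: "\<And>S. S \<in> M \<Longrightarrow> clin S" and T: "T \<in> closed_span M"
  shows "adj T \<in> closed_span (adj ` M)"
proof -
  let ?N = "{T. clin T \<and> adj T \<in> closed_span (adj ` M)}"
  note cs = closed_osubspace_closed_span[of "adj ` M", unfolded closed_osubspace_def coper.subspace_def]
  have "closed ?N"
    unfolding closed_sequential_limits
  proof (intro allI impI, elim conjE)
    fix f l assume f: "\<forall>n. f n \<in> ?N" "f \<longlonglongrightarrow> l"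
    then have l: "clin l" using closed_clin unfolding closed_sequential_limits by blast
    have "(\<lambda>n. adj (f n)) \<longlonglongrightarrow> adj l"
    proof (rule LIM_zero_cancel, rule Lim_null_comparison)
      have "adj (f n) - adj l = adj (f n - l)" for n
        using f(1) l adj_add[of "f n - l" l] by simp
      then show "\<forall>\<^sub>F n in sequentially. norm (adj (f n) - adj l) \<le> norm (f n - l)"
        using f(1) l by (auto intro!: always_eventually norm_adj_le)
      show "(\<lambda>n. norm (f n - l)) \<longlonglongrightarrow> 0"
        using f(2) by (simp add: LIM_zero tendsto_norm_zero)
    qed
    then have "adj l \<in> closed_span (adj ` M)"
      using closed_sequentially[of "closed_span (adj ` M)" "\<lambda>n. adj (f n)"] cs f(1) by blast
    then show "l \<in> ?N" using l by blast
  qed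
  then have "closed_osubspace ?N"
    using cs by (auto simp: closed_osubspace_def coper.subspace_def adj_add adj_scaleC)
  then show ?thesis
    using closed_span_minimal[of ?N M] M T closed_span_superset by fastforce
qed

section \<open>Rank-one and compact operators\<close>

definition rank1 :: "'v \<Rightarrow> 'v \<Rightarrow> 'v :: complex_hilbert_space oper" where
  "rank1 b a = Blinfun (\<lambda>x. cinner a x *\<^sub>C b)"

definition rank1s :: "'v set \<Rightarrow> 'v set \<Rightarrow> 'v :: complex_hilbert_space oper set" where
  "rank1s A B = {rank1 b a | a b. a \<in> A \<and> b \<in> B}"

lemma rank1_apply [simp]: "rank1 b a x = cinner a x *\<^sub>C b"
proof -
  have "bounded_linear (\<lambda>x. cinner a x *\<^sub>C b)"
    by (rule bounded_linear_compose[OF bounded_bilinear.bounded_linear_left[OF bounded_bilinear_scaleC]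
          bounded_linear_cinner_right])
  then show ?thesis by (simp add: rank1_def bounded_linear_Blinfun_apply)
qed

lemma rank1_expand:
  "rank1 (b + b') a = rank1 b a + rank1 b' a" "rank1 (z *\<^sub>C b) a = scaleC_oper z (rank1 b a)"
  "rank1 b (a + a') = rank1 b a + rank1 b a'" "rank1 b (z *\<^sub>C a) = scaleC_oper (cnj z) (rank1 b a)"
  by (auto intro!: blinfun_eqI simp: blinfun.add_left cvec.scale_right_distrib cinner_expand
      cvec.scale_left_distrib scaleC_scaleC mult.commute)

lemma clin_rank1 [simp, intro]: "clin (rank1 b a)"
  by (simp add: clin_def cinner_expand scaleC_scaleC)

lemma adj_rank1 [simp]: "adj (rank1 b a) = rank1 a b"
  by (rule adj_eqI) (simp add: cinner_expand mult.commute flip: cinner_commute)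

lemma comp_rank1: "clin T \<Longrightarrow> T o\<^sub>L rank1 b a = rank1 (T b) a"
  by (rule blinfun_eqI) (simp add: clinD)

lemma rank1_comp: "clin T \<Longrightarrow> rank1 b a o\<^sub>L T = rank1 b (adj T a)"
  by (rule blinfun_eqI) (simp add: cinner_adj)

lemma norm_rank1_le: "norm (rank1 b a) \<le> norm a * norm b"
proof (rule norm_blinfun_bound)
  show "norm (rank1 b a x) \<le> norm a * norm b * norm x" for x
    using mult_right_mono[OF cauchy_schwarz[of a x] norm_ge_zero[of b]] by (simp add: norm_scaleC mult_ac)
qed simp

lemma bounded_linear_rank1:
  fixes a b :: "'a :: complex_hilbert_space"
  shows "bounded_linear (\<lambda>b. rank1 b a)" "bounded_linear (\<lambda>a. rank1 b a)"
proof -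
  have sc: "r *\<^sub>R rank1 b a = scaleC_oper (complex_of_real r) (rank1 b a)" for r and a b :: 'a
    by (rule blinfun_eqI) (simp add: blinfun.scaleR_left scaleR_scaleC)
  show "bounded_linear (\<lambda>b. rank1 b a)"
    by (rule bounded_linear_intro[of _ "norm a"]) (simp_all add: rank1_expand sc scaleR_scaleC,
        metis norm_rank1_le mult.commute)
  show "bounded_linear (\<lambda>a. rank1 b a)"
    by (rule bounded_linear_intro[of _ "norm b"]) (simp_all add: rank1_expand sc scaleR_scaleC norm_rank1_le)
qed

lemma rank1_bounded_ops: "closed_csubspace B \<Longrightarrow> a \<in> A \<Longrightarrow> b \<in> B \<Longrightarrow> rank1 b a \<in> bounded_ops A B"
  by (rule bounded_opsI) (auto simp: closed_csubspaceD)

text \<open>The unit ball is mapped into the multiples z b with |z| \<le> |a|, a compact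
  set.\<close>

lemma rank1s_subset_compact_ops:
  assumes B: "closed_csubspace B"
  shows "rank1s A B \<subseteq> compact_ops A B"
proof
  fix T assume "T \<in> rank1s A B"
  then obtain a b where T: "T = rank1 b a" "a \<in> A" "b \<in> B" by (auto simp: rank1s_def)
  let ?K = "(\<lambda>z. z *\<^sub>C b) ` cball 0 (norm a)"
  have K: "compact ?K"
    by (rule compact_continuous_image[OF linear_continuous_on compact_cball])
      (rule bounded_bilinear.bounded_linear_left[OF bounded_bilinear_scaleC])
  have "cmod (cinner a x) \<le> norm a" if "norm x \<le> 1" for x
    using order_trans[OF cauchy_schwarz[of a x] mult_left_mono[OF that norm_ge_zero]] by simp
  then have "T ` (A \<inter> cball 0 1) \<subseteq> ?K"
    by (auto simp: T)
  then have "closure (T ` (A \<inter> cball 0 1)) \<subseteq> ?K"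
    by (rule closure_minimal[OF _ compact_imp_closed[OF K]])
  then have "compact (closure (T ` (A \<inter> cball 0 1)))"
    using compact_Int_closed[OF K closed_closure] by (metis inf.absorb_iff2)
  then show "T \<in> compact_ops A B"
    using rank1_bounded_ops[OF B T(2,3)] by (simp add: compact_ops_def T(1))
qed

section \<open>Orthonormal systems and finite-rank approximation\<close>

definition orthonormal :: "'v :: complex_hilbert_space set \<Rightarrow> bool" where
  "orthonormal E \<longleftrightarrow> (\<forall>e\<in>E. \<forall>f\<in>E. cinner e f = (if e = f then 1 else 0))"

lemma orthonormal_expansion:
  assumes E: "finite E" "orthonormal E" and x: "x \<in> cvec.span E"
  shows "(\<Sum>e\<in>E. cinner e x *\<^sub>C e) = x"
  using x
proof (induction rule: cvec.span_induct)
  case base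
  have "(\<Sum>e\<in>E. cinner e (a *\<^sub>C x) *\<^sub>C e) = a *\<^sub>C (\<Sum>e\<in>E. cinner e x *\<^sub>C e)" for a x
    by (simp add: cvec.scale_sum_right cinner_scaleC_right)
  then show ?case
    by (auto intro!: cvec.subspaceI simp: cinner_add_right cvec.scale_left_distrib sum.distrib)
next
  case (step f)
  have "(\<Sum>e\<in>E. cinner e f *\<^sub>C e) = (\<Sum>e\<in>E. if e = f then e else 0)"
    using E step by (intro sum.cong) (auto simp: orthonormal_def)
  then show ?case using E step by simp
qed

lemma cinner_orthonormal_sum:
  assumes "finite E" "orthonormal E" "e \<in> E"
  shows "cinner e (\<Sum>f\<in>E. r f *\<^sub>C f) = r e"
proof -
  have "(\<Sum>f\<in>E. r f * cinner e f) = (\<Sum>f\<in>E. if e = f then r f else 0)"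
    using assms by (intro sum.cong) (auto simp: orthonormal_def)
  then show ?thesis using assms by (simp add: cinner_sum_right cinner_scaleC_right)
qed

text \<open>Induction on S: a new vector contributes its normalized component orthogonal to the span
  so far, or nothing if that component is zero.\<close>

lemma gram_schmidt:
  assumes "finite S"
  shows "\<exists>E. finite E \<and> orthonormal E \<and> E \<subseteq> cvec.span S \<and> S \<subseteq> cvec.span E"
  using assms
proof (induction rule: finite_induct)
  case empty
  then show ?case by (auto simp: orthonormal_def)
next
  case (insert b S)
  then obtain E where E: "finite E" "orthonormal E" "E \<subseteq> cvec.span S" "S \<subseteq> cvec.span E" by blast
  \<comment> \<open>The orthogonal projection of b to the span of E.\<close>
  define p where "p = (\<Sum>e\<in>E. cinner e b *\<^sub>C e)"
  have pE: "p \<in> cvec.span E" unfolding p_def by (intro cvec.span_sum cvec.span_scale cvec.span_base)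
  have SI: "cvec.span S \<subseteq> cvec.span (insert b S)" by (intro cvec.span_mono) auto
  have ES: "cvec.span E \<subseteq> cvec.span S" using E(3) cvec.span_minimal cvec.subspace_span by blast
  show ?case
  proof (cases "b - p = 0")
    case True
    then show ?thesis using E pE SI by (intro exI[of _ E]) auto
  next
    case False
    define e where "e = complex_of_real (1 / norm (b - p)) *\<^sub>C (b - p)"
    have orth: "cinner f (b - p) = 0" if "f \<in> E" for f
      using cinner_orthonormal_sum[OF E(1,2) that, of "\<lambda>e. cinner e b"] by (simp add: p_def cinner_diff_right)
    then have fe: "cinner f e = 0" if "f \<in> E" for f
      using that by (simp add: e_def cinner_scaleC_right)
    then have ef: "cinner e f = 0" if "f \<in> E" for f
      using that cinner_zero_commute by blast
    have ee: "cinner e e = 1"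
      using False by (simp add: e_def cinner_self norm_scaleC norm_divide)
    have "e \<in> cvec.span (insert b S)"
      unfolding e_def using pE ES SI by (intro cvec.span_scale cvec.span_diff) (auto intro: cvec.span_base)
    moreover have "b = p + complex_of_real (norm (b - p)) *\<^sub>C e"
      using False by (simp add: e_def scaleC_scaleC)
    then have "b \<in> cvec.span (insert e E)"
      using pE cvec.span_mono[of E "insert e E"]
      by (metis cvec.span_add cvec.span_base cvec.span_scale insertI1 subset_iff subset_insertI)
    moreover have "orthonormal (insert e E)"
      using E(2) fe ef ee by (auto simp: orthonormal_def)
    moreover have "cvec.span E \<subseteq> cvec.span (insert e E)" by (intro cvec.span_mono) auto
    ultimately show ?thesis
      using E SI by (intro exI[of _ "insert e E"]) auto
  qed
qed

text \<open>Let p be the projection onto the span of a finite net of the image of the unit ball. For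
  s in the net, p s = s, so T u - p (T u) equals (1 - p) (T u - s) and has norm at most that of T u
  - s. The composite p T is a finite sum of rank-one operators.\<close>

lemma compact_ops_subset_closed_span:
  assumes A: "closed_csubspace A" and B: "closed_csubspace B"
  shows "compact_ops A B \<subseteq> closed_span (rank1s A B)"
proof
  fix T assume "T \<in> compact_ops A B"
  then have T: "T \<in> bounded_ops A B" and cpt: "compact (closure (T ` (A \<inter> cball 0 1)))"
    by (auto simp: compact_ops_def)
  let ?S = "T ` (A \<inter> cball 0 1)"
  show "T \<in> closed_span (rank1s A B)"
    unfolding closed_span_def closure_approachable
  proof (intro allI impI)
    fix \<epsilon> :: real assume "\<epsilon> > 0"
    \<comment> \<open>The estimate below gives only \<le> \<delta>, while the distance must be
      strictly below \<epsilon>.\<close>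
    define \<delta> where "\<delta> = \<epsilon> / 2"
    have \<delta>: "\<delta> > 0" "\<delta> < \<epsilon>" using \<open>\<epsilon> > 0\<close> by (simp_all add: \<delta>_def)
    have "closure ?S \<subseteq> (\<Union>s\<in>?S. ball s \<delta>)"
    proof
      fix x assume "x \<in> closure ?S"
      then obtain s where "s \<in> ?S" "dist s x < \<delta>" using \<delta>(1) by (metis closure_approachable)
      then show "x \<in> (\<Union>s\<in>?S. ball s \<delta>)" by auto
    qed
    then obtain k where k: "k \<subseteq> ?S" "finite k" "closure ?S \<subseteq> (\<Union>s\<in>k. ball s \<delta>)"
      by (rule compactE_image[OF cpt, of ?S "\<lambda>s. ball s \<delta>", rotated]) auto
    obtain E where E: "finite E" "orthonormal E" "E \<subseteq> cvec.span k" "k \<subseteq> cvec.span E"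
      using gram_schmidt[OF k(2)] by blast
    have "k \<subseteq> B" using k(1) bounded_opsD(2)[OF T] by auto
    then have EB: "E \<subseteq> B" using E(3) B cvec.span_minimal[of k B] by (auto simp: closed_csubspace_def)
    \<comment> \<open>This is p T, since <e, T x> = <T^* e, x>.\<close>
    define S where "S = (\<Sum>e\<in>E. rank1 e (adj T e))"
    define p where "p y = (\<Sum>e\<in>E. cinner e y *\<^sub>C e)" for y
    have S: "S x = p (T x)" for x
      by (simp add: S_def p_def blinfun.sum_left cinner_adj[OF bounded_opsD(1)[OF T]])
    have p_diff: "p (y - z) = p y - p z" for y z
      by (simp add: p_def cinner_diff_right cvec.scale_left_diff_distrib sum_subtractf)
    have p_le: "norm (y - p y) \<le> norm y" for y
    proof -
      have "cinner e (y - p y) = 0" if "e \<in> E" for e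
        using cinner_orthonormal_sum[OF E(1,2) that, of "\<lambda>e. cinner e y"] by (simp add: p_def cinner_diff_right)
      then have "cinner (p y) (y - p y) = 0"
        by (simp add: p_def[of y] cinner_sum_left cinner_scaleC_left)
      then have "cinner (y - p y) (p y) = 0" by (simp add: cinner_zero_commute)
      from norm_le_add_orthogonal[OF this] show ?thesis by simp
    qed
    have "adj T e \<in> A" for e
      by (rule bounded_ops_range[OF B bounded_ops_adj[OF A B T]])
    then have "S \<in> coper.span (rank1s A B)"
      unfolding S_def using EB by (intro coper.span_sum coper.span_base) (auto simp: rank1s_def)
    moreover have "norm (T - S) \<le> \<delta>"
    proof (rule norm_blinfun_bound)
      fix x
      show "norm ((T - S) x) \<le> \<delta> * norm x"
      proof (cases "x = 0")
        case False
        \<comment> \<open>The projection of x to A is divided by |x| and not by its own norm: this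
          keeps u in the unit ball and avoids a vanishing denominator.\<close>
        define u where "u = complex_of_real (1 / norm x) *\<^sub>C id_op A x"
        have "norm u \<le> 1"
          using False id_op(6)[OF A, of x] by (simp add: u_def norm_scaleC norm_divide divide_le_eq)
        moreover have "u \<in> A" unfolding u_def by (intro closed_csubspaceD(3)[OF A] id_op(3)[OF A])
        ultimately have "T u \<in> closure ?S" using closure_subset by fastforce
        then obtain s where s: "s \<in> k" "dist s (T u) < \<delta>" using k(3) by auto
        have "p s = s" unfolding p_def using orthonormal_expansion[OF E(1,2)] s E(4) by blast
        then have eq: "(T u - s) - p (T u - s) = T u - p (T u)" by (simp add: p_diff)
        have *: "norm (T u - p (T u)) \<le> \<delta>"
          using p_le[of "T u - s"] s(2) unfolding eq dist_norm by (simp add: norm_minus_commute)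
        have "x - complex_of_real (norm x) *\<^sub>C u = x - id_op A x"
          using False by (simp add: u_def scaleC_scaleC)
        have "T u = complex_of_real (1 / norm x) *\<^sub>C T x"
          by (simp add: u_def clinD[OF bounded_opsD(1)[OF T]] bounded_ops_apply_id[OF A T])
        then have Tx: "T x = complex_of_real (norm x) *\<^sub>C T u"
          using False by (simp add: scaleC_scaleC)
        have "p (T x) = complex_of_real (norm x) *\<^sub>C p (T u)"
          by (simp add: p_def Tx cinner_scaleC_right scaleC_scaleC cvec.scale_sum_right)
        then have "(T - S) x = complex_of_real (norm x) *\<^sub>C (T u - p (T u))"
          by (simp add: blinfun.diff_left S Tx cvec.scale_right_diff_distrib)
        then show ?thesis using mult_right_mono[OF * norm_ge_zero[of x]] by (simp add: norm_scaleC mult.commute)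
      qed simp
    qed (use \<delta> in simp)
    ultimately show "\<exists>S\<in>coper.span (rank1s A B). dist S T < \<epsilon>"
      using \<delta>(2) by (auto simp: dist_norm norm_minus_commute intro!: bexI[of _ S])
  qed
qed

lemma oper_comp_assoc: "(R o\<^sub>L S) o\<^sub>L T = R o\<^sub>L (S o\<^sub>L T)"
  by (rule blinfun_eqI) simp

section \<open>Extension of linear and isometric maps from a generating set\<close>

text \<open>The linear relation spanned by the pairs (G i, G' i). Working with a relation avoids
  choosing a representation of each vector of the span; that it is single-valued comes out of a norm
  bound later.\<close>

inductive lin_rel :: "'i set \<Rightarrow> ('i \<Rightarrow> 'v) \<Rightarrow> ('i \<Rightarrow> 'v) \<Rightarrow> 'v \<Rightarrow> 'v :: complex_hilbert_space \<Rightarrow> bool"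
  for I G G' where
  lin_rel_zero: "lin_rel I G G' 0 0"
| lin_rel_gen: "i \<in> I \<Longrightarrow> lin_rel I G G' (G i) (G' i)"
| lin_rel_add: "lin_rel I G G' x y \<Longrightarrow> lin_rel I G G' x' y' \<Longrightarrow> lin_rel I G G' (x + x') (y + y')"
| lin_rel_scale: "lin_rel I G G' x y \<Longrightarrow> lin_rel I G G' (a *\<^sub>C x) (a *\<^sub>C y)"

lemma lin_rel_diff:
  assumes "lin_rel I G G' x y" "lin_rel I G G' x' y'"
  shows "lin_rel I G G' (x - x') (y - y')"
  using lin_rel_add[OF assms(1) lin_rel_scale[OF assms(2), of "-1"]] by (simp add: cvec.scale_minus_left)

lemma lin_rel_total: "x \<in> cvec.span (G ` I) \<Longrightarrow> \<exists>y. lin_rel I G G' x y"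
proof (induction rule: cvec.span_induct)
  case base
  show ?case by (rule cvec.subspaceI) (auto intro: lin_rel.intros)
qed (auto intro: lin_rel_gen)

lemma lin_rel_range:
  "lin_rel I G G' x y \<Longrightarrow> closed_csubspace B \<Longrightarrow> G' ` I \<subseteq> B \<Longrightarrow> y \<in> B"
  by (induction rule: lin_rel.induct) (auto simp: closed_csubspaceD)

text \<open>The bound makes the closure of the linear relation single-valued and total on A.
  Composing with the projection onto A extends the resulting map by zero to the ambient
  space.\<close>

lemma bounded_extension:
  fixes G G' :: "'i \<Rightarrow> 'v :: complex_hilbert_space"
  assumes B: "closed_csubspace B" "G' ` I \<subseteq> B"
    and bound: "\<And>x y. lin_rel I G G' x y \<Longrightarrow> norm y \<le> M * norm x" and "M \<ge> 0"
  shows "\<exists>T :: 'v oper. T \<in> bounded_ops (closure (cvec.span (G ` I))) B \<and>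
    (\<forall>i\<in>I. T (G i) = G' i) \<and> norm T \<le> M"
proof -
  define A where "A = closure (cvec.span (G ` I))"
  have A: "closed_csubspace A" unfolding A_def by (rule closed_csubspace_closure_span)
  \<comment> \<open>The sequential closure of the relation in the product of the two spaces.\<close>
  define cl where "cl x y \<longleftrightarrow> (\<exists>f g. (\<forall>n. lin_rel I G G' (f n) (g n)) \<and> f \<longlonglongrightarrow> x \<and> g \<longlonglongrightarrow> y)" for x y
  have rel_cl: "cl x y" if "lin_rel I G G' x y" for x y
    unfolding cl_def by (intro exI[of _ "\<lambda>_. x"] exI[of _ "\<lambda>_. y"]) (use that in auto)
  have cl_add: "cl (x + x') (y + y')" if cxy: "cl x y" "cl x' y'" for x y x' y'
  proof -
    obtain f g f' g' where "\<forall>n. lin_rel I G G' (f n) (g n)" "f \<longlonglongrightarrow> x" "g \<longlonglongrightarrow> y"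
      "\<forall>n. lin_rel I G G' (f' n) (g' n)" "f' \<longlonglongrightarrow> x'" "g' \<longlonglongrightarrow> y'"
      using cxy unfolding cl_def by blast
    then show ?thesis unfolding cl_def
      by (intro exI[of _ "\<lambda>n. f n + f' n"] exI[of _ "\<lambda>n. g n + g' n"]) (auto intro: lin_rel_add tendsto_add)
  qed
  have cl_scale: "cl (a *\<^sub>C x) (a *\<^sub>C y)" if cxy: "cl x y" for a x y
  proof -
    obtain f g where "\<forall>n. lin_rel I G G' (f n) (g n)" "f \<longlonglongrightarrow> x" "g \<longlonglongrightarrow> y"
      using cxy unfolding cl_def by blast
    then show ?thesis unfolding cl_def
      by (intro exI[of _ "\<lambda>n. a *\<^sub>C f n"] exI[of _ "\<lambda>n. a *\<^sub>C g n"])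
        (auto intro: lin_rel_scale bounded_bilinear.tendsto[OF bounded_bilinear_scaleC tendsto_const])
  qed
  have cl_bound: "norm y \<le> M * norm x" if cxy: "cl x y" for x y
  proof -
    obtain f g where fg: "\<forall>n. lin_rel I G G' (f n) (g n)" "f \<longlonglongrightarrow> x" "g \<longlonglongrightarrow> y"
      using cxy unfolding cl_def by blast
    have "(\<lambda>n. norm (g n)) \<longlonglongrightarrow> norm y" "(\<lambda>n. M * norm (f n)) \<longlonglongrightarrow> M * norm x"
      by (intro tendsto_intros fg)+
    then show ?thesis by (rule LIMSEQ_le) (use fg(1) bound in blast)
  qed
  \<comment> \<open>The difference of two values of the same vector is related to 0, so the bound
    makes it vanish.\<close>
  have cl_unique: "y = y'" if "cl x y" "cl x y'" for x y y'
    using cl_bound[OF cl_add[OF that(1) cl_scale[OF that(2), of "-1"]]] by (simp add: cvec.scale_minus_left)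
  have cl_B: "y \<in> B" if cxy: "cl x y" for x y
  proof -
    obtain f g where fg: "\<forall>n. lin_rel I G G' (f n) (g n)" "g \<longlonglongrightarrow> y"
      using cxy unfolding cl_def by blast
    then have "\<forall>n. g n \<in> B" using lin_rel_range[OF _ B] by blast
    then show ?thesis using closed_sequentially[OF closed_csubspaceD(4)[OF B(1)] _ fg(2)] by blast
  qed
  have cl_total: "\<exists>y. cl x y" if x: "x \<in> A" for x
  proof -
    obtain f where f: "\<And>n. f n \<in> cvec.span (G ` I)" "f \<longlonglongrightarrow> x"
      using x unfolding A_def closure_sequential by blast
    obtain g where g: "\<And>n. lin_rel I G G' (f n) (g n)"
      using lin_rel_total[OF f(1)] by metis
    have "Cauchy g"
    proof (rule CauchyI)
      fix e :: real assume e: "e > 0"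
      \<comment> \<open>M may be 0, so e is divided by M + 1.\<close>
      have "e / (M + 1) > 0" using e \<open>M \<ge> 0\<close> by simp
      then obtain N where N: "\<And>m n. m \<ge> N \<Longrightarrow> n \<ge> N \<Longrightarrow> norm (f m - f n) < e / (M + 1)"
        using CauchyD[OF LIMSEQ_imp_Cauchy[OF f(2)]] by metis
      have "norm (g m - g n) < e" if "m \<ge> N" "n \<ge> N" for m n
      proof -
        have "norm (g m - g n) \<le> M * norm (f m - f n)"
          by (rule bound[OF lin_rel_diff[OF g g]])
        also have "\<dots> \<le> M * (e / (M + 1))"
          by (intro mult_left_mono less_imp_le[OF N[OF that]] \<open>M \<ge> 0\<close>)
        also have "\<dots> < e" using e \<open>M \<ge> 0\<close> by (simp add: field_simps)
        finally show ?thesis .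
      qed
      then show "\<exists>N. \<forall>m\<ge>N. \<forall>n\<ge>N. norm (g m - g n) < e" by blast
    qed
    then obtain y where "g \<longlonglongrightarrow> y" by (auto simp: Cauchy_convergent_iff convergent_def)
    then show ?thesis unfolding cl_def using f g by blast
  qed
  \<comment> \<open>The projection makes h defined everywhere and zero on the orthogonal complement
    of A.\<close>
  obtain h where h: "\<And>x. cl (id_op A x) (h x)"
    using cl_total[OF id_op(3)[OF A]] by metis
  have h_scale: "h (a *\<^sub>C x) = a *\<^sub>C h x" for a x
    by (rule cl_unique[OF h]) (simp add: clinD[OF id_op(5)[OF A]] cl_scale[OF h])
  have h_le: "norm (h x) \<le> M * norm x" for x
    using cl_bound[OF h[of x]] mult_left_mono[OF id_op(6)[OF A, of x] \<open>M \<ge> 0\<close>] by simp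
  have "bounded_linear h"
  proof (rule bounded_linear_intro)
    show "h (x + y) = h x + h y" for x y
      by (rule cl_unique[OF h]) (simp add: blinfun.add_right cl_add[OF h h])
    show "norm (h x) \<le> norm x * M" for x
      using h_le[of x] by (simp add: mult.commute)
  qed (simp add: scaleR_scaleC h_scale)
  then have app: "blinfun_apply (Blinfun h) = h" by (rule bounded_linear_Blinfun_apply)
  have h_gen: "h x = y" if "x \<in> A" "cl x y" for x y
    by (rule cl_unique[OF h]) (simp add: id_op[OF A] that)
  have "h x = 0" if "\<And>a. a \<in> A \<Longrightarrow> cinner a x = 0" for x
    by (rule cl_unique[OF h]) (simp add: bounded_opsD(3)[OF id_op(1)[OF A] that] rel_cl lin_rel_zero)
  then have "Blinfun h \<in> bounded_ops A B"
    by (intro bounded_opsI) (auto simp: clin_def app h_scale cl_B[OF h])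
  moreover have "G i \<in> A" if "i \<in> I" for i
    using closure_span_superset[of "G ` I"] that by (auto simp: A_def)
  then have "Blinfun h (G i) = G' i" if "i \<in> I" for i
    using that by (simp add: app h_gen rel_cl lin_rel_gen)
  moreover have "norm (Blinfun h) \<le> M"
    by (rule norm_blinfun_bound) (simp_all add: app h_le \<open>M \<ge> 0\<close>)
  ultimately show ?thesis unfolding A_def by blast
qed

section \<open>Unitary operators between closed subspaces\<close>

lemma unitary_opD:
  assumes "unitary_op A B T"
  shows "T \<in> bounded_ops A B" "adj T o\<^sub>L T = id_op A" "T o\<^sub>L adj T = id_op B" "clin T"
  using assms bounded_opsD(1) by (auto simp: unitary_op_def)

lemma unitary_op_adj:
  "closed_csubspace A \<Longrightarrow> closed_csubspace B \<Longrightarrow> unitary_op A B T \<Longrightarrow> unitary_op B A (adj T)"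
  unfolding unitary_op_def
  using bounded_ops_adj[of A B T] adj_adj[OF bounded_opsD(1)] by (metis (no_types))

lemma unitary_op_comp:
  assumes A: "closed_csubspace A" and B: "closed_csubspace B" and D: "closed_csubspace D"
    and S: "unitary_op B D S" and T: "unitary_op A B T"
  shows "unitary_op A D (S o\<^sub>L T)"
proof -
  note S' = unitary_opD[OF S] and T' = unitary_opD[OF T]
  have "adj (S o\<^sub>L T) o\<^sub>L (S o\<^sub>L T) = adj T o\<^sub>L (adj S o\<^sub>L S) o\<^sub>L T"
    by (simp add: adj_comp S'(4) T'(4) oper_comp_assoc)
  also have "\<dots> = id_op A"
    by (simp only: S'(2) bounded_ops_id_right[OF B bounded_ops_adj[OF A B T'(1)]] T'(2))
  finally have 1: "adj (S o\<^sub>L T) o\<^sub>L (S o\<^sub>L T) = id_op A" .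
  have "(S o\<^sub>L T) o\<^sub>L adj (S o\<^sub>L T) = S o\<^sub>L (T o\<^sub>L adj T) o\<^sub>L adj S"
    by (simp add: adj_comp S'(4) T'(4) oper_comp_assoc)
  also have "\<dots> = id_op D"
    by (simp only: T'(3) bounded_ops_id_right[OF B S'(1)] S'(3))
  finally show ?thesis
    using 1 bounded_ops_comp[OF T'(1) S'(1)] by (simp add: unitary_op_def)
qed

lemma unitary_op_id: "closed_csubspace A \<Longrightarrow> unitary_op A A (id_op A)"
  using bounded_ops_id_right[OF _ id_op(1)] by (simp add: unitary_op_def id_op(1) adj_id_op)

lemma unitary_op_apply_adj:
  assumes "closed_csubspace A" "closed_csubspace B" "unitary_op A B T"
  shows "y \<in> B \<Longrightarrow> T (adj T y) = y" "x \<in> A \<Longrightarrow> adj T (T x) = x"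
  using unitary_opD(2,3)[OF assms(3)] id_op(2) assms(1,2) by (metis blinfun_apply_blinfun_compose)+

lemma unitary_op_image:
  assumes "closed_csubspace A" "closed_csubspace B" "unitary_op A B T"
  shows "T ` A = B"
proof -
  have "y \<in> T ` A" if "y \<in> B" for y
    using unitary_op_apply_adj(1)[OF assms that] bounded_ops_range[OF assms(2) bounded_ops_adj[OF assms(1,2)]]
      unitary_opD(1)[OF assms(3)] by (metis imageI)
  then show ?thesis using bounded_opsD(2)[OF unitary_opD(1)[OF assms(3)]] by auto
qed

lemma unitary_op_cinner:
  assumes "closed_csubspace A" "unitary_op A B T" "x \<in> A" "y \<in> A"
  shows "cinner (T x) (T y) = cinner x y"
proof -
  have "cinner (T x) (T y) = cinner x ((adj T o\<^sub>L T) y)"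
    using cinner_adj'[OF unitary_opD(4)[OF assms(2)], of x "T y"] by simp
  then show ?thesis by (simp add: unitary_opD(2)[OF assms(2)] id_op(2)[OF assms(1,4)])
qed

text \<open>A two-sided inverse is unique, so the definite description picks the adjoint. Every
  inverse braiding below is handled in this form.\<close>

lemma inv_op_unitary:
  assumes A: "closed_csubspace A" and B: "closed_csubspace B" and T: "unitary_op A B T"
  shows "inv_op A B T = adj T"
  unfolding inv_op_def
proof (rule the_equality)
  fix S assume S: "S \<in> bounded_ops B A \<and> S o\<^sub>L T = id_op A \<and> T o\<^sub>L S = id_op B"
  have "S = (adj T o\<^sub>L T) o\<^sub>L S"
    using S bounded_ops_id_left[OF B A] unitary_opD(2)[OF T] by simp
  also have "\<dots> = adj T o\<^sub>L id_op B" using S by (simp add: oper_comp_assoc)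
  also have "\<dots> = adj T" using bounded_ops_adj[OF A B] unitary_opD(1)[OF T] bounded_ops_id_right[OF B] by blast
  finally show "S = adj T" .
qed (use bounded_ops_adj[OF A B] unitary_opD[OF T] in blast)

text \<open>Equal inner products make the spanned relation isometric in both directions, so
  \<open>bounded_extension\<close> with bound 1 gives maps T and S. They are mutually inverse on
  generators; S is the adjoint of T because adj T (G' i) - G i lies in A and is orthogonal to every
  G j.\<close>

lemma unitary_extension:
  fixes G G' :: "'i \<Rightarrow> 'v :: complex_hilbert_space"
  assumes iso: "\<And>i j. i \<in> I \<Longrightarrow> j \<in> I \<Longrightarrow> cinner (G i) (G j) = cinner (G' i) (G' j)"
    and A: "closure (cvec.span (G ` I)) = A" and B: "closure (cvec.span (G' ` I)) = B"
  shows "\<exists>T :: 'v oper. unitary_op A B T \<and> (\<forall>i\<in>I. T (G i) = G' i)"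
proof -
  have ex: "\<exists>T :: 'v oper. T \<in> bounded_ops A B \<and> (\<forall>i\<in>I. T (G i) = G' i)"
    if iso: "\<And>i j. i \<in> I \<Longrightarrow> j \<in> I \<Longrightarrow> cinner (G i) (G j) = cinner (G' i) (G' j)"
      and A: "closure (cvec.span (G ` I)) = A" and B: "closure (cvec.span (G' ` I)) = B"
    for G G' :: "'i \<Rightarrow> 'v" and A B
  proof -
    have gen: "cinner x (G j) = cinner y (G' j)" if "lin_rel I G G' x y" "j \<in> I" for x y j
      using that by (induction rule: lin_rel.induct) (auto simp: cinner_expand iso)
    \<comment> \<open>Sesquilinearity in two rounds: the second argument was a generator before and
      is now an arbitrary member of the relation.\<close>
    have "cinner x x' = cinner y y'" if "lin_rel I G G' x' y'" "lin_rel I G G' x y" for x y x' y'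
      using that by (induction rule: lin_rel.induct) (auto simp: cinner_expand gen)
    then have "norm y \<le> 1 * norm x" if "lin_rel I G G' x y" for x y
      using that by (metis norm_sq_cinner power2_eq_imp_eq norm_ge_zero mult_1 order_refl)
    then show ?thesis
      using bounded_extension[of B G' I G 1] A B closed_csubspace_closure_span closure_span_superset
      by (metis zero_le_one)
  qed
  obtain T where T: "T \<in> bounded_ops A B" "\<And>i. i \<in> I \<Longrightarrow> T (G i) = G' i"
    using ex[OF iso A B] by blast
  obtain S where S: "S \<in> bounded_ops B A" "\<And>i. i \<in> I \<Longrightarrow> S (G' i) = G i"
    using ex[OF iso[symmetric] B A] by blast
  have cA: "closed_csubspace A" and cB: "closed_csubspace B"
    using A B closed_csubspace_closure_span by blast+
  note clT = bounded_opsD(1)[OF T(1)]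
  have GB: "G' i \<in> B" if "i \<in> I" for i using that closure_span_superset[of "G' ` I"] by (auto simp: B)
  have GA: "G i \<in> A" if "i \<in> I" for i using that closure_span_superset[of "G ` I"] by (auto simp: A)
  have TS: "T o\<^sub>L S = id_op B"
    by (rule bounded_ops_eqI[OF cB bounded_ops_comp[OF S(1) T(1)] id_op(1)[OF cB] B])
      (auto simp: S T id_op[OF cB] GB)
  have "adj T (G' i) = G i" if i: "i \<in> I" for i
  proof -
    have "closed_csubspace {a. cinner a (adj T (G' i) - G i) = 0}"
      by (auto simp: closed_csubspace_def cvec.subspace_def cinner_expand
          intro!: closed_Collect_eq continuous_intros)
    moreover have "cinner (G j) (adj T (G' i) - G i) = 0" if "j \<in> I" for j
      using iso[OF that i] by (simp add: cinner_diff_right cinner_adj'[OF clT, symmetric] T that)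
    ultimately have "A \<subseteq> {a. cinner a (adj T (G' i) - G i) = 0}"
      unfolding A[symmetric] by (intro closure_span_minimal) auto
    moreover have "adj T (G' i) - G i \<in> A"
      using bounded_ops_range[OF cB bounded_ops_adj[OF cA cB T(1)]] GA[OF i] closed_csubspaceD(5)[OF cA] by blast
    ultimately show ?thesis by auto
  qed
  then have "adj T = S"
    by (intro bounded_ops_eqI[OF cB bounded_ops_adj[OF cA cB T(1)] S(1) B]) (auto simp: S)
  moreover have "S o\<^sub>L T = id_op A"
    by (rule bounded_ops_eqI[OF cA bounded_ops_comp[OF T(1) S(1)] id_op(1)[OF cA] A])
      (auto simp: S T id_op[OF cA] GA)
  ultimately show ?thesis using TS T by (auto simp: unitary_op_def)
qed

section \<open>Tensor products of Hilbert spaces\<close>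

text \<open>The projections make \<open>rcreate A B t b\<close>, the operator \<open>a \<mapsto> a \<otimes> b\<close>, linear in \<open>b\<close> on the
  whole ambient space.\<close>

definition rcreate :: "'v set \<Rightarrow> 'v set \<Rightarrow> ('v \<Rightarrow> 'v \<Rightarrow> 'v) \<Rightarrow> 'v \<Rightarrow> 'v :: complex_hilbert_space oper" where
  "rcreate A B t b = Blinfun (\<lambda>x. t (id_op A x) (id_op B b))"

locale hilbert_tensor =
  fixes A B D :: "'v :: complex_hilbert_space set" and t :: "'v \<Rightarrow> 'v \<Rightarrow> 'v"
  assumes cA: "closed_csubspace A" and cB: "closed_csubspace B"
    and tens: "is_tensor_product A B D t"
begin

lemma mem: "a \<in> A \<Longrightarrow> b \<in> B \<Longrightarrow> t a b \<in> D"
  using tens by (simp add: is_tensor_product_def)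

lemma cinner_t:
  "a \<in> A \<Longrightarrow> b \<in> B \<Longrightarrow> a' \<in> A \<Longrightarrow> b' \<in> B \<Longrightarrow> cinner (t a b) (t a' b') = cinner a a' * cinner b b'"
  using tens by (simp add: is_tensor_product_def)

lemma dense: "closure (cvec.span ((\<lambda>(a, b). t a b) ` (A \<times> B))) = D"
proof -
  have "(\<lambda>(a, b). t a b) ` (A \<times> B) = {t a b | a b. a \<in> A \<and> b \<in> B}" by auto
  then show ?thesis using tens by (simp add: is_tensor_product_def)
qed

lemma cD: "closed_csubspace D"
  using closed_csubspace_closure_span dense by metis

text \<open>Through the flip, every statement about a \<mapsto> a \<otimes> b also serves for b
  \<mapsto> a \<otimes> b.\<close>

lemma flip: "hilbert_tensor B A D (\<lambda>b a. t a b)"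
proof
  have "{t a b | b a. b \<in> B \<and> a \<in> A} = {t a b | a b. a \<in> A \<and> b \<in> B}" by auto
  then show "is_tensor_product B A D (\<lambda>b a. t a b)"
    using tens by (simp add: is_tensor_product_def mult.commute)
qed (fact cB cA)+

lemma oper_eqI:
  assumes "S \<in> bounded_ops D E" "T \<in> bounded_ops D E'" "\<And>a b. a \<in> A \<Longrightarrow> b \<in> B \<Longrightarrow> S (t a b) = T (t a b)"
  shows "S = T"
  by (rule bounded_ops_eqI[OF cD assms(1,2) dense]) (use assms(3) in auto)

lemma subset_closedI:
  assumes "closed_csubspace N" "\<And>a b. a \<in> A \<Longrightarrow> b \<in> B \<Longrightarrow> t a b \<in> N"
  shows "D \<subseteq> N"
  unfolding dense[symmetric] by (rule closure_span_minimal[OF assms(1)]) (use assms(2) in auto)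

text \<open>Elementary tensors are total in D, so inner products with them determine a vector.
  Bilinearity of t is deduced from this, since only its inner products are given.\<close>

lemma vec_eqI:
  assumes u: "u \<in> D" and w: "w \<in> D"
    and eq: "\<And>a b. a \<in> A \<Longrightarrow> b \<in> B \<Longrightarrow> cinner (t a b) u = cinner (t a b) w"
  shows "u = w"
proof -
  have "closed_csubspace {z. cinner z (u - w) = 0}"
    by (auto simp: closed_csubspace_def cvec.subspace_def cinner_add_left cinner_scaleC_left
        intro!: closed_Collect_eq continuous_intros)
  then have "D \<subseteq> {z. cinner z (u - w) = 0}"
    by (rule subset_closedI) (simp add: cinner_diff_right eq)
  then have "cinner (u - w) (u - w) = 0"
    using closed_csubspaceD(5)[OF cD u w] by blast
  then show ?thesis by simp
qed

lemmas memA = closed_csubspaceD[OF cA] and memB = closed_csubspaceD[OF cB] and memD = closed_csubspaceD[OF cD]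

lemma add_left: "a \<in> A \<Longrightarrow> a' \<in> A \<Longrightarrow> b \<in> B \<Longrightarrow> t (a + a') b = t a b + t a' b"
  by (rule vec_eqI) (simp_all add: mem memA memD cinner_t cinner_add_right distrib_right)

lemma scale_left: "a \<in> A \<Longrightarrow> b \<in> B \<Longrightarrow> t (r *\<^sub>C a) b = r *\<^sub>C t a b"
  by (rule vec_eqI) (simp_all add: mem memA memD cinner_t cinner_scaleC_right)

lemma add_right: "a \<in> A \<Longrightarrow> b \<in> B \<Longrightarrow> b' \<in> B \<Longrightarrow> t a (b + b') = t a b + t a b'"
  by (rule vec_eqI) (simp_all add: mem memB memD cinner_t cinner_add_right distrib_left)

lemma scale_right: "a \<in> A \<Longrightarrow> b \<in> B \<Longrightarrow> t a (r *\<^sub>C b) = r *\<^sub>C t a b"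
  by (rule vec_eqI) (simp_all add: mem memB memD cinner_t cinner_scaleC_right)

lemma zero_left: "b \<in> B \<Longrightarrow> t 0 b = 0"
  using scale_left[of 0 b 0] memA(1) by simp

lemma zero_right: "a \<in> A \<Longrightarrow> t a 0 = 0"
  using scale_right[of a 0 0] memB(1) by simp

lemma norm_t: "a \<in> A \<Longrightarrow> b \<in> B \<Longrightarrow> norm (t a b) = norm a * norm b"
proof -
  assume ab: "a \<in> A" "b \<in> B"
  have "complex_of_real ((norm (t a b))\<^sup>2) = complex_of_real ((norm a * norm b)\<^sup>2)"
    using cinner_t[OF ab ab] by (simp add: cinner_self power_mult_distrib)
  then have "(norm (t a b))\<^sup>2 = (norm a * norm b)\<^sup>2" by (simp only: of_real_eq_iff)
  then show ?thesis by (simp add: power2_eq_iff_nonneg)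
qed

section \<open>Creation operators and their adjoints\<close>

abbreviation R :: "'v \<Rightarrow> 'v oper" where "R \<equiv> rcreate A B t"

lemma rcreate_apply_gen: "R b x = t (id_op A x) (id_op B b)"
proof -
  have "bounded_linear (\<lambda>x. t (id_op A x) (id_op B b))"
  proof (rule bounded_linear_intro)
    show "norm (t (id_op A x) (id_op B b)) \<le> norm x * norm (id_op B b)" for x
      by (simp add: norm_t id_op[OF cA] id_op[OF cB] mult_right_mono)
  qed (simp_all add: blinfun.add_right scaleR_scaleC clinD[OF id_op(5)[OF cA]] add_left scale_left
      id_op(3)[OF cA] id_op(3)[OF cB])
  then show ?thesis by (simp add: rcreate_def bounded_linear_Blinfun_apply)
qed

lemma rcreate_apply: "b \<in> B \<Longrightarrow> a \<in> A \<Longrightarrow> R b a = t a b"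
  by (simp add: rcreate_apply_gen id_op[OF cA] id_op[OF cB])

lemma rcreate_bounded_ops: "R b \<in> bounded_ops A D"
proof (rule bounded_opsI)
  fix x assume "\<And>a. a \<in> A \<Longrightarrow> cinner a x = 0"
  then have "id_op A x = 0" using bounded_opsD(3)[OF id_op(1)[OF cA]] by blast
  then show "R b x = 0" by (simp add: rcreate_apply_gen zero_left id_op(3)[OF cB])
qed (simp_all add: rcreate_apply_gen mem id_op[OF cA] id_op[OF cB] clin_def clinD[OF id_op(5)[OF cA]] scale_left)

lemma clin_rcreate: "clin (R b)"
  by (rule bounded_opsD(1)[OF rcreate_bounded_ops])

lemma adj_rcreate_bounded_ops: "adj (R b) \<in> bounded_ops D A"
  by (rule bounded_ops_adj[OF cA cD rcreate_bounded_ops])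

lemma rcreate_scale: "R (z *\<^sub>C b) = scaleC_oper z (R b)"
  by (rule blinfun_eqI) (simp add: rcreate_apply_gen clinD[OF id_op(5)[OF cB]] scale_right id_op[OF cA] id_op[OF cB])

lemma norm_rcreate_le: "norm (R b) \<le> norm b"
proof (rule norm_blinfun_bound)
  have "norm (R b x) = norm (id_op B b) * norm (id_op A x)" for x
    by (simp add: rcreate_apply_gen norm_t id_op(3)[OF cA] id_op(3)[OF cB])
  then show "norm (R b x) \<le> norm b * norm x" for x
    by (simp add: mult_mono id_op(6)[OF cA] id_op(6)[OF cB])
qed simp

lemma bounded_linear_rcreate: "bounded_linear R"
proof (rule bounded_linear_intro)
  show "R (x + y) = R x + R y" for x y
    by (rule blinfun_eqI)
      (simp add: rcreate_apply_gen blinfun.add_right blinfun.add_left add_right id_op(3)[OF cA] id_op(3)[OF cB])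
  show "R (r *\<^sub>R x) = r *\<^sub>R R x" for r x
    by (rule blinfun_eqI) (simp add: scaleR_scaleC rcreate_scale blinfun.scaleR_left)
  show "norm (R x) \<le> norm x * 1" for x by (simp add: norm_rcreate_le)
qed

text \<open>The annihilation operator contracts the second leg against b; it is what turns a vector
  functional on that leg into a slice.\<close>

lemma adj_rcreate_apply:
  assumes "b \<in> B" "a \<in> A" "b' \<in> B"
  shows "adj (R b) (t a b') = cinner b b' *\<^sub>C a"
proof -
  have "cinner (adj (R b) (t a b')) x = cinner (cinner b b' *\<^sub>C a) x" for x
  proof -
    have "cinner (adj (R b) (t a b')) x = cinner (t a b') (t (id_op A x) b)"
      using assms by (simp add: cinner_adj[OF clin_rcreate, symmetric] rcreate_apply_gen id_op[OF cB])
    also have "\<dots> = cinner a (id_op A x) * cinner b' b"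
      using assms by (simp add: cinner_t id_op(3)[OF cA])
    also have "cinner a (id_op A x) = cinner a x"
      using id_op(4)[OF cA \<open>a \<in> A\<close>, of x] by (simp add: cinner_diff_right)
    finally show ?thesis using cinner_commute[of b' b] by (simp add: cinner_scaleC_left mult.commute)
  qed
  then show ?thesis by (rule cinner_left_ext)
qed

lemma adj_rcreate_comp:
  assumes b: "b \<in> B" and b': "b' \<in> B"
  shows "adj (R b) o\<^sub>L R b' = scaleC_oper (cinner b b') (id_op A)"
  by (rule blinfun_eqI)
    (simp add: rcreate_apply_gen id_op[OF cB] b' adj_rcreate_apply[OF b id_op(3)[OF cA] b'])

end

text \<open>Expanding in an orthonormal system of the first leg shows that \<open>id \<otimes> s\<close> is bounded.\<close>

lemma tensor_amplification:
  assumes T: "hilbert_tensor A B D t" and T': "hilbert_tensor A B' D' t'" and s: "s \<in> bounded_ops B B'"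
  shows "\<exists>S :: 'v :: complex_hilbert_space oper. S \<in> bounded_ops D D' \<and>
    (\<forall>a\<in>A. \<forall>b\<in>B. S (t a b) = t' a (s b)) \<and> norm S \<le> norm s"
proof -
  interpret T: hilbert_tensor A B D t by (fact T)
  interpret T': hilbert_tensor A B' D' t' by (fact T')
  note sB = bounded_opsD(2)[OF s]
  let ?basis = "\<lambda>S E. finite E \<and> orthonormal E \<and> E \<subseteq> A \<and> S \<subseteq> cvec.span E"
    and ?rep = "\<lambda>E x y. \<exists>f. (\<forall>e. f e \<in> B) \<and> x = (\<Sum>e\<in>E. t e (f e)) \<and> y = (\<Sum>e\<in>E. t' e (s (f e)))"
  let ?I = "A \<times> B" and ?G = "\<lambda>(a, b). t a b" and ?G' = "\<lambda>(a, b). t' a (s b)"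
  have sum_left: "t (\<Sum>e\<in>E. r e *\<^sub>C e) b = (\<Sum>e\<in>E. t e (r e *\<^sub>C b))" if "E \<subseteq> A" "b \<in> B" "finite E" for E r b
    using that(3,1)
    by (induction rule: finite_induct)
      (auto simp: T.zero_left T.add_left T.scale_left T.scale_right that closed_csubspace_sum[OF T.cA] T.memA subset_iff)
  have sum_left': "t' (\<Sum>e\<in>E. r e *\<^sub>C e) b = (\<Sum>e\<in>E. t' e (r e *\<^sub>C b))" if "E \<subseteq> A" "b \<in> B'" "finite E" for E r b
    using that(3,1)
    by (induction rule: finite_induct)
      (auto simp: T'.zero_left T'.add_left T'.scale_left T'.scale_right that closed_csubspace_sum[OF T'.cA] T'.memA subset_iff)
  \<comment> \<open>S collects the first legs that occur in x. The expansion is claimed for every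
    orthonormal E whose span contains S, so that in the additive case both summands can be expanded
    in the same E.\<close>
  have expand: "\<exists>S. finite S \<and> S \<subseteq> A \<and> (\<forall>E. ?basis S E \<longrightarrow> ?rep E x y)"
    if "lin_rel ?I ?G ?G' x y" for x y
    using that
  proof (induction rule: lin_rel.induct)
    case lin_rel_zero
    show ?case
      by (intro exI[of _ "{}"] conjI allI impI exI[of _ "\<lambda>_. 0"])
        (auto simp: T.memB T.zero_right T'.zero_right blinfun.zero_right subset_iff intro!: sum.neutral[symmetric])
  next
    case (lin_rel_gen i)
    obtain a b where i: "i = (a, b)" "a \<in> A" "b \<in> B" using lin_rel_gen by auto
    show ?case
    proof (intro exI[of _ "{a}"] conjI allI impI)
      fix E assume "?basis {a} E"
      then have E: "finite E" "orthonormal E" "E \<subseteq> A" "{a} \<subseteq> cvec.span E" by auto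
      have a: "(\<Sum>e\<in>E. cinner e a *\<^sub>C e) = a" using E by (intro orthonormal_expansion) auto
      show "\<exists>f. (\<forall>e. f e \<in> B) \<and> ?G i = (\<Sum>e\<in>E. t e (f e)) \<and> ?G' i = (\<Sum>e\<in>E. t' e (s (f e)))"
        using sum_left[OF E(3) i(3) E(1), of "\<lambda>e. cinner e a"]
          sum_left'[OF E(3) sB[OF i(3)] E(1), of "\<lambda>e. cinner e a"]
        by (intro exI[of _ "\<lambda>e. cinner e a *\<^sub>C b"]) (simp add: a i T.memB clinD[OF bounded_opsD(1)[OF s]])
    qed (use i in auto)
  next
    case (lin_rel_add x y x' y')
    obtain S where S: "finite S" "S \<subseteq> A" "\<And>E. ?basis S E \<Longrightarrow> ?rep E x y"
      using lin_rel_add.IH(1) by blast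
    obtain S' where S': "finite S'" "S' \<subseteq> A" "\<And>E. ?basis S' E \<Longrightarrow> ?rep E x' y'"
      using lin_rel_add.IH(2) by blast
    show ?case
    proof (intro exI[of _ "S \<union> S'"] conjI allI impI)
      fix E assume "?basis (S \<union> S') E"
      then have E: "finite E" "orthonormal E" "E \<subseteq> A" "S \<union> S' \<subseteq> cvec.span E" by auto
      obtain f where f: "\<And>e. f e \<in> B" "x = (\<Sum>e\<in>E. t e (f e))" "y = (\<Sum>e\<in>E. t' e (s (f e)))"
        using S(3)[of E] E by auto
      obtain g where g: "\<And>e. g e \<in> B" "x' = (\<Sum>e\<in>E. t e (g e))" "y' = (\<Sum>e\<in>E. t' e (s (g e)))"
        using S'(3)[of E] E by auto
      have "t e (f e + g e) = t e (f e) + t e (g e)" "t' e (s (f e + g e)) = t' e (s (f e)) + t' e (s (g e))"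
        if "e \<in> E" for e
        using that E(3) f(1) g(1) by (auto simp: T.add_right T'.add_right sB blinfun.add_right subset_iff)
      then show "\<exists>h. (\<forall>e. h e \<in> B) \<and> x + x' = (\<Sum>e\<in>E. t e (h e)) \<and> y + y' = (\<Sum>e\<in>E. t' e (s (h e)))"
        by (intro exI[of _ "\<lambda>e. f e + g e"]) (simp add: f g T.memB sum.distrib)
    qed (use S S' in auto)
  next
    case (lin_rel_scale x y z)
    obtain S where S: "finite S" "S \<subseteq> A" "\<And>E. ?basis S E \<Longrightarrow> ?rep E x y"
      using lin_rel_scale.IH by blast
    show ?case
    proof (intro exI[of _ S] conjI allI impI)
      fix E assume "?basis S E"
      then have E: "finite E" "orthonormal E" "E \<subseteq> A" "S \<subseteq> cvec.span E" by auto
      obtain f where f: "\<And>e. f e \<in> B" "x = (\<Sum>e\<in>E. t e (f e))" "y = (\<Sum>e\<in>E. t' e (s (f e)))"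
        using S(3)[of E] E by auto
      have "t e (z *\<^sub>C f e) = z *\<^sub>C t e (f e)" "t' e (s (z *\<^sub>C f e)) = z *\<^sub>C t' e (s (f e))" if "e \<in> E" for e
        using that E(3) f(1) by (auto simp: T.scale_right T'.scale_right sB clinD[OF bounded_opsD(1)[OF s]] subset_iff)
      then show "\<exists>h. (\<forall>e. h e \<in> B) \<and> z *\<^sub>C x = (\<Sum>e\<in>E. t e (h e)) \<and> z *\<^sub>C y = (\<Sum>e\<in>E. t' e (s (h e)))"
        by (intro exI[of _ "\<lambda>e. z *\<^sub>C f e"]) (simp add: f T.memB cvec.scale_sum_right)
    qed (use S in auto)
  qed
  have bound: "norm y \<le> norm s * norm x" if xy: "lin_rel ?I ?G ?G' x y" for x y
  proof -
    obtain S where S: "finite S" "S \<subseteq> A" "\<And>E. ?basis S E \<Longrightarrow> ?rep E x y"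
      using expand[OF xy] by blast
    obtain E where E: "finite E" "orthonormal E" "E \<subseteq> cvec.span S" "S \<subseteq> cvec.span E"
      using gram_schmidt[OF S(1)] by blast
    have EA: "E \<subseteq> A"
      using E(3) S(2) cvec.span_minimal[of S A] T.cA by (auto simp: closed_csubspace_def)
    obtain f where f: "\<And>e. f e \<in> B" "x = (\<Sum>e\<in>E. t e (f e))" "y = (\<Sum>e\<in>E. t' e (s (f e)))"
      using S(3)[of E] E EA by auto
    \<comment> \<open>For distinct e in E the summands are orthogonal, so the norm of the sum obeys
      Pythagoras. This serves the source and the target tensor product alike.\<close>
    have ns: "(norm (\<Sum>e\<in>E. u e (h e)))\<^sup>2 = (\<Sum>e\<in>E. (norm (h e))\<^sup>2)"
      if u: "\<And>e e'. e \<in> E \<Longrightarrow> e' \<in> E \<Longrightarrow> cinner (u e (h e)) (u e' (h e')) = cinner e e' * cinner (h e) (h e')"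
      for u :: "'v \<Rightarrow> 'v \<Rightarrow> 'v" and h
    proof -
      have "cinner (\<Sum>e\<in>E. u e (h e)) (\<Sum>e\<in>E. u e (h e)) = (\<Sum>e\<in>E. \<Sum>e'\<in>E. cinner (u e (h e)) (u e' (h e')))"
        by (simp only: cinner_sum_left) (simp only: cinner_sum_right)
      also have "\<dots> = (\<Sum>e\<in>E. \<Sum>e'\<in>E. if e = e' then cinner (h e) (h e) else 0)"
        using E(2) by (intro sum.cong refl) (auto simp: u orthonormal_def)
      also have "\<dots> = complex_of_real (\<Sum>e\<in>E. (norm (h e))\<^sup>2)"
        using E(1) by (simp add: cinner_self)
      finally show ?thesis by (simp only: cinner_self of_real_eq_iff)
    qed
    have nx: "(norm x)\<^sup>2 = (\<Sum>e\<in>E. (norm (f e))\<^sup>2)"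
      unfolding f(2) by (rule ns) (use EA in \<open>auto simp: T.cinner_t f(1) subset_iff\<close>)
    have "(norm y)\<^sup>2 = (\<Sum>e\<in>E. (norm (s (f e)))\<^sup>2)"
      unfolding f(3) by (rule ns[of t' "\<lambda>e. s (f e)"]) (use EA in \<open>auto simp: T'.cinner_t f(1) sB subset_iff\<close>)
    also have "\<dots> \<le> (\<Sum>e\<in>E. (norm s * norm (f e))\<^sup>2)"
      by (intro sum_mono power_mono norm_blinfun norm_ge_zero)
    also have "\<dots> = (norm s * norm x)\<^sup>2"
      by (simp add: power_mult_distrib nx sum_distrib_left)
    finally show ?thesis by (rule power2_le_imp_le) simp
  qed
  have "?G' ` ?I \<subseteq> D'" by (auto intro: T'.mem sB)
  then have "\<exists>S :: 'v oper. S \<in> bounded_ops (closure (cvec.span (?G ` ?I))) D' \<and>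
    (\<forall>i\<in>?I. S (?G i) = ?G' i) \<and> norm S \<le> norm s"
    by (intro bounded_extension[OF T'.cD]) (use bound in auto)
  then show ?thesis unfolding T.dense by auto
qed

text \<open>Unitaries preserve inner products of elementary tensors, so
  \<open>unitary_extension\<close> applies directly.\<close>

lemma tensor_unitary:
  assumes T: "hilbert_tensor A B D t" and T': "hilbert_tensor A' B' D' t'"
    and f: "unitary_op A A' f" and g: "unitary_op B B' g"
  shows "\<exists>S :: 'v :: complex_hilbert_space oper. unitary_op D D' S \<and> (\<forall>a\<in>A. \<forall>b\<in>B. S (t a b) = t' (f a) (g b))"
proof -
  interpret T: hilbert_tensor A B D t by (fact T)
  interpret T': hilbert_tensor A' B' D' t' by (fact T')
  note fA = bounded_opsD(2)[OF unitary_opD(1)[OF f]] and gB = bounded_opsD(2)[OF unitary_opD(1)[OF g]]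
  have "(\<lambda>(a, b). t' (f a) (g b)) ` (A \<times> B) = (\<lambda>(a, b). t' a b) ` (f ` A \<times> g ` B)"
    by force
  then have "closure (cvec.span ((\<lambda>(a, b). t' (f a) (g b)) ` (A \<times> B))) = D'"
    using T'.dense unitary_op_image[OF T.cA T'.cA f] unitary_op_image[OF T.cB T'.cB g] by simp
  then have "\<exists>S :: 'v oper. unitary_op D D' S \<and> (\<forall>i\<in>A\<times>B. S ((\<lambda>(a, b). t a b) i) = (\<lambda>(a, b). t' (f a) (g b)) i)"
    by (intro unitary_extension T.dense)
      (auto simp: T.cinner_t T'.cinner_t fA gB unitary_op_cinner[OF T.cA f] unitary_op_cinner[OF T.cB g])
  then show ?thesis by auto
qed

text \<open>\<open>bounded_linear\<close> speaks of real linearity, so the antilinearity of the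
  adjoint does no harm.\<close>

lemma bounded_linear_adj_family:
  fixes \<phi> :: "'a :: real_normed_vector \<Rightarrow> 'v :: complex_hilbert_space oper"
  assumes \<phi>: "bounded_linear \<phi>" and cl: "\<And>x. clin (\<phi> x)"
  shows "bounded_linear (\<lambda>x. adj (\<phi> x))"
proof -
  obtain K where K: "\<And>x. norm (\<phi> x) \<le> norm x * K"
    using bounded_linear.bounded[OF \<phi>] by blast
  have sc: "r *\<^sub>R T = scaleC_oper (complex_of_real r) T" for r and T :: "'v oper"
    by (rule blinfun_eqI) (simp add: blinfun.scaleR_left scaleR_scaleC)
  show ?thesis
  proof (rule bounded_linear_intro)
    show "adj (\<phi> (x + y)) = adj (\<phi> x) + adj (\<phi> y)" for x y
      by (simp add: linear_add[OF bounded_linear.linear[OF \<phi>]] adj_add cl)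
    show "adj (\<phi> (r *\<^sub>R x)) = r *\<^sub>R adj (\<phi> x)" for r x
      by (simp add: linear_cmul[OF bounded_linear.linear[OF \<phi>]] sc adj_scaleC cl)
    show "norm (adj (\<phi> x)) \<le> norm x * K" for x
      using norm_adj_le[OF cl] K order_trans by blast
  qed
qed

section \<open>Creation operators and slices in a concrete monoidal category\<close>

context concrete_monoidal_wstar_category
begin

lemmas [simp] = tobj_Obj Hilb_closed

lemma tensor_obj: "X \<in> Obj C \<Longrightarrow> Y \<in> Obj C \<Longrightarrow>
    hilbert_tensor (Hilb C X) (Hilb C Y) (Hilb2 C X Y) (tvec C X Y)"
  by unfold_locales (simp_all add: tvec_tensor)

abbreviation R :: "'o \<Rightarrow> 'o \<Rightarrow> 'v \<Rightarrow> 'v oper" where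
  "R X Y \<equiv> rcreate (Hilb C X) (Hilb C Y) (tvec C X Y)"

text \<open>Left creation is right creation for the flipped tensor product. Unlike
  \<open>lcreate\<close> it is given by a formula and makes sense for every vector of the ambient
  space.\<close>

abbreviation Lc :: "'o \<Rightarrow> 'o \<Rightarrow> 'v \<Rightarrow> 'v oper" where
  "Lc X Y \<equiv> rcreate (Hilb C Y) (Hilb C X) (\<lambda>y x. tvec C X Y x y)"

lemma tvec_mem [simp]:
  "X \<in> Obj C \<Longrightarrow> Y \<in> Obj C \<Longrightarrow> x \<in> Hilb C X \<Longrightarrow> y \<in> Hilb C Y \<Longrightarrow> tvec C X Y x y \<in> Hilb2 C X Y"
  by (rule hilbert_tensor.mem[OF tensor_obj])

lemma R_apply [simp]:
  "X \<in> Obj C \<Longrightarrow> Y \<in> Obj C \<Longrightarrow> x \<in> Hilb C X \<Longrightarrow> y \<in> Hilb C Y \<Longrightarrow> R X Y y x = tvec C X Y x y"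
  by (rule hilbert_tensor.rcreate_apply[OF tensor_obj])

lemma Lc_apply [simp]:
  "X \<in> Obj C \<Longrightarrow> Y \<in> Obj C \<Longrightarrow> x \<in> Hilb C X \<Longrightarrow> y \<in> Hilb C Y \<Longrightarrow> Lc X Y x y = tvec C X Y x y"
  using hilbert_tensor.rcreate_apply[OF hilbert_tensor.flip[OF tensor_obj]] .

lemma R_bounded_ops [simp]: "X \<in> Obj C \<Longrightarrow> Y \<in> Obj C \<Longrightarrow> R X Y y \<in> bounded_ops (Hilb C X) (Hilb2 C X Y)"
  by (rule hilbert_tensor.rcreate_bounded_ops[OF tensor_obj])

lemma Lc_bounded_ops [simp]: "X \<in> Obj C \<Longrightarrow> Y \<in> Obj C \<Longrightarrow> Lc X Y x \<in> bounded_ops (Hilb C Y) (Hilb2 C X Y)"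
  by (rule hilbert_tensor.rcreate_bounded_ops[OF hilbert_tensor.flip[OF tensor_obj]])

lemma clin_R [simp]: "X \<in> Obj C \<Longrightarrow> Y \<in> Obj C \<Longrightarrow> clin (R X Y y)"
  by (rule hilbert_tensor.clin_rcreate[OF tensor_obj])

lemma clin_Lc [simp]: "X \<in> Obj C \<Longrightarrow> Y \<in> Obj C \<Longrightarrow> clin (Lc X Y y)"
  by (rule hilbert_tensor.clin_rcreate[OF hilbert_tensor.flip[OF tensor_obj]])

lemma adj_R_bounded_ops [simp]:
  "X \<in> Obj C \<Longrightarrow> Y \<in> Obj C \<Longrightarrow> adj (R X Y y) \<in> bounded_ops (Hilb2 C X Y) (Hilb C X)"
  by (rule hilbert_tensor.adj_rcreate_bounded_ops[OF tensor_obj])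

lemma adj_R_apply [simp]:
  "X \<in> Obj C \<Longrightarrow> Y \<in> Obj C \<Longrightarrow> x \<in> Hilb C X \<Longrightarrow> y \<in> Hilb C Y \<Longrightarrow> y' \<in> Hilb C Y \<Longrightarrow>
    adj (R X Y y) (tvec C X Y x y') = cinner y y' *\<^sub>C x"
  by (rule hilbert_tensor.adj_rcreate_apply[OF tensor_obj])

lemma adj_R_comp_R:
  "X \<in> Obj C \<Longrightarrow> Y \<in> Obj C \<Longrightarrow> y \<in> Hilb C Y \<Longrightarrow> y' \<in> Hilb C Y \<Longrightarrow>
    adj (R X Y y) o\<^sub>L R X Y y' = scaleC_oper (cinner y y') (idm C X)"
  by (rule hilbert_tensor.adj_rcreate_comp[OF tensor_obj])

lemma tensor_oper_eqI:
  "\<lbrakk>X \<in> Obj C; Y \<in> Obj C; S \<in> bounded_ops (Hilb2 C X Y) E; T \<in> bounded_ops (Hilb2 C X Y) E';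
    \<And>x y. x \<in> Hilb C X \<Longrightarrow> y \<in> Hilb C Y \<Longrightarrow> S (tvec C X Y x y) = T (tvec C X Y x y)\<rbrakk> \<Longrightarrow> S = T"
  by (rule hilbert_tensor.oper_eqI[OF tensor_obj])

lemma bounded_ops_self_eqI:
  "X \<in> Obj C \<Longrightarrow> S \<in> bounded_ops (Hilb C X) E \<Longrightarrow> T \<in> bounded_ops (Hilb C X) E' \<Longrightarrow>
    (\<And>x. x \<in> Hilb C X \<Longrightarrow> S x = T x) \<Longrightarrow> S = T"
  by (rule bounded_ops_eqI[OF _ _ _ closure_span_self]) auto

lemma lcreate_eq: "X \<in> Obj C \<Longrightarrow> Y \<in> Obj C \<Longrightarrow> x \<in> Hilb C X \<Longrightarrow> lcreate C X Y x = Lc X Y x"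
  unfolding lcreate_def
  by (rule the_equality, simp, elim conjE, rule bounded_ops_self_eqI[OF _ _ Lc_bounded_ops]) simp_all

text \<open>The slices by the vector functionals <y', _ y>, written with creation operators so that
  neither a functional nor a definite description occurs.\<close>

definition vslices :: "'o \<Rightarrow> 'o \<Rightarrow> 'o \<Rightarrow> 'o \<Rightarrow> 'v oper \<Rightarrow> 'v oper set" where
  "vslices X Y X' Y' T = {adj (R X' Y' y') o\<^sub>L T o\<^sub>L R X Y y | y y'. y \<in> Hilb C Y \<and> y' \<in> Hilb C Y'}"

lemma vslices_bounded_ops:
  assumes "X \<in> Obj C" "Y \<in> Obj C" "X' \<in> Obj C" "Y' \<in> Obj C"
    and "T \<in> bounded_ops (Hilb2 C X Y) (Hilb2 C X' Y')"
  shows "vslices X Y X' Y' T \<subseteq> bounded_ops (Hilb C X) (Hilb C X')"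
proof -
  have "adj (R X' Y' y') o\<^sub>L T o\<^sub>L R X Y y \<in> bounded_ops (Hilb C X) (Hilb C X')" for y y'
    by (rule bounded_ops_comp[OF R_bounded_ops bounded_ops_comp[OF assms(5) adj_R_bounded_ops]])
      (use assms in auto)
  then show ?thesis unfolding vslices_def by blast
qed

text \<open>The slice by a general normal functional is a norm-convergent series of vector slices,
  because creation operators are bounded by the norms of their vectors and both sequences are
  square-summable.\<close>

lemma slice_series:
  assumes obj: "X \<in> Obj C" "Y \<in> Obj C" "X' \<in> Obj C" "Y' \<in> Obj C"
    and T: "T \<in> bounded_ops (Hilb2 C X Y) (Hilb2 C X' Y')"
    and x: "\<And>n. x n \<in> Hilb C Y" and y: "\<And>n. y n \<in> Hilb C Y'"
    and sx: "summable (\<lambda>n. (norm (x n))\<^sup>2)" and sy: "summable (\<lambda>n. (norm (y n))\<^sup>2)"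
  shows "slice C X Y X' Y' (\<lambda>T. \<Sum>n. cinner (y n) (T (x n))) T
      = (\<Sum>n. adj (R X' Y' (y n)) o\<^sub>L T o\<^sub>L R X Y (x n))" (is "slice C X Y X' Y' ?\<omega> T = (\<Sum>n. ?f n)")
    and "(\<Sum>n. adj (R X' Y' (y n)) o\<^sub>L T o\<^sub>L R X Y (x n)) \<in> closed_span (vslices X Y X' Y' T)"
proof -
  note [simp] = obj
  note R_le = hilbert_tensor.norm_rcreate_le[OF tensor_obj]
  have nf: "norm (?f n) \<le> norm T * ((norm (x n))\<^sup>2 + (norm (y n))\<^sup>2)" for n
  proof -
    have "norm (?f n) \<le> norm (adj (R X' Y' (y n)) o\<^sub>L T) * norm (R X Y (x n))"
      by (rule norm_blinfun_compose)
    also have "\<dots> \<le> (norm (adj (R X' Y' (y n))) * norm T) * norm (R X Y (x n))"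
      by (intro mult_right_mono norm_blinfun_compose norm_ge_zero)
    also have "\<dots> \<le> (norm (y n) * norm T) * norm (x n)"
      using order_trans[OF norm_adj_le[OF clin_R[OF obj(3,4)]] R_le[OF obj(3,4)]] R_le[OF obj(1,2)]
      by (intro mult_mono mult_nonneg_nonneg) auto
    also have "\<dots> = norm T * (norm (x n) * norm (y n))" by (simp add: mult_ac)
    \<comment> \<open>Bounding the product by the sum of the squares gives a summable
      majorant.\<close>
    also have "norm (x n) * norm (y n) \<le> (norm (x n))\<^sup>2 + (norm (y n))\<^sup>2"
    proof -
      have "0 \<le> norm (x n) * norm (y n)" by simp
      moreover have "2 * (norm (x n) * norm (y n)) \<le> (norm (x n))\<^sup>2 + (norm (y n))\<^sup>2"
        using sum_squares_bound[of "norm (x n)" "norm (y n)"] by (simp add: mult.assoc)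
      ultimately show ?thesis by linarith
    qed
    finally show ?thesis by (simp add: mult_left_mono)
  qed
  have "summable (\<lambda>n. norm T * ((norm (x n))\<^sup>2 + (norm (y n))\<^sup>2))"
    by (intro summable_mult summable_add sx sy)
  then have sm: "summable ?f"
    by (rule summable_comparison_test'[where N = 0]) (rule nf)
  let ?S = "\<Sum>n. ?f n"
  have cs: "closed_osubspace (closed_span (vslices X Y X' Y' T))" by (rule closed_osubspace_closed_span)
  have "?f n \<in> closed_span (vslices X Y X' Y' T)" for n
    using closed_span_superset[of "vslices X Y X' Y' T"] x y unfolding vslices_def by blast
  then have "sum ?f {..<n} \<in> closed_span (vslices X Y X' Y' T)" for n
    using cs by (auto simp: closed_osubspace_def intro!: coper.subspace_sum)
  then show 1: "?S \<in> closed_span (vslices X Y X' Y' T)"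
    using closed_sequentially[of "closed_span (vslices X Y X' Y' T)" "\<lambda>n. sum ?f {..<n}"]
      summable_LIMSEQ[OF sm] cs by (auto simp: closed_osubspace_def)
  have S: "?S \<in> bounded_ops (Hilb C X) (Hilb C X')"
    using 1 closed_span_minimal[OF closed_osubspace_bounded_ops vslices_bounded_ops[OF obj T]] by auto
  have eq: "cinner u' (?S u) = ?\<omega> (adj (lcreate C X' Y' u') o\<^sub>L T o\<^sub>L lcreate C X Y u)"
    if u: "u \<in> Hilb C X" "u' \<in> Hilb C X'" for u u'
  proof -
    have "bounded_linear (\<lambda>S. cinner u' (blinfun_apply S u))"
      by (rule bounded_linear_compose[OF bounded_linear_cinner_right blinfun.bounded_linear_left])
    then have "cinner u' (?S u) = (\<Sum>n. cinner u' (?f n u))"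
      by (rule bounded_linear.suminf[OF _ sm])
    moreover have "cinner u' (?f n u) = cinner (y n) ((adj (lcreate C X' Y' u') o\<^sub>L T o\<^sub>L lcreate C X Y u) (x n))" for n
      using u x[of n] y[of n] by (simp add: lcreate_eq cinner_adj'[OF clin_R, symmetric] cinner_adj'[OF clin_Lc, symmetric])
    ultimately show ?thesis by simp
  qed
  show "slice C X Y X' Y' ?\<omega> T = ?S"
    unfolding slice_def
  proof (rule the_equality)
    fix S' assume S': "S' \<in> bounded_ops (Hilb C X) (Hilb C X') \<and> (\<forall>u\<in>Hilb C X. \<forall>u'\<in>Hilb C X'.
        cinner u' (S' u) = ?\<omega> (adj (lcreate C X' Y' u') o\<^sub>L T o\<^sub>L lcreate C X Y u))"
    show "S' = ?S"
    proof (rule bounded_ops_self_eqI[OF obj(1) conjunct1[OF S'] S])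
      fix u assume u: "u \<in> Hilb C X"
      \<comment> \<open>The difference lies in the space of test vectors, so it may be tested
        against itself.\<close>
      have "S' u - ?S u \<in> Hilb C X'"
        using S' S u by (intro closed_csubspaceD(5) bounded_opsD(2)) auto
      then have "cinner (S' u - ?S u) (S' u) = cinner (S' u - ?S u) (?S u)"
        using eq u S' by auto
      then have "cinner (S' u - ?S u) (S' u - ?S u) = 0" by (simp add: cinner_diff_right)
      then show "S' u = ?S u" by simp
    qed
  qed (use S eq in blast)
qed

text \<open>One inclusion expands a normal functional into vector functionals; the other regards a
  vector functional as a series with a single term. From here on slice spans are handled through
  vector slices.\<close>

lemma slice_span_eq:
  assumes obj: "X \<in> Obj C" "Y \<in> Obj C" "X' \<in> Obj C" "Y' \<in> Obj C"
    and T: "T \<in> bounded_ops (Hilb2 C X Y) (Hilb2 C X' Y')"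
  shows "slice_span C X Y X' Y' T = closed_span (vslices X Y X' Y' T)"
proof
  show "slice_span C X Y X' Y' T \<subseteq> closed_span (vslices X Y X' Y' T)"
    unfolding slice_span_def
  proof (intro closed_span_le image_subsetI)
    fix \<omega> assume "\<omega> \<in> predual (Hilb C Y) (Hilb C Y')"
    then obtain x y where \<omega>: "\<omega> = (\<lambda>T. \<Sum>n. cinner (y n) (blinfun_apply T (x n)))"
      and xy: "range x \<subseteq> Hilb C Y" "range y \<subseteq> Hilb C Y'" "summable (\<lambda>n. (norm (x n))\<^sup>2)" "summable (\<lambda>n. (norm (y n))\<^sup>2)"
      unfolding predual_def by blast
    then have mem: "x n \<in> Hilb C Y" "y n \<in> Hilb C Y'" for n by auto
    show "slice C X Y X' Y' \<omega> T \<in> closed_span (vslices X Y X' Y' T)"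
      unfolding \<omega> slice_series(1)[OF obj T mem xy(3,4)] by (rule slice_series(2)[OF obj T mem xy(3,4)])
  qed
  show "closed_span (vslices X Y X' Y' T) \<subseteq> slice_span C X Y X' Y' T"
    unfolding slice_span_def
  proof (intro closed_span_le subsetI)
    fix S assume "S \<in> vslices X Y X' Y' T"
    then obtain y y' where S: "S = adj (R X' Y' y') o\<^sub>L T o\<^sub>L R X Y y" and y: "y \<in> Hilb C Y" "y' \<in> Hilb C Y'"
      unfolding vslices_def by blast
    \<comment> \<open>The vector functional <y', _ y> as a series in which only the term with index
      0 survives.\<close>
    define u v where "u n = (if n = 0 then y else 0)" and "v n = (if n = 0 then y' else 0)" for n :: nat
    have sum: "summable (\<lambda>n. (norm (u n))\<^sup>2)" "summable (\<lambda>n. (norm (v n))\<^sup>2)"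
      by (auto simp: u_def v_def intro!: summable_finite[of "{0}"] split: if_splits)
    have mem: "u n \<in> Hilb C Y" "v n \<in> Hilb C Y'" for n
      using y closed_csubspaceD(1)[OF Hilb_closed[OF obj(2)]] closed_csubspaceD(1)[OF Hilb_closed[OF obj(4)]]
      by (auto simp: u_def v_def)
    have z: "R X Y 0 = 0"
      using bounded_linear.linear[OF hilbert_tensor.bounded_linear_rcreate[OF tensor_obj[OF obj(1,2)]]] linear_0 by blast
    have "(\<Sum>n. adj (R X' Y' (v n)) o\<^sub>L T o\<^sub>L R X Y (u n)) = (\<Sum>n\<in>{0}. adj (R X' Y' (v n)) o\<^sub>L T o\<^sub>L R X Y (u n))"
      by (rule suminf_finite) (auto simp: u_def z)
    then have "S = slice C X Y X' Y' (\<lambda>T. \<Sum>n. cinner (v n) (blinfun_apply T (u n))) T"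
      using slice_series(1)[OF obj T mem sum] by (simp add: S u_def v_def)
    moreover have "(\<lambda>T. \<Sum>n. cinner (v n) (blinfun_apply T (u n))) \<in> predual (Hilb C Y) (Hilb C Y')"
      unfolding predual_def using mem sum by blast
    ultimately show "S \<in> closed_span ((\<lambda>\<omega>. slice C X Y X' Y' \<omega> T) ` predual (Hilb C Y) (Hilb C Y'))"
      by (intro subsetD[OF closed_span_superset] image_eqI)
  qed
qed

end

section \<open>Tensor products of morphisms and leg calculus\<close>

lemma closed_csubspace_vimage:
  fixes T :: "'v :: complex_hilbert_space oper"
  assumes T: "clin T" and N: "closed_csubspace N"
  shows "closed_csubspace {x. T x \<in> N}"
proof -
  have "closed (blinfun_apply T -` N)"
    by (intro closed_vimage closed_csubspaceD[OF N] continuous_intros)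
  then show ?thesis
    by (auto simp: closed_csubspace_def cvec.subspace_def vimage_def blinfun.add_right blinfun.zero_right
        clinD[OF T] closed_csubspaceD[OF N])
qed

context concrete_monoidal_wstar_category
begin

abbreviation uni :: "'o \<Rightarrow> 'o \<Rightarrow> 'v oper \<Rightarrow> bool" where
  "uni X Y \<equiv> unitary_op (Hilb C X) (Hilb C Y)"

lemma uni_comp [simp]: "X \<in> Obj C \<Longrightarrow> Y \<in> Obj C \<Longrightarrow> Z \<in> Obj C \<Longrightarrow> uni X Y T \<Longrightarrow> uni Y Z S \<Longrightarrow> uni X Z (S o\<^sub>L T)"
  by (rule unitary_op_comp[of _ "Hilb C Y"]) simp_all

lemma uni_adj: "X \<in> Obj C \<Longrightarrow> Y \<in> Obj C \<Longrightarrow> uni X Y T \<Longrightarrow> uni Y X (adj T)"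
  by (rule unitary_op_adj) simp_all

lemma uni_id [simp]: "X \<in> Obj C \<Longrightarrow> uni X X (idm C X)"
  by (rule unitary_op_id) simp

lemma uni_mem: "uni X Y T \<Longrightarrow> x \<in> Hilb C X \<Longrightarrow> T x \<in> Hilb C Y"
  using bounded_opsD(2) unitary_opD(1) by blast

lemma uni_id_left: "X \<in> Obj C \<Longrightarrow> Y \<in> Obj C \<Longrightarrow> uni X Y T \<Longrightarrow> idm C Y o\<^sub>L T = T"
  by (rule bounded_ops_id_left[OF _ _ unitary_opD(1)]) simp_all

lemma uni_id_right: "X \<in> Obj C \<Longrightarrow> uni X Y T \<Longrightarrow> T o\<^sub>L idm C X = T"
  by (rule bounded_ops_id_right[OF _ unitary_opD(1)]) simp_all

lemma idm_idm [simp]: "X \<in> Obj C \<Longrightarrow> idm C X o\<^sub>L idm C X = idm C X"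
  by (rule uni_id_right[OF _ uni_id]) simp_all

lemma idm_apply [simp]: "X \<in> Obj C \<Longrightarrow> x \<in> Hilb C X \<Longrightarrow> idm C X x = x"
  by (rule id_op(2)) simp_all

text \<open>Elementary tensors are total, so a bounded operator with the right values on them is the
  one described by \<open>tmor\<close>.\<close>

lemma tmor_eqI:
  fixes f g T :: "'v oper"
  assumes "X \<in> Obj C" "Y \<in> Obj C" and T: "T \<in> bounded_ops (Hilb2 C X Y) (Hilb2 C X' Y')"
    and eq: "\<And>x y. x \<in> Hilb C X \<Longrightarrow> y \<in> Hilb C Y \<Longrightarrow> T (tvec C X Y x y) = tvec C X' Y' (f x) (g y)"
  shows "tmor C X X' Y Y' f g = T"
  unfolding tmor_def
  by (rule the_equality, use T eq in blast, elim conjE, rule tensor_oper_eqI[OF assms(1,2) _ T])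
    (use eq in auto)

lemma tmor_unitary:
  assumes obj: "X \<in> Obj C" "Y \<in> Obj C" "X' \<in> Obj C" "Y' \<in> Obj C" and fg: "uni X X' f" "uni Y Y' g"
  shows "uni (tobj C X Y) (tobj C X' Y') (tmor C X X' Y Y' f g)"
    and "x \<in> Hilb C X \<Longrightarrow> y \<in> Hilb C Y \<Longrightarrow> tmor C X X' Y Y' f g (tvec C X Y x y) = tvec C X' Y' (f x) (g y)"
proof -
  obtain T where T: "uni (tobj C X Y) (tobj C X' Y') T"
    "\<And>x y. x \<in> Hilb C X \<Longrightarrow> y \<in> Hilb C Y \<Longrightarrow> T (tvec C X Y x y) = tvec C X' Y' (f x) (g y)"
    using tensor_unitary[OF tensor_obj[OF obj(1,2)] tensor_obj[OF obj(3,4)] fg] by blast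
  have "tmor C X X' Y Y' f g = T"
    by (rule tmor_eqI[OF obj(1,2) unitary_opD(1)[OF T(1)] T(2)])
  then show "uni (tobj C X Y) (tobj C X' Y') (tmor C X X' Y Y' f g)"
    and "x \<in> Hilb C X \<Longrightarrow> y \<in> Hilb C Y \<Longrightarrow> tmor C X X' Y Y' f g (tvec C X Y x y) = tvec C X' Y' (f x) (g y)"
    using T by auto
qed

lemma tmor_comp:
  assumes obj: "X \<in> Obj C" "Y \<in> Obj C" "X' \<in> Obj C" "Y' \<in> Obj C" "X'' \<in> Obj C" "Y'' \<in> Obj C"
    and fg: "uni X X' f" "uni Y Y' g" and fg': "uni X' X'' f'" "uni Y' Y'' g'"
  shows "tmor C X' X'' Y' Y'' f' g' o\<^sub>L tmor C X X' Y Y' f g = tmor C X X'' Y Y'' (f' o\<^sub>L f) (g' o\<^sub>L g)"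
proof (rule tmor_eqI[symmetric])
  show "tmor C X' X'' Y' Y'' f' g' o\<^sub>L tmor C X X' Y Y' f g \<in> bounded_ops (Hilb2 C X Y) (Hilb2 C X'' Y'')"
    using bounded_ops_comp[OF unitary_opD(1)[OF tmor_unitary(1)] unitary_opD(1)[OF tmor_unitary(1)]]
      obj fg fg' by blast
qed (use obj fg fg' in \<open>simp_all add: tmor_unitary(2) uni_mem\<close>)

lemma tmor_id: "X \<in> Obj C \<Longrightarrow> Y \<in> Obj C \<Longrightarrow> tmor C X X Y Y (idm C X) (idm C Y) = idm C (tobj C X Y)"
  by (rule tmor_eqI) (simp_all add: id_op(1))

text \<open>S = S T T^* = T^*. With the composition laws this yields the adjoints of f \<otimes> g
  and of legs without computing inner products.\<close>

lemma adj_eq_of_left_inverse: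
  assumes "A \<in> Obj C" "B \<in> Obj C" "uni A B T" "uni B A S" "S o\<^sub>L T = idm C A"
  shows "adj T = S"
proof -
  have "S = S o\<^sub>L (T o\<^sub>L adj T)" using assms unitary_opD(3) uni_id_right by metis
  also have "\<dots> = adj T" using assms uni_id_left uni_adj by (metis oper_comp_assoc)
  finally show ?thesis by simp
qed

lemma tmor_adj:
  assumes obj: "X \<in> Obj C" "Y \<in> Obj C" "X' \<in> Obj C" "Y' \<in> Obj C" and fg: "uni X X' f" "uni Y Y' g"
  shows "adj (tmor C X X' Y Y' f g) = tmor C X' X Y' Y (adj f) (adj g)"
  by (rule adj_eq_of_left_inverse[of "tobj C X Y" "tobj C X' Y'"])
    (use obj fg in \<open>simp_all add: tmor_unitary(1) uni_adj tmor_comp unitary_opD(2)[OF fg(1)] unitary_opD(2)[OF fg(2)] tmor_id\<close>)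

section \<open>Triple tensor products, associators and legs\<close>

lemma triple_subset_left:
  assumes obj: "X \<in> Obj C" "Y \<in> Obj C" "Z \<in> Obj C" and N: "closed_csubspace N"
    and gen: "\<And>x y z. x \<in> Hilb C X \<Longrightarrow> y \<in> Hilb C Y \<Longrightarrow> z \<in> Hilb C Z \<Longrightarrow>
      tvec C (tobj C X Y) Z (tvec C X Y x y) z \<in> N"
  shows "Hilb2 C (tobj C X Y) Z \<subseteq> N"
proof (rule hilbert_tensor.subset_closedI[OF tensor_obj N])
  fix \<xi> z assume \<xi>: "\<xi> \<in> Hilb2 C X Y" and z: "z \<in> Hilb C Z"
  \<comment> \<open>For fixed z the vectors \<xi> with \<xi> \<otimes> z in N form a closed
    subspace, so density is used once in each of the two tensor products.\<close>
  have "Hilb2 C X Y \<subseteq> {\<xi>. R (tobj C X Y) Z z \<xi> \<in> N}"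
    by (rule hilbert_tensor.subset_closedI[OF tensor_obj closed_csubspace_vimage[OF _ N]]) (use obj gen z in auto)
  then show "tvec C (tobj C X Y) Z \<xi> z \<in> N" using \<xi> z obj by auto
qed (use obj in auto)

lemma triple_subset_right:
  assumes obj: "X \<in> Obj C" "Y \<in> Obj C" "Z \<in> Obj C" and N: "closed_csubspace N"
    and gen: "\<And>x y z. x \<in> Hilb C X \<Longrightarrow> y \<in> Hilb C Y \<Longrightarrow> z \<in> Hilb C Z \<Longrightarrow>
      tvec C X (tobj C Y Z) x (tvec C Y Z y z) \<in> N"
  shows "Hilb2 C X (tobj C Y Z) \<subseteq> N"
proof (rule hilbert_tensor.subset_closedI[OF tensor_obj N])
  fix x \<xi> assume \<xi>: "\<xi> \<in> Hilb2 C Y Z" and x: "x \<in> Hilb C X"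
  have "Hilb2 C Y Z \<subseteq> {\<xi>. Lc X (tobj C Y Z) x \<xi> \<in> N}"
    by (rule hilbert_tensor.subset_closedI[OF tensor_obj closed_csubspace_vimage[OF _ N]]) (use obj gen x in auto)
  then show "tvec C X (tobj C Y Z) x \<xi> \<in> N" using \<xi> x obj by auto
qed (use obj in auto)

text \<open>The elementary triple tensors are total in both bracketings and have the same inner
  products there.\<close>

lemma assoc_unitary:
  assumes obj [simp]: "X \<in> Obj C" "Y \<in> Obj C" "Z \<in> Obj C"
  shows "uni (tobj C (tobj C X Y) Z) (tobj C X (tobj C Y Z)) (assoc C X Y Z)"
    and "x \<in> Hilb C X \<Longrightarrow> y \<in> Hilb C Y \<Longrightarrow> z \<in> Hilb C Z \<Longrightarrow>
      assoc C X Y Z (tvec C (tobj C X Y) Z (tvec C X Y x y) z) = tvec C X (tobj C Y Z) x (tvec C Y Z y z)"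
proof -
  define I where "I = Hilb C X \<times> Hilb C Y \<times> Hilb C Z"
  let ?G = "\<lambda>(x, y, z). tvec C (tobj C X Y) Z (tvec C X Y x y) z"
  let ?G' = "\<lambda>(x, y, z). tvec C X (tobj C Y Z) x (tvec C Y Z y z)"
  have 1: "closure (cvec.span (?G ` I)) = Hilb2 C (tobj C X Y) Z"
  proof
    show "closure (cvec.span (?G ` I)) \<subseteq> Hilb2 C (tobj C X Y) Z"
      by (rule closure_span_minimal) (auto simp: I_def)
    show "Hilb2 C (tobj C X Y) Z \<subseteq> closure (cvec.span (?G ` I))"
      by (rule triple_subset_left[OF obj closed_csubspace_closure_span])
        (rule subsetD[OF closure_span_superset], force simp: I_def)
  qed
  have 2: "closure (cvec.span (?G' ` I)) = Hilb2 C X (tobj C Y Z)"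
  proof
    show "closure (cvec.span (?G' ` I)) \<subseteq> Hilb2 C X (tobj C Y Z)"
      by (rule closure_span_minimal) (auto simp: I_def)
    show "Hilb2 C X (tobj C Y Z) \<subseteq> closure (cvec.span (?G' ` I))"
      by (rule triple_subset_right[OF obj closed_csubspace_closure_span])
        (rule subsetD[OF closure_span_superset], force simp: I_def)
  qed
  note ci = hilbert_tensor.cinner_t[OF tensor_obj]
  have "\<exists>T :: 'v oper. uni (tobj C (tobj C X Y) Z) (tobj C X (tobj C Y Z)) T \<and> (\<forall>i\<in>I. T (?G i) = ?G' i)"
    by (rule unitary_extension[OF _ 1 2]) (auto simp: I_def ci)
  then obtain T where T: "uni (tobj C (tobj C X Y) Z) (tobj C X (tobj C Y Z)) T"
    "\<And>x y z. x \<in> Hilb C X \<Longrightarrow> y \<in> Hilb C Y \<Longrightarrow> z \<in> Hilb C Z \<Longrightarrow>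
      T (tvec C (tobj C X Y) Z (tvec C X Y x y) z) = tvec C X (tobj C Y Z) x (tvec C Y Z y z)"
    by (force simp: I_def)
  have "assoc C X Y Z = T"
    unfolding assoc_def
  proof (rule the_equality)
    fix S assume S: "S \<in> bounded_ops (Hilb2 C (tobj C X Y) Z) (Hilb2 C X (tobj C Y Z)) \<and>
      (\<forall>x\<in>Hilb C X. \<forall>y\<in>Hilb C Y. \<forall>z\<in>Hilb C Z.
        S (tvec C (tobj C X Y) Z (tvec C X Y x y) z) = tvec C X (tobj C Y Z) x (tvec C Y Z y z))"
    show "S = T"
      by (rule bounded_ops_eqI[OF _ conjunct1[OF S] unitary_opD(1)[OF T(1)] 1]) (use S T(2) in \<open>auto simp: I_def\<close>)
  qed (use T unitary_opD(1) in blast)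
  then show "uni (tobj C (tobj C X Y) Z) (tobj C X (tobj C Y Z)) (assoc C X Y Z)"
    and "x \<in> Hilb C X \<Longrightarrow> y \<in> Hilb C Y \<Longrightarrow> z \<in> Hilb C Z \<Longrightarrow>
      assoc C X Y Z (tvec C (tobj C X Y) Z (tvec C X Y x y) z) = tvec C X (tobj C Y Z) x (tvec C Y Z y z)"
    using T by auto
qed

lemmas assoc_apply [simp] = assoc_unitary(2)

lemma assoc_inv_unitary:
  "X \<in> Obj C \<Longrightarrow> Y \<in> Obj C \<Longrightarrow> Z \<in> Obj C \<Longrightarrow>
    uni (tobj C X (tobj C Y Z)) (tobj C (tobj C X Y) Z) (assoc_inv C X Y Z)"
  by (rule uni_adj) (simp_all add: assoc_unitary(1))

lemma assoc_inv_apply [simp]: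
  assumes "X \<in> Obj C" "Y \<in> Obj C" "Z \<in> Obj C" "x \<in> Hilb C X" "y \<in> Hilb C Y" "z \<in> Hilb C Z"
  shows "assoc_inv C X Y Z (tvec C X (tobj C Y Z) x (tvec C Y Z y z)) = tvec C (tobj C X Y) Z (tvec C X Y x y) z"
  using unitary_op_apply_adj(2)[OF _ _ assoc_unitary(1)[OF assms(1-3)],
      of "tvec C (tobj C X Y) Z (tvec C X Y x y) z"] assms by simp

lemma leg12_unitary [simp]:
  "\<lbrakk>A \<in> Obj C; B \<in> Obj C; A' \<in> Obj C; B' \<in> Obj C; D \<in> Obj C; uni (tobj C A B) (tobj C A' B') T\<rbrakk> \<Longrightarrow>
    uni (tobj C (tobj C A B) D) (tobj C (tobj C A' B') D) (leg12 C A B A' B' D T)"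
  unfolding leg12_def by (rule tmor_unitary) simp_all

lemma leg12_comp:
  "\<lbrakk>A \<in> Obj C; B \<in> Obj C; A' \<in> Obj C; B' \<in> Obj C; A'' \<in> Obj C; B'' \<in> Obj C; D \<in> Obj C;
    uni (tobj C A B) (tobj C A' B') T; uni (tobj C A' B') (tobj C A'' B'') S\<rbrakk> \<Longrightarrow>
    leg12 C A B A'' B'' D (S o\<^sub>L T) = leg12 C A' B' A'' B'' D S o\<^sub>L leg12 C A B A' B' D T"
  unfolding leg12_def by (simp add: tmor_comp)

lemma leg12_adj:
  "\<lbrakk>A \<in> Obj C; B \<in> Obj C; A' \<in> Obj C; B' \<in> Obj C; D \<in> Obj C; uni (tobj C A B) (tobj C A' B') T\<rbrakk> \<Longrightarrow>
    adj (leg12 C A B A' B' D T) = leg12 C A' B' A B D (adj T)"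
  unfolding leg12_def by (simp add: tmor_adj adj_id_op)

text \<open>\<open>leg23\<close> covers endomorphisms only; a braiding or its inverse in legs 2 and
  3 interchanges the two factors.\<close>

definition leg23_gen :: "'o \<Rightarrow> 'o \<Rightarrow> 'o \<Rightarrow> 'o \<Rightarrow> 'o \<Rightarrow> 'v oper \<Rightarrow> 'v oper" where
  "leg23_gen A B D B' D' T =
     assoc_inv C A B' D' o\<^sub>L tmor C A A (tobj C B D) (tobj C B' D') (idm C A) T o\<^sub>L assoc C A B D"

lemma leg23_eq: "leg23 C A B D T = leg23_gen A B D B D T"
  by (simp add: leg23_def leg23_gen_def)

lemma leg23_gen_unitary [simp]:
  "\<lbrakk>A \<in> Obj C; B \<in> Obj C; D \<in> Obj C; B' \<in> Obj C; D' \<in> Obj C; uni (tobj C B D) (tobj C B' D') T\<rbrakk> \<Longrightarrow>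
    uni (tobj C (tobj C A B) D) (tobj C (tobj C A B') D') (leg23_gen A B D B' D' T)"
  unfolding leg23_gen_def
  by (rule uni_comp[OF _ _ _ assoc_unitary(1) uni_comp[OF _ _ _ tmor_unitary(1) assoc_inv_unitary]]) simp_all

lemma assoc_inv_assoc:
  "\<lbrakk>X \<in> Obj C; Y \<in> Obj C; Z \<in> Obj C\<rbrakk> \<Longrightarrow> assoc_inv C X Y Z o\<^sub>L assoc C X Y Z = idm C (tobj C (tobj C X Y) Z)"
  by (rule unitary_opD(2)[OF assoc_unitary(1)])

lemma assoc_assoc_inv:
  "\<lbrakk>X \<in> Obj C; Y \<in> Obj C; Z \<in> Obj C\<rbrakk> \<Longrightarrow> assoc C X Y Z o\<^sub>L assoc_inv C X Y Z = idm C (tobj C X (tobj C Y Z))"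
  by (rule unitary_opD(3)[OF assoc_unitary(1)])

lemma assoc_leg23_gen:
  assumes "A \<in> Obj C" "B \<in> Obj C" "D \<in> Obj C" "B' \<in> Obj C" "D' \<in> Obj C" "uni (tobj C B D) (tobj C B' D') T"
  shows "assoc C A B' D' o\<^sub>L leg23_gen A B D B' D' T
    = tmor C A A (tobj C B D) (tobj C B' D') (idm C A) T o\<^sub>L assoc C A B D"
proof -
  have u: "uni (tobj C A (tobj C B D)) (tobj C A (tobj C B' D')) (tmor C A A (tobj C B D) (tobj C B' D') (idm C A) T)"
    using assms by (intro tmor_unitary(1)) simp_all
  then show ?thesis
    unfolding leg23_gen_def using assms
    by (simp add: oper_comp_assoc[symmetric] assoc_assoc_inv uni_id_left[OF _ _ u])
qed

lemma leg23_gen_assoc_inv: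
  assumes "A \<in> Obj C" "B \<in> Obj C" "D \<in> Obj C" "B' \<in> Obj C" "D' \<in> Obj C" "uni (tobj C B D) (tobj C B' D') T"
  shows "leg23_gen A B D B' D' T o\<^sub>L assoc_inv C A B D
    = assoc_inv C A B' D' o\<^sub>L tmor C A A (tobj C B D) (tobj C B' D') (idm C A) T"
proof -
  have u: "uni (tobj C A (tobj C B D)) (tobj C A (tobj C B' D')) (tmor C A A (tobj C B D) (tobj C B' D') (idm C A) T)"
    using assms by (intro tmor_unitary(1)) simp_all
  then show ?thesis
    unfolding leg23_gen_def using assms
    by (simp add: oper_comp_assoc assoc_assoc_inv uni_id_right[OF _ u])
qed

lemma leg23_gen_comp:
  assumes "A \<in> Obj C" "B \<in> Obj C" "D \<in> Obj C" "B' \<in> Obj C" "D' \<in> Obj C" "B'' \<in> Obj C" "D'' \<in> Obj C"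
    "uni (tobj C B D) (tobj C B' D') T" "uni (tobj C B' D') (tobj C B'' D'') S"
  shows "leg23_gen A B D B'' D'' (S o\<^sub>L T) = leg23_gen A B' D' B'' D'' S o\<^sub>L leg23_gen A B D B' D' T"
proof -
  have "leg23_gen A B' D' B'' D'' S o\<^sub>L leg23_gen A B D B' D' T
    = assoc_inv C A B'' D'' o\<^sub>L tmor C A A (tobj C B' D') (tobj C B'' D'') (idm C A) S o\<^sub>L (assoc C A B' D' o\<^sub>L leg23_gen A B D B' D' T)"
    unfolding leg23_gen_def[of A B' D' B'' D'' S] by (simp add: oper_comp_assoc)
  also have "\<dots> = assoc_inv C A B'' D'' o\<^sub>L (tmor C A A (tobj C B' D') (tobj C B'' D'') (idm C A) S
      o\<^sub>L tmor C A A (tobj C B D) (tobj C B' D') (idm C A) T) o\<^sub>L assoc C A B D"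
    using assms by (simp add: assoc_leg23_gen oper_comp_assoc)
  also have "tmor C A A (tobj C B' D') (tobj C B'' D'') (idm C A) S o\<^sub>L tmor C A A (tobj C B D) (tobj C B' D') (idm C A) T
    = tmor C A A (tobj C B D) (tobj C B'' D'') (idm C A) (S o\<^sub>L T)"
    using assms by (simp add: tmor_comp)
  finally show ?thesis by (simp add: leg23_gen_def)
qed

lemma leg23_gen_adj:
  assumes "A \<in> Obj C" "B \<in> Obj C" "D \<in> Obj C" "B' \<in> Obj C" "D' \<in> Obj C" and T: "uni (tobj C B D) (tobj C B' D') T"
  shows "adj (leg23_gen A B D B' D' T) = leg23_gen A B' D' B D (adj T)"
proof (rule adj_eq_of_left_inverse[of "tobj C (tobj C A B) D" "tobj C (tobj C A B') D'"])
  have "leg23_gen A B' D' B D (adj T) o\<^sub>L leg23_gen A B D B' D' T = leg23_gen A B D B D (idm C (tobj C B D))"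
    using assms uni_adj[OF _ _ T] by (simp add: leg23_gen_comp[symmetric] unitary_opD(2)[OF T])
  also have "\<dots> = idm C (tobj C (tobj C A B) D)"
    using assms by (simp add: leg23_gen_def tmor_id uni_id_right[OF _ assoc_inv_unitary] assoc_inv_assoc)
  finally show "leg23_gen A B' D' B D (adj T) o\<^sub>L leg23_gen A B D B' D' T = idm C (tobj C (tobj C A B) D)" .
qed (use assms uni_adj in simp_all)

end

section \<open>The braid form of the pentagon equation\<close>

lemma oper_eq_apply: "S o\<^sub>L T = S' o\<^sub>L T' \<Longrightarrow> S (T x) = S' (T' x)"
  by (metis blinfun_apply_blinfun_compose)

text \<open>Both kinds of regularity include unitarity of c. It is isolated here so that one
  interpretation serves both, and inverses become the adjoints \<open>w\<close>.\<close>

locale unitarily_braided_category = concrete_monoidal_wstar_category C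
  for C :: "('o, 'v :: complex_hilbert_space) cmcat" +
  fixes c :: "('o, 'v) braid"
  assumes br: "braiding C c"
    and c_unitary: "\<lbrakk>X \<in> Obj C; Y \<in> Obj C\<rbrakk> \<Longrightarrow> unitary_op (Hilb2 C X Y) (Hilb2 C Y X) (c X Y)"
begin

abbreviation w :: "'o \<Rightarrow> 'o \<Rightarrow> 'v oper" where
  "w X Y \<equiv> adj (c X Y)"

lemma c_uni [simp]: "X \<in> Obj C \<Longrightarrow> Y \<in> Obj C \<Longrightarrow> uni (tobj C X Y) (tobj C Y X) (c X Y)"
  by (rule c_unitary)

lemma w_uni [simp]: "X \<in> Obj C \<Longrightarrow> Y \<in> Obj C \<Longrightarrow> uni (tobj C Y X) (tobj C X Y) (w X Y)"
  by (rule uni_adj) simp_all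

lemma binv_eq: "X \<in> Obj C \<Longrightarrow> Y \<in> Obj C \<Longrightarrow> binv C c X Y = w X Y"
  by (rule inv_op_unitary) (simp_all add: c_unitary)

lemma c_Hom: "X \<in> Obj C \<Longrightarrow> Y \<in> Obj C \<Longrightarrow> c X Y \<in> Hom C (tobj C X Y) (tobj C Y X)"
  using br unfolding braiding_def by blast

lemma w_Hom: "X \<in> Obj C \<Longrightarrow> Y \<in> Obj C \<Longrightarrow> w X Y \<in> Hom C (tobj C Y X) (tobj C X Y)"
  by (rule Hom_adj) (simp_all add: c_Hom)

lemma c_natural:
  "\<lbrakk>X \<in> Obj C; X' \<in> Obj C; Y \<in> Obj C; Y' \<in> Obj C; f \<in> Hom C X X'; g \<in> Hom C Y Y'\<rbrakk> \<Longrightarrow>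
    c X' Y' o\<^sub>L tmor C X X' Y Y' f g = tmor C Y Y' X X' g f o\<^sub>L c X Y"
  using br unfolding braiding_def by blast

lemma hexagon1:
  "\<lbrakk>U \<in> Obj C; V \<in> Obj C; W \<in> Obj C\<rbrakk> \<Longrightarrow>
    assoc C V W U o\<^sub>L c U (tobj C V W) o\<^sub>L assoc C U V W =
        tmor C V V (tobj C U W) (tobj C W U) (idm C V) (c U W) o\<^sub>L assoc C V U W o\<^sub>L
        tmor C (tobj C U V) (tobj C V U) W W (c U V) (idm C W)"
  using br unfolding braiding_def by blast

lemma hexagon2:
  "\<lbrakk>U \<in> Obj C; V \<in> Obj C; W \<in> Obj C\<rbrakk> \<Longrightarrow>
    assoc_inv C W U V o\<^sub>L c (tobj C U V) W o\<^sub>L assoc_inv C U V W =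
        tmor C (tobj C U W) (tobj C W U) V V (c U W) (idm C V) o\<^sub>L assoc_inv C U W V o\<^sub>L
        tmor C U U (tobj C V W) (tobj C W V) (idm C U) (c V W)"
  using br unfolding braiding_def by blast

text \<open>\<open>move_right D A B\<close> moves \<open>D\<close> to the right across \<open>A \<otimes> B\<close>; \<open>move_left A B D\<close> moves it to the left.\<close>

definition move_right :: "'o \<Rightarrow> 'o \<Rightarrow> 'o \<Rightarrow> 'v oper" where
  "move_right D A B = leg23_gen A D B B D (c D B) o\<^sub>L leg12 C D A A D B (c D A)"

definition move_left :: "'o \<Rightarrow> 'o \<Rightarrow> 'o \<Rightarrow> 'v oper" where
  "move_left A B D = leg12 C A D D A B (c A D) o\<^sub>L leg23_gen A B D D B (c B D)"

lemma move_right_uni: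
  assumes [simp]: "D \<in> Obj C" "A \<in> Obj C" "B \<in> Obj C"
  shows "uni (tobj C (tobj C D A) B) (tobj C (tobj C A B) D) (move_right D A B)"
  unfolding move_right_def by (rule uni_comp[of _ "tobj C (tobj C A D) B"]) simp_all

lemma move_left_uni:
  assumes [simp]: "D \<in> Obj C" "A \<in> Obj C" "B \<in> Obj C"
  shows "uni (tobj C (tobj C A B) D) (tobj C (tobj C D A) B) (move_left A B D)"
  unfolding move_left_def by (rule uni_comp[of _ "tobj C (tobj C A D) B"]) simp_all

text \<open>The first hexagon identity with one associator cancelled. A crossing with A followed by
  one with B is a single crossing with A \<otimes> B, the form to which naturality applies.\<close>

lemma move_right_eq:
  assumes [simp]: "D \<in> Obj C" "A \<in> Obj C" "B \<in> Obj C"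
  shows "move_right D A B = c D (tobj C A B) o\<^sub>L assoc C D A B"
proof -
  have u: "uni (tobj C D (tobj C A B)) (tobj C (tobj C A B) D) (c D (tobj C A B))" by simp
  have "move_right D A B = assoc_inv C A B D o\<^sub>L (assoc C A B D o\<^sub>L c D (tobj C A B) o\<^sub>L assoc C D A B)"
    unfolding hexagon1[OF assms] by (simp add: move_right_def leg23_gen_def leg12_def oper_comp_assoc)
  also have "\<dots> = c D (tobj C A B) o\<^sub>L assoc C D A B"
    by (simp add: oper_comp_assoc[symmetric] assoc_inv_assoc uni_id_left[OF _ _ u])
  finally show ?thesis .
qed

lemma move_left_eq:
  assumes [simp]: "D \<in> Obj C" "A \<in> Obj C" "B \<in> Obj C"
  shows "move_left A B D = assoc_inv C D A B o\<^sub>L c (tobj C A B) D"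
proof -
  have u: "uni (tobj C (tobj C A B) D) (tobj C D (tobj C A B)) (c (tobj C A B) D)" by simp
  have "move_left A B D = (assoc_inv C D A B o\<^sub>L c (tobj C A B) D o\<^sub>L assoc_inv C A B D) o\<^sub>L assoc C A B D"
    unfolding hexagon2[OF assms(2,3,1)] by (simp add: move_left_def leg23_gen_def leg12_def oper_comp_assoc)
  also have "\<dots> = assoc_inv C D A B o\<^sub>L c (tobj C A B) D"
    by (simp add: oper_comp_assoc assoc_inv_assoc uni_id_right[OF _ u])
  finally show ?thesis .
qed

text \<open>T slides past the strand D by naturality in the factor A \<otimes> B. Naturality is
  available for morphisms of the category, hence the \<open>Hom\<close> assumption beside
  unitarity.\<close>

lemma move_right_natural:
  assumes [simp]: "D \<in> Obj C" "A \<in> Obj C" "B \<in> Obj C" "A' \<in> Obj C" "B' \<in> Obj C"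
    and T: "T \<in> Hom C (tobj C A B) (tobj C A' B')" "uni (tobj C A B) (tobj C A' B') T"
  shows "move_right D A' B' o\<^sub>L leg23_gen D A B A' B' T = leg12 C A B A' B' D T o\<^sub>L move_right D A B"
proof -
  have "move_right D A' B' o\<^sub>L leg23_gen D A B A' B' T
      = c D (tobj C A' B') o\<^sub>L tmor C D D (tobj C A B) (tobj C A' B') (idm C D) T o\<^sub>L assoc C D A B"
    by (simp add: move_right_eq oper_comp_assoc assoc_leg23_gen T(2))
  also have "\<dots> = leg12 C A B A' B' D T o\<^sub>L move_right D A B"
    using c_natural[of D D "tobj C A B" "tobj C A' B'" "idm C D" T] T(1)
    by (simp add: Hom_id leg12_def move_right_eq oper_comp_assoc)
  finally show ?thesis .
qed

lemma move_left_natural: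
  assumes [simp]: "D \<in> Obj C" "A \<in> Obj C" "B \<in> Obj C" "A' \<in> Obj C" "B' \<in> Obj C"
    and T: "T \<in> Hom C (tobj C A B) (tobj C A' B')" "uni (tobj C A B) (tobj C A' B') T"
  shows "leg23_gen D A B A' B' T o\<^sub>L move_left A B D = move_left A' B' D o\<^sub>L leg12 C A B A' B' D T"
proof -
  have "leg23_gen D A B A' B' T o\<^sub>L move_left A B D = (leg23_gen D A B A' B' T o\<^sub>L assoc_inv C D A B) o\<^sub>L c (tobj C A B) D"
    by (simp add: move_left_eq oper_comp_assoc)
  also have "\<dots> = assoc_inv C D A' B' o\<^sub>L (tmor C D D (tobj C A B) (tobj C A' B') (idm C D) T o\<^sub>L c (tobj C A B) D)"
    by (simp add: leg23_gen_assoc_inv T(2) oper_comp_assoc)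
  also have "\<dots> = move_left A' B' D o\<^sub>L leg12 C A B A' B' D T"
    using c_natural[of "tobj C A B" "tobj C A' B'" D D T "idm C D"] T(1)
    by (simp add: Hom_id leg12_def move_left_eq oper_comp_assoc)
  finally show ?thesis .
qed

text \<open>The equation is multiplied by adjoints on both sides. This converts naturality of the
  crossings into naturality of their inverses.\<close>

lemma intertwine_adj:
  assumes obj: "A \<in> Obj C" "B \<in> Obj C" "A' \<in> Obj C" "B' \<in> Obj C"
    and u: "uni A B S" "uni A' B' S'" "uni A A' T" "uni B B' T'"
    and eq: "S' o\<^sub>L T = T' o\<^sub>L S"
  shows "T o\<^sub>L adj S = adj S' o\<^sub>L T'"
proof -
  have "T o\<^sub>L adj S = adj S' o\<^sub>L (S' o\<^sub>L T) o\<^sub>L adj S"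
    using uni_id_left[OF obj(1,3) u(3)] by (simp add: oper_comp_assoc[symmetric] unitary_opD(2)[OF u(2)])
  also have "\<dots> = adj S' o\<^sub>L T'"
    unfolding eq using uni_id_right[OF obj(2) u(4)] by (simp add: oper_comp_assoc unitary_opD(3)[OF u(1)])
  finally show ?thesis .
qed

lemma adj_move_right:
  assumes [simp]: "D \<in> Obj C" "A \<in> Obj C" "B \<in> Obj C"
  shows "adj (move_right D A B) = leg12 C A D D A B (w D A) o\<^sub>L leg23_gen A B D D B (w D B)"
proof -
  have u: "uni (tobj C (tobj C A D) B) (tobj C (tobj C A B) D) (leg23_gen A D B B D (c D B))"
    "uni (tobj C (tobj C D A) B) (tobj C (tobj C A D) B) (leg12 C D A A D B (c D A))" by simp_all
  then show ?thesis
    unfolding move_right_def adj_comp[OF unitary_opD(4)[OF u(1)] unitary_opD(4)[OF u(2)]]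
    by (simp add: leg23_gen_adj leg12_adj)
qed

lemma adj_move_left:
  assumes [simp]: "D \<in> Obj C" "A \<in> Obj C" "B \<in> Obj C"
  shows "adj (move_left A B D) = leg23_gen A D B B D (w B D) o\<^sub>L leg12 C D A A D B (w A D)"
proof -
  have u: "uni (tobj C (tobj C A B) D) (tobj C (tobj C A D) B) (leg23_gen A B D D B (c B D))"
    "uni (tobj C (tobj C A D) B) (tobj C (tobj C D A) B) (leg12 C A D D A B (c A D))" by simp_all
  then show ?thesis
    unfolding move_left_def adj_comp[OF unitary_opD(4)[OF u(2)] unitary_opD(4)[OF u(1)]]
    by (simp add: leg23_gen_adj leg12_adj)
qed

lemma adj_move_right_natural:
  assumes [simp]: "D \<in> Obj C" "A \<in> Obj C" "B \<in> Obj C" "A' \<in> Obj C" "B' \<in> Obj C"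
    and T: "T \<in> Hom C (tobj C A B) (tobj C A' B')" "uni (tobj C A B) (tobj C A' B') T"
  shows "leg23_gen D A B A' B' T o\<^sub>L adj (move_right D A B) = adj (move_right D A' B') o\<^sub>L leg12 C A B A' B' D T"
  by (rule intertwine_adj[OF _ _ _ _ move_right_uni move_right_uni leg23_gen_unitary leg12_unitary move_right_natural[OF _ _ _ _ _ T]])
    (simp_all add: T)

lemma adj_move_left_natural:
  assumes [simp]: "D \<in> Obj C" "A \<in> Obj C" "B \<in> Obj C" "A' \<in> Obj C" "B' \<in> Obj C"
    and T: "T \<in> Hom C (tobj C A B) (tobj C A' B')" "uni (tobj C A B) (tobj C A' B') T"
  shows "leg12 C A B A' B' D T o\<^sub>L adj (move_left A B D) = adj (move_left A' B' D) o\<^sub>L leg23_gen D A B A' B' T"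
  by (rule intertwine_adj[OF _ _ _ _ move_left_uni move_left_uni leg12_unitary leg23_gen_unitary move_left_natural[OF _ _ _ _ _ T, symmetric]])
    (simp_all add: T)

lemma unitaries_iff: "T \<in> unitaries C X \<longleftrightarrow> T \<in> Hom C X X \<and> uni X X T"
  by (simp add: unitaries_def)

text \<open>V is pushed through the inverse crossings towards the argument, where it meets U in the
  form V_23 U_12 of the pentagon equation. After that equation is used, U' and X are pushed through
  towards the output, and the two mutually inverse crossings of H and L from the definition of X_13
  cancel.\<close>

lemma braid_pentagon:
  assumes obj [simp]: "H \<in> Obj C" "L \<in> Obj C" "K \<in> Obj C"
    and U: "U \<in> unitaries C (tobj C H L)" and V: "V \<in> unitaries C (tobj C L K)"
    and X: "X \<in> unitaries C (tobj C H K)"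
    and pent: "leg23 C H L K V o\<^sub>L leg12 C H L H L K U =
      leg12 C H L H L K U o\<^sub>L leg13 C c H L K X o\<^sub>L leg23 C H L K V"
  shows "leg12 C L K K L H (w K L o\<^sub>L V) o\<^sub>L leg23_gen L H K K H (w K H) o\<^sub>L leg12 C H L L H K (w L H o\<^sub>L U)
    = leg23_gen K H L L H (w L H o\<^sub>L U) o\<^sub>L leg12 C H K K H L (w K H o\<^sub>L X) o\<^sub>L leg23_gen H L K K L (w K L o\<^sub>L V)"
proof (rule blinfun_eqI)
  fix x
  have [simp]: "uni (tobj C H L) (tobj C H L) U" "uni (tobj C L K) (tobj C L K) V" "uni (tobj C H K) (tobj C H K) X"
    and Hom: "U \<in> Hom C (tobj C H L) (tobj C H L)" "V \<in> Hom C (tobj C L K) (tobj C L K)" "X \<in> Hom C (tobj C H K) (tobj C H K)"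
    using U V X by (simp_all add: unitaries_iff)
  have U': "w L H o\<^sub>L U \<in> Hom C (tobj C H L) (tobj C L H)"
    by (rule Hom_comp[OF _ _ _ Hom(1) w_Hom]) simp_all
  have uU' [simp]: "uni (tobj C H L) (tobj C L H) (w L H o\<^sub>L U)" by (rule uni_comp[of _ "tobj C H L"]) simp_all
  \<comment> \<open>\<open>f1\<close>, \<open>f3\<close> and \<open>f4\<close> move V past the
    strand H, U' past K and X past L; \<open>f2\<close> is the pentagon equation.\<close>
  have f1: "leg12 C L K L K H V (leg23_gen L H K K H (w K H) (leg12 C H L L H K (w L H) y))
      = leg23_gen L H K K H (w K H) (leg12 C H L L H K (w L H) (leg23 C H L K V y))" for y
    using oper_eq_apply[OF adj_move_left_natural[of H L K L K V]] Hom(2) by (simp add: adj_move_left leg23_eq)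
  have f2: "leg23 C H L K V (leg12 C H L H L K U y) = leg12 C H L H L K U (leg12 C L H H L K (w H L)
      (leg23 C L H K X (leg12 C H L L H K (c H L) (leg23 C H L K V y))))" for y
    using oper_eq_apply[OF pent] by (simp add: leg13_def binv_eq)
  have f3: "leg12 C L K K L H (w K L) (leg23_gen L H K K H (w K H) (leg12 C H L L H K (w L H o\<^sub>L U) y))
      = leg23_gen K H L L H (w L H o\<^sub>L U) (leg12 C H K K H L (w K H) (leg23_gen H L K K L (w K L) y))" for y
    using oper_eq_apply[OF adj_move_right_natural[of K H L L H "w L H o\<^sub>L U"]] U' by (simp add: adj_move_right)
  have f4: "leg23_gen H L K K L (w K L) (leg12 C L H H L K (w H L) (leg23 C L H K X y))
      = leg12 C H K H K L X (leg23_gen H L K K L (w K L) (leg12 C L H H L K (w H L) y))" for y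
    using oper_eq_apply[OF adj_move_left_natural[of L H K H K X]] Hom(3) by (simp add: adj_move_left leg23_eq)
  have V23: "uni (tobj C (tobj C H L) K) (tobj C (tobj C H L) K) (leg23 C H L K V)"
    by (simp add: leg23_eq)
  have "leg12 C L H H L K (w H L) o\<^sub>L leg12 C H L L H K (c H L) = idm C (tobj C (tobj C H L) K)"
    by (simp add: leg12_comp[symmetric] unitary_opD(2)[OF c_uni]) (simp add: leg12_def tmor_id)
  then have f5: "leg12 C L H H L K (w H L) (leg12 C H L L H K (c H L) (leg23 C H L K V y)) = leg23 C H L K V y" for y
    using uni_id_left[OF _ _ V23] by (simp add: oper_comp_assoc[symmetric] flip: blinfun_apply_blinfun_compose)
  have s1: "leg12 C L K K L H (w K L o\<^sub>L V) y = leg12 C L K K L H (w K L) (leg12 C L K L K H V y)" for y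
    by (subst leg12_comp) simp_all
  have s2: "leg12 C H L L H K (w L H o\<^sub>L U) y = leg12 C H L L H K (w L H) (leg12 C H L H L K U y)" for y
    by (subst leg12_comp) simp_all
  have s3: "leg12 C H K K H L (w K H o\<^sub>L X) y = leg12 C H K K H L (w K H) (leg12 C H K H K L X y)" for y
    by (subst leg12_comp) simp_all
  have s4: "leg23_gen H L K K L (w K L o\<^sub>L V) y = leg23_gen H L K K L (w K L) (leg23 C H L K V y)" for y
    unfolding leg23_eq by (subst leg23_gen_comp[of _ _ _ L K]) simp_all
  \<comment> \<open>\<open>?y\<close> is X_13 V_23 x, the part of the right side of the pentagon
    equation on which U_12 acts.\<close>
  let ?y = "leg12 C L H H L K (w H L) (leg23 C L H K X (leg12 C H L L H K (c H L) (leg23 C H L K V x)))"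
  have "(leg12 C L K K L H (w K L o\<^sub>L V) o\<^sub>L leg23_gen L H K K H (w K H) o\<^sub>L leg12 C H L L H K (w L H o\<^sub>L U)) x
    = leg12 C L K K L H (w K L) (leg23_gen L H K K H (w K H) (leg12 C H L L H K (w L H o\<^sub>L U) ?y))"
    by (simp add: s1) (simp add: s2 f1 f2)
  also have "\<dots> = leg23_gen K H L L H (w L H o\<^sub>L U) (leg12 C H K K H L (w K H) (leg23_gen H L K K L (w K L) ?y))"
    by (rule f3)
  also have "\<dots> = (leg23_gen K H L L H (w L H o\<^sub>L U) o\<^sub>L leg12 C H K K H L (w K H o\<^sub>L X) o\<^sub>L leg23_gen H L K K L (w K L o\<^sub>L V)) x"
    by (simp add: s3 s4 f4 f5)
  finally show "(leg12 C L K K L H (w K L o\<^sub>L V) o\<^sub>L leg23_gen L H K K H (w K H) o\<^sub>L leg12 C H L L H K (w L H o\<^sub>L U)) x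
    = (leg23_gen K H L L H (w L H o\<^sub>L U) o\<^sub>L leg12 C H K K H L (w K H o\<^sub>L X) o\<^sub>L leg23_gen H L K K L (w K L o\<^sub>L V)) x" .
qed

end

section \<open>Slicing the braid relation\<close>

context concrete_monoidal_wstar_category
begin

section \<open>Amplified operators id \<otimes> s\<close>

abbreviation amp :: "'o \<Rightarrow> 'o \<Rightarrow> 'o \<Rightarrow> 'v oper \<Rightarrow> 'v oper" where
  "amp X Y Y' s \<equiv> tmor C X X Y Y' (idm C X) s"

text \<open>Slices and rank-one operators are in general neither unitary nor morphisms, so id
  \<otimes> s is obtained from the boundedness of s alone. The norm bound makes it continuous in
  s.\<close>

lemma amp:
  assumes obj [simp]: "X \<in> Obj C" "Y \<in> Obj C" "Y' \<in> Obj C" and s: "s \<in> bounded_ops (Hilb C Y) (Hilb C Y')"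
  shows "amp X Y Y' s \<in> bounded_ops (Hilb2 C X Y) (Hilb2 C X Y')"
    and "x \<in> Hilb C X \<Longrightarrow> y \<in> Hilb C Y \<Longrightarrow> amp X Y Y' s (tvec C X Y x y) = tvec C X Y' x (s y)"
    and "norm (amp X Y Y' s) \<le> norm s"
proof -
  obtain T where T: "T \<in> bounded_ops (Hilb2 C X Y) (Hilb2 C X Y')" "norm T \<le> norm s"
    "\<And>x y. x \<in> Hilb C X \<Longrightarrow> y \<in> Hilb C Y \<Longrightarrow> T (tvec C X Y x y) = tvec C X Y' x (s y)"
    using tensor_amplification[OF tensor_obj[OF obj(1,2)] tensor_obj[OF obj(1,3)] s] by blast
  have "amp X Y Y' s = T"
    by (rule tmor_eqI[OF obj(1,2) T(1)]) (simp add: T(3))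
  then show "amp X Y Y' s \<in> bounded_ops (Hilb2 C X Y) (Hilb2 C X Y')"
    "x \<in> Hilb C X \<Longrightarrow> y \<in> Hilb C Y \<Longrightarrow> amp X Y Y' s (tvec C X Y x y) = tvec C X Y' x (s y)"
    "norm (amp X Y Y' s) \<le> norm s"
    using T by auto
qed

lemma amp_comp:
  assumes obj [simp]: "X \<in> Obj C" "Y \<in> Obj C" "Y' \<in> Obj C" "Y'' \<in> Obj C"
    and s: "s \<in> bounded_ops (Hilb C Y) (Hilb C Y')" and s': "s' \<in> bounded_ops (Hilb C Y') (Hilb C Y'')"
  shows "amp X Y' Y'' s' o\<^sub>L amp X Y Y' s = amp X Y Y'' (s' o\<^sub>L s)"
  by (rule tmor_eqI[symmetric])
    (simp_all add: bounded_ops_comp[OF amp(1)[OF obj(1-3) s] amp(1)[OF obj(1,3,4) s']]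
      amp(2)[OF obj(1-3) s] amp(2)[OF obj(1,3,4) s'] bounded_opsD(2)[OF s])

lemma amp_adj:
  assumes obj [simp]: "X \<in> Obj C" "Y \<in> Obj C" "Y' \<in> Obj C" and s: "s \<in> bounded_ops (Hilb C Y) (Hilb C Y')"
  shows "adj (amp X Y Y' s) = amp X Y' Y (adj s)"
proof (rule tmor_eqI[symmetric])
  note s' = bounded_ops_adj[OF Hilb_closed[OF obj(2)] Hilb_closed[OF obj(3)] s]
  show adj: "adj (amp X Y Y' s) \<in> bounded_ops (Hilb2 C X Y') (Hilb2 C X Y)"
    by (rule bounded_ops_adj[OF _ _ amp(1)[OF obj s]]) simp_all
  fix x y assume xy: "x \<in> Hilb C X" "y \<in> Hilb C Y'"
  note ci = hilbert_tensor.cinner_t[OF tensor_obj]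
  have "adj (amp X Y Y' s) (tvec C X Y' x y) = tvec C X Y x (adj s y)"
  proof (rule hilbert_tensor.vec_eqI[OF tensor_obj[OF obj(1,2)]])
    show "adj (amp X Y Y' s) (tvec C X Y' x y) \<in> Hilb2 C X Y"
      by (rule bounded_opsD(2)[OF adj]) (simp add: xy)
    show "tvec C X Y x (adj s y) \<in> Hilb2 C X Y"
      using xy bounded_opsD(2)[OF s'] by simp
    fix a b assume ab: "a \<in> Hilb C X" "b \<in> Hilb C Y"
    show "cinner (tvec C X Y a b) (adj (amp X Y Y' s) (tvec C X Y' x y)) = cinner (tvec C X Y a b) (tvec C X Y x (adj s y))"
      using xy ab bounded_opsD(2)[OF s'] bounded_opsD(2)[OF s]
      by (simp add: cinner_adj'[OF bounded_opsD(1)[OF amp(1)[OF obj s]], symmetric] amp(2)[OF obj s] ci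
          cinner_adj'[OF bounded_opsD(1)[OF s]])
  qed
  then show "adj (amp X Y Y' s) (tvec C X Y' x y) = tvec C X Y (idm C X x) (adj s y)"
    using xy by simp
qed (use obj in simp_all)

text \<open>Factoring id \<otimes> |y'><y| through X is what cuts the sliced braid relation into a
  product of two slices.\<close>

lemma amp_rank1:
  assumes obj [simp]: "X \<in> Obj C" "Y \<in> Obj C" "Y' \<in> Obj C" and yy: "y \<in> Hilb C Y" "y' \<in> Hilb C Y'"
  shows "amp X Y Y' (rank1 y' y) = R X Y' y' o\<^sub>L adj (R X Y y)"
proof (rule tmor_eqI)
  show "R X Y' y' o\<^sub>L adj (R X Y y) \<in> bounded_ops (Hilb2 C X Y) (Hilb2 C X Y')"
    by (rule bounded_ops_comp[OF adj_R_bounded_ops R_bounded_ops]) simp_all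
qed (use yy in \<open>simp_all add: clinD hilbert_tensor.scale_right[OF tensor_obj]\<close>)

text \<open>The map s \<mapsto> S (id \<otimes> s) T is linear and continuous on the corner, where
  \<open>amp\<close> gives the properties of id \<otimes> s. Membership of its values in W thus
  passes from a set of operators s to the closed span of that set.\<close>

lemma closed_osubspace_amp:
  assumes obj [simp]: "X \<in> Obj C" "Y \<in> Obj C" "Y' \<in> Obj C" and W: "closed_osubspace W" and S: "clin S"
  shows "closed_osubspace {s \<in> bounded_ops (Hilb C Y) (Hilb C Y'). S o\<^sub>L amp X Y Y' s o\<^sub>L T \<in> W}"
    (is "closed_osubspace ?N")
proof -
  let ?B = "bounded_ops (Hilb C Y) (Hilb C Y')" and ?f = "\<lambda>s. S o\<^sub>L amp X Y Y' s o\<^sub>L T"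
  have B: "closed_osubspace ?B" "closed_osubspace (bounded_ops (Hilb2 C X Y) (Hilb2 C X Y'))"
    by (auto intro: closed_osubspace_bounded_ops)
  note sB = B[unfolded closed_osubspace_def coper.subspace_def]
  have add: "amp X Y Y' (s + s') = amp X Y Y' s + amp X Y Y' s'" if "s \<in> ?B" "s' \<in> ?B" for s s'
  proof (rule tmor_eqI)
    show "amp X Y Y' s + amp X Y Y' s' \<in> bounded_ops (Hilb2 C X Y) (Hilb2 C X Y')"
      using sB(2) amp(1)[OF obj] that by blast
  qed (use that in \<open>simp_all add: blinfun.add_left amp(2) hilbert_tensor.add_right[OF tensor_obj] bounded_opsD(2)\<close>)
  have scale: "amp X Y Y' (scaleC_oper a s) = scaleC_oper a (amp X Y Y' s)" if "s \<in> ?B" for s a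
  proof (rule tmor_eqI)
    show "scaleC_oper a (amp X Y Y' s) \<in> bounded_ops (Hilb2 C X Y) (Hilb2 C X Y')"
      using sB(2) amp(1)[OF obj] that by blast
  qed (use that in \<open>simp_all add: amp(2) hilbert_tensor.scale_right[OF tensor_obj] bounded_opsD(2)\<close>)
  have zero: "amp X Y Y' 0 = 0"
    using scale[of 0 0] sB(1) by simp
  have fadd: "?f (s + s') = ?f s + ?f s'" if "s \<in> ?B" "s' \<in> ?B" for s s'
    by (rule blinfun_eqI) (simp add: add[OF that] blinfun.add_left blinfun.add_right)
  have fscale: "?f (scaleC_oper a s) = scaleC_oper a (?f s)" if "s \<in> ?B" for a s
    by (rule blinfun_eqI) (simp add: scale[OF that] clinD[OF S])
  have fzero: "?f 0 = 0" by (rule blinfun_eqI) (simp add: zero blinfun.zero_right)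
  have "closed ?N"
    unfolding closed_sequential_limits
  proof (intro allI impI, elim conjE)
    fix f l assume f: "\<forall>n. f n \<in> ?N" "f \<longlonglongrightarrow> l"
    then have l: "l \<in> ?B"
      using sB(1) closed_sequentially[of ?B f l] by auto
    have "(\<lambda>n. amp X Y Y' (f n)) \<longlonglongrightarrow> amp X Y Y' l"
    proof (rule LIM_zero_cancel, rule Lim_null_comparison)
      have "f n - l \<in> ?B" for n
        using f(1) l coper.subspace_diff sB(1) B(1) unfolding closed_osubspace_def by blast
      then show "\<forall>\<^sub>F n in sequentially. norm (amp X Y Y' (f n) - amp X Y Y' l) \<le> norm (f n - l)"
        using add[of "f _ - l" l] l amp(3)[OF obj, of "f _ - l"] by (auto intro!: always_eventually)
      show "(\<lambda>n. norm (f n - l)) \<longlonglongrightarrow> 0"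
        using f(2) by (simp add: LIM_zero tendsto_norm_zero)
    qed
    then have "(\<lambda>n. ?f (f n)) \<longlonglongrightarrow> ?f l"
      by (intro bounded_bilinear.tendsto[OF bounded_bilinear_blinfun_compose] tendsto_const)
    then have "?f l \<in> W"
      using closed_sequentially[of W "\<lambda>n. ?f (f n)"] W f(1) by (auto simp: closed_osubspace_def)
    then show "l \<in> ?N" using l by blast
  qed
  moreover have "coper.subspace ?N"
    using W sB(1) fadd fscale fzero unfolding coper.subspace_def closed_osubspace_def by auto
  ultimately show ?thesis by (simp add: closed_osubspace_def)
qed

section \<open>Creation operators against legs and associators\<close>

lemma leg12_R:
  assumes obj [simp]: "A \<in> Obj C" "B \<in> Obj C" "A' \<in> Obj C" "B' \<in> Obj C" "D \<in> Obj C"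
    and T: "uni (tobj C A B) (tobj C A' B') T" and d: "d \<in> Hilb C D"
  shows "leg12 C A B A' B' D T o\<^sub>L R (tobj C A B) D d = R (tobj C A' B') D d o\<^sub>L T"
proof (rule bounded_ops_self_eqI[of "tobj C A B"])
  show "leg12 C A B A' B' D T o\<^sub>L R (tobj C A B) D d \<in> bounded_ops (Hilb2 C A B) (Hilb2 C (tobj C A' B') D)"
    by (rule bounded_ops_comp[OF R_bounded_ops unitary_opD(1)]) (use T in simp_all)
  show "R (tobj C A' B') D d o\<^sub>L T \<in> bounded_ops (Hilb2 C A B) (Hilb2 C (tobj C A' B') D)"
    by (rule bounded_ops_comp[OF unitary_opD(1)[OF T] R_bounded_ops]) simp_all
qed (use T d in \<open>simp_all add: leg12_def tmor_unitary(2) uni_mem\<close>)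

lemma adj_R_leg12:
  assumes obj [simp]: "A \<in> Obj C" "B \<in> Obj C" "A' \<in> Obj C" "B' \<in> Obj C" "D \<in> Obj C"
    and T: "uni (tobj C A B) (tobj C A' B') T" and d: "d \<in> Hilb C D"
  shows "adj (R (tobj C A' B') D d) o\<^sub>L leg12 C A B A' B' D T = T o\<^sub>L adj (R (tobj C A B) D d)"
proof (rule tensor_oper_eqI[of "tobj C A B" D])
  show "adj (R (tobj C A' B') D d) o\<^sub>L leg12 C A B A' B' D T \<in> bounded_ops (Hilb2 C (tobj C A B) D) (Hilb2 C A' B')"
    by (rule bounded_ops_comp[OF unitary_opD(1) adj_R_bounded_ops]) (use T in simp_all)
  show "T o\<^sub>L adj (R (tobj C A B) D d) \<in> bounded_ops (Hilb2 C (tobj C A B) D) (Hilb2 C A' B')"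
    by (rule bounded_ops_comp[OF adj_R_bounded_ops unitary_opD(1)[OF T]]) simp_all
qed (use T d in \<open>simp_all add: leg12_def tmor_unitary(2) uni_mem clinD[OF unitary_opD(4)[OF T]]\<close>)

lemma amp_R:
  assumes obj [simp]: "A \<in> Obj C" "B \<in> Obj C" "B' \<in> Obj C" and T: "uni B B' T" and b: "b \<in> Hilb C B"
  shows "amp A B B' T o\<^sub>L R A B b = R A B' (T b)"
  by (rule bounded_ops_self_eqI[OF obj(1) bounded_ops_comp[OF R_bounded_ops amp(1)[OF _ _ _ unitary_opD(1)[OF T]]]
        R_bounded_ops]) (use b in \<open>simp_all add: amp(2)[OF _ _ _ unitary_opD(1)[OF T]] uni_mem[OF T]\<close>)

lemma adj_R_amp:
  assumes obj [simp]: "A \<in> Obj C" "B \<in> Obj C" "B' \<in> Obj C" and T: "uni B B' T" and b: "b \<in> Hilb C B'"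
  shows "adj (R A B' b) o\<^sub>L amp A B B' T = adj (R A B (adj T b))"
  by (rule tensor_oper_eqI[OF obj(1,2) bounded_ops_comp[OF amp(1)[OF _ _ _ unitary_opD(1)[OF T]] adj_R_bounded_ops]
        adj_R_bounded_ops])
    (use b in \<open>simp_all add: amp(2)[OF _ _ _ unitary_opD(1)[OF T]] uni_mem[OF T] uni_mem[OF uni_adj[OF _ _ T]]
      cinner_adj[OF unitary_opD(4)[OF T]]\<close>)

lemma assoc_R:
  assumes obj [simp]: "A \<in> Obj C" "B \<in> Obj C" "D \<in> Obj C" and d: "d \<in> Hilb C D"
  shows "assoc C A B D o\<^sub>L R (tobj C A B) D d = amp A B (tobj C B D) (R B D d)"
  by (rule tensor_oper_eqI[OF obj(1,2) bounded_ops_comp[OF R_bounded_ops unitary_opD(1)[OF assoc_unitary(1)]]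
        amp(1)[OF _ _ _ R_bounded_ops]]) (use d in \<open>simp_all add: amp(2)[OF _ _ _ R_bounded_ops]\<close>)

text \<open>Creating two legs in turn is creating one elementary tensor, up to the associator.
  Functionals on two legs thereby become one functional on their tensor product.\<close>

lemma R_R:
  assumes obj [simp]: "A \<in> Obj C" "B \<in> Obj C" "D \<in> Obj C" and b: "b \<in> Hilb C B" and d: "d \<in> Hilb C D"
  shows "R (tobj C A B) D d o\<^sub>L R A B b = assoc_inv C A B D o\<^sub>L R A (tobj C B D) (tvec C B D b d)"
  by (rule bounded_ops_self_eqI[OF obj(1) bounded_ops_comp[OF R_bounded_ops R_bounded_ops]
        bounded_ops_comp[OF R_bounded_ops unitary_opD(1)[OF assoc_inv_unitary]]]) (use b d in simp_all)

lemma adj_R_adj_R: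
  assumes obj [simp]: "A \<in> Obj C" "B \<in> Obj C" "D \<in> Obj C" and b: "b \<in> Hilb C B" and d: "d \<in> Hilb C D"
  shows "adj (R A B b) o\<^sub>L adj (R (tobj C A B) D d) = adj (R A (tobj C B D) (tvec C B D b d)) o\<^sub>L assoc C A B D"
proof -
  have "adj (R A B b) o\<^sub>L adj (R (tobj C A B) D d) = adj (R (tobj C A B) D d o\<^sub>L R A B b)"
    by (simp add: adj_comp)
  also have "\<dots> = adj (R A (tobj C B D) (tvec C B D b d)) o\<^sub>L adj (assoc_inv C A B D)"
    unfolding R_R[OF assms] by (intro adj_comp unitary_opD(4)[OF assoc_inv_unitary]) simp_all
  also have "adj (assoc_inv C A B D) = assoc C A B D"
    by (intro adj_adj unitary_opD(4)[OF assoc_unitary(1)]) simp_all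
  finally show ?thesis .
qed

text \<open>A slice is antilinear in \<zeta> and linear in \<xi>, so membership extends from total
  sets in one variable after the other. S and T leave room for the outer unitaries of the braid
  relation.\<close>

lemma sliced_closure:
  assumes obj [simp]: "X \<in> Obj C" "Y \<in> Obj C" "X' \<in> Obj C" "Y' \<in> Obj C" and cl: "clin S" "clin T" "clin M"
    and gen: "\<And>\<zeta> \<xi>. \<zeta> \<in> G \<Longrightarrow> \<xi> \<in> G' \<Longrightarrow> adj (R X' Y' (S \<zeta>)) o\<^sub>L M o\<^sub>L R X Y (T \<xi>) \<in> closed_span N"
    and \<zeta>: "\<zeta> \<in> closure (cvec.span G)" and \<xi>: "\<xi> \<in> closure (cvec.span G')"
  shows "adj (R X' Y' (S \<zeta>)) o\<^sub>L M o\<^sub>L R X Y (T \<xi>) \<in> closed_span N"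
proof -
  note blR = hilbert_tensor.bounded_linear_rcreate[OF tensor_obj]
  note R_scale = hilbert_tensor.rcreate_scale[OF tensor_obj]
  have 1: "adj (R X' Y' (S \<zeta>)) o\<^sub>L M o\<^sub>L R X Y (T \<xi>) \<in> closed_span N" if \<zeta>: "\<zeta> \<in> G" for \<zeta>
  proof (rule closed_span_vector_image[where \<phi> = "\<lambda>\<xi>. adj (R X' Y' (S \<zeta>)) o\<^sub>L M o\<^sub>L R X Y (T \<xi>)", OF _ _ gen[OF \<zeta>] \<xi>])
    show "bounded_linear (\<lambda>\<xi>. adj (R X' Y' (S \<zeta>)) o\<^sub>L M o\<^sub>L R X Y (T \<xi>))"
      by (intro bounded_linear_compose[OF bounded_linear_comp_left] bounded_linear_compose[OF blR]
          blinfun.bounded_linear_right) simp_all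
    show "\<exists>b. adj (R X' Y' (S \<zeta>)) o\<^sub>L M o\<^sub>L R X Y (T (a *\<^sub>C x))
        = scaleC_oper b (adj (R X' Y' (S \<zeta>)) o\<^sub>L M o\<^sub>L R X Y (T x))" for a x
      by (intro exI[of _ a]) (simp add: clinD cl R_scale scaleC_oper_comp_right)
  qed
  show ?thesis
  proof (rule closed_span_vector_image[where \<phi> = "\<lambda>\<zeta>. adj (R X' Y' (S \<zeta>)) o\<^sub>L M o\<^sub>L R X Y (T \<xi>)", OF _ _ 1 \<zeta>])
    show "bounded_linear (\<lambda>\<zeta>. adj (R X' Y' (S \<zeta>)) o\<^sub>L M o\<^sub>L R X Y (T \<xi>))"
      unfolding oper_comp_assoc
      by (intro bounded_linear_compose[OF bounded_linear_comp_right] bounded_linear_adj_family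
          bounded_linear_compose[OF blR] blinfun.bounded_linear_right) simp_all
    show "\<exists>b. adj (R X' Y' (S (a *\<^sub>C x))) o\<^sub>L M o\<^sub>L R X Y (T \<xi>)
        = scaleC_oper b (adj (R X' Y' (S x)) o\<^sub>L M o\<^sub>L R X Y (T \<xi>))" for a x
      by (intro exI[of _ "cnj a"]) (simp add: clinD cl R_scale adj_scaleC scaleC_oper_comp_left)
  qed
qed

text \<open>Slices in the last two legs of an operator from (H \<otimes> L) \<otimes> K to (K
  \<otimes> L) \<otimes> H. The creation operators are nested because triple products are bracketed
  to the left.\<close>

definition outer_slices :: "'o \<Rightarrow> 'o \<Rightarrow> 'o \<Rightarrow> 'v oper \<Rightarrow> 'v oper set" where
  "outer_slices H L K M = {adj (R K L l') o\<^sub>L adj (R (tobj C K L) H h') o\<^sub>L M o\<^sub>L R (tobj C H L) K k o\<^sub>L R H L l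
     | l' h' k l. l' \<in> Hilb C L \<and> h' \<in> Hilb C H \<and> k \<in> Hilb C K \<and> l \<in> Hilb C L}"

text \<open>Both outer factors are unitaries of the legs that are sliced off, so they do not change the span.\<close>

lemma closed_span_outer_slices:
  assumes obj [simp]: "H \<in> Obj C" "L \<in> Obj C" "K \<in> Obj C"
    and U [simp]: "uni (tobj C H L) (tobj C L H) U" and V [simp]: "uni (tobj C L K) (tobj C K L) V"
    and X [simp]: "uni (tobj C H K) (tobj C K H) X" and l0: "l0 \<in> Hilb C L" "l0 \<noteq> 0"
  defines "M \<equiv> leg23_gen K H L L H U o\<^sub>L leg12 C H K K H L X o\<^sub>L leg23_gen H L K K L V"
  shows "closed_span (outer_slices H L K M) = closed_span (vslices H K K H X)"
proof -
  \<comment> \<open>X_12 seen in the other bracketing, where the two sliced legs form one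
    factor.\<close>
  define P where "P = assoc C K H L o\<^sub>L leg12 C H K K H L X o\<^sub>L assoc_inv C H K L"
  define \<sigma> where "\<sigma> \<zeta> \<xi> = adj (R K (tobj C H L) \<zeta>) o\<^sub>L P o\<^sub>L R H (tobj C K L) \<xi>" for \<zeta> \<xi>
  have clP: "clin P"
    unfolding P_def by (intro clin_intros unitary_opD(4)[OF assoc_unitary(1)] unitary_opD(4)[OF assoc_inv_unitary]
      unitary_opD(4)[OF leg12_unitary]) simp_all
  \<comment> \<open>The outer unitaries are absorbed by the vectors of the functional.\<close>
  have \<tau>: "adj (R K L l') o\<^sub>L adj (R (tobj C K L) H h') o\<^sub>L M o\<^sub>L R (tobj C H L) K k o\<^sub>L R H L l
      = \<sigma> (adj U (tvec C L H l' h')) (V (tvec C L K l k))"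
    if [simp]: "l' \<in> Hilb C L" "h' \<in> Hilb C H" "k \<in> Hilb C K" "l \<in> Hilb C L" for l' h' k l
  proof -
    have "adj (R K L l') o\<^sub>L adj (R (tobj C K L) H h') o\<^sub>L M o\<^sub>L R (tobj C H L) K k o\<^sub>L R H L l
      = (adj (R K L l') o\<^sub>L adj (R (tobj C K L) H h')) o\<^sub>L M o\<^sub>L (R (tobj C H L) K k o\<^sub>L R H L l)"
      by (simp only: oper_comp_assoc)
    also have "\<dots> = adj (R K (tobj C L H) (tvec C L H l' h')) o\<^sub>L (assoc C K L H o\<^sub>L leg23_gen K H L L H U) o\<^sub>L
        leg12 C H K K H L X o\<^sub>L (leg23_gen H L K K L V o\<^sub>L assoc_inv C H L K) o\<^sub>L R H (tobj C L K) (tvec C L K l k)"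
      by (simp add: R_R adj_R_adj_R M_def oper_comp_assoc)
    also have "\<dots> = (adj (R K (tobj C L H) (tvec C L H l' h')) o\<^sub>L amp K (tobj C H L) (tobj C L H) U) o\<^sub>L P o\<^sub>L
        (amp H (tobj C L K) (tobj C K L) V o\<^sub>L R H (tobj C L K) (tvec C L K l k))"
      by (simp add: assoc_leg23_gen leg23_gen_assoc_inv P_def oper_comp_assoc)
    also have "\<dots> = \<sigma> (adj U (tvec C L H l' h')) (V (tvec C L K l k))"
      by (simp add: amp_R adj_R_amp \<sigma>_def)
    finally show ?thesis .
  qed
  \<comment> \<open>On elementary tensors X does not touch the leg L, which contributes a scalar
    only.\<close>
  have \<sigma>_vec: "\<sigma> (tvec C H L h' l') (tvec C K L k l) = scaleC_oper (cinner l' l) (adj (R K H h') o\<^sub>L X o\<^sub>L R H K k)"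
    if [simp]: "l' \<in> Hilb C L" "h' \<in> Hilb C H" "k \<in> Hilb C K" "l \<in> Hilb C L" for l' h' k l
  proof -
    have "\<sigma> (tvec C H L h' l') (tvec C K L k l) = (adj (R K (tobj C H L) (tvec C H L h' l')) o\<^sub>L assoc C K H L) o\<^sub>L
        leg12 C H K K H L X o\<^sub>L (assoc_inv C H K L o\<^sub>L R H (tobj C K L) (tvec C K L k l))"
      by (simp add: \<sigma>_def P_def oper_comp_assoc)
    also have "\<dots> = (adj (R K H h') o\<^sub>L adj (R (tobj C K H) L l')) o\<^sub>L leg12 C H K K H L X o\<^sub>L (R (tobj C H K) L l o\<^sub>L R H K k)"
      by (simp add: adj_R_adj_R R_R)
    also have "\<dots> = adj (R K H h') o\<^sub>L adj (R (tobj C K H) L l') o\<^sub>L (leg12 C H K K H L X o\<^sub>L R (tobj C H K) L l) o\<^sub>L R H K k"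
      by (simp only: oper_comp_assoc)
    also have "\<dots> = adj (R K H h') o\<^sub>L (adj (R (tobj C K H) L l') o\<^sub>L R (tobj C K H) L l) o\<^sub>L X o\<^sub>L R H K k"
      by (simp add: leg12_R oper_comp_assoc)
    also have "\<dots> = scaleC_oper (cinner l' l) (adj (R K H h') o\<^sub>L (idm C (tobj C K H) o\<^sub>L X) o\<^sub>L R H K k)"
      by (simp add: adj_R_comp_R scaleC_oper_comp_left scaleC_oper_comp_right oper_comp_assoc)
    finally show ?thesis by (simp add: uni_id_left[OF _ _ X])
  qed
  note dense = hilbert_tensor.dense[OF tensor_obj]
  show ?thesis
  proof (intro equalityI closed_span_le subsetI)
    fix S assume "S \<in> outer_slices H L K M"
    then obtain l' h' k l where l: "l' \<in> Hilb C L" "h' \<in> Hilb C H" "k \<in> Hilb C K" "l \<in> Hilb C L"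
      and S: "S = \<sigma> (adj U (tvec C L H l' h')) (V (tvec C L K l k))"
      unfolding outer_slices_def using \<tau> by blast
    have mem: "adj U (tvec C L H l' h') \<in> Hilb2 C H L" "V (tvec C L K l k) \<in> Hilb2 C K L"
      using l by (auto intro: uni_mem[OF uni_adj[OF _ _ U]] uni_mem[OF V])
    \<comment> \<open>Here the vectors are arbitrary and no unitary remains, so both maps in
      \<open>sliced_closure\<close> are the identity.\<close>
    have "adj (R K (tobj C H L) (id_blinfun \<zeta>)) o\<^sub>L P o\<^sub>L R H (tobj C K L) (id_blinfun \<xi>) \<in> closed_span (vslices H K K H X)"
      if "\<zeta> \<in> Hilb2 C H L" "\<xi> \<in> Hilb2 C K L" for \<zeta> \<xi>
    proof (rule sliced_closure[of _ _ _ _ _ _ _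
          "(\<lambda>(a, b). tvec C H L a b) ` (Hilb C H \<times> Hilb C L)" "(\<lambda>(a, b). tvec C K L a b) ` (Hilb C K \<times> Hilb C L)"])
      fix \<zeta> \<xi> assume "\<zeta> \<in> (\<lambda>(a, b). tvec C H L a b) ` (Hilb C H \<times> Hilb C L)"
        "\<xi> \<in> (\<lambda>(a, b). tvec C K L a b) ` (Hilb C K \<times> Hilb C L)"
      then obtain h' l' k l where v: "\<zeta> = tvec C H L h' l'" "\<xi> = tvec C K L k l"
        "h' \<in> Hilb C H" "l' \<in> Hilb C L" "k \<in> Hilb C K" "l \<in> Hilb C L" by auto
      then have "adj (R K H h') o\<^sub>L X o\<^sub>L R H K k \<in> vslices H K K H X" unfolding vslices_def by blast
      then have "\<sigma> \<zeta> \<xi> \<in> closed_span (vslices H K K H X)"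
        using closed_span_superset[of "vslices H K K H X"] v by (auto simp: \<sigma>_vec intro!: closed_span_scale)
      then show "adj (R K (tobj C H L) (id_blinfun \<zeta>)) o\<^sub>L P o\<^sub>L R H (tobj C K L) (id_blinfun \<xi>) \<in> closed_span (vslices H K K H X)"
        by (simp add: \<sigma>_def)
    qed (use that clP in \<open>simp_all add: dense clin_def\<close>)
    from this[OF mem] show "S \<in> closed_span (vslices H K K H X)" by (simp add: S \<sigma>_def)
  next
    fix S assume "S \<in> vslices H K K H X"
    then obtain h' k where hk: "h' \<in> Hilb C H" "k \<in> Hilb C K" and S: "S = adj (R K H h') o\<^sub>L X o\<^sub>L R H K k"
      unfolding vslices_def by blast
    have *: "adj (R K (tobj C H L) (adj U \<zeta>)) o\<^sub>L P o\<^sub>L R H (tobj C K L) (V \<xi>) \<in> closed_span (outer_slices H L K M)"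
      if "\<zeta> \<in> Hilb2 C L H" "\<xi> \<in> Hilb2 C L K" for \<zeta> \<xi>
    proof (rule sliced_closure[of _ _ _ _ _ _ _
          "(\<lambda>(a, b). tvec C L H a b) ` (Hilb C L \<times> Hilb C H)" "(\<lambda>(a, b). tvec C L K a b) ` (Hilb C L \<times> Hilb C K)"])
      fix \<zeta> \<xi> assume "\<zeta> \<in> (\<lambda>(a, b). tvec C L H a b) ` (Hilb C L \<times> Hilb C H)"
        "\<xi> \<in> (\<lambda>(a, b). tvec C L K a b) ` (Hilb C L \<times> Hilb C K)"
      then obtain l' h' l k where v: "\<zeta> = tvec C L H l' h'" "\<xi> = tvec C L K l k"
        "h' \<in> Hilb C H" "l' \<in> Hilb C L" "k \<in> Hilb C K" "l \<in> Hilb C L" by auto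
      have "\<sigma> (adj U \<zeta>) (V \<xi>) \<in> outer_slices H L K M"
        unfolding v(1,2) \<tau>[OF v(4,3,5,6), symmetric] outer_slices_def using v(3-6) by blast
      then show "adj (R K (tobj C H L) (adj U \<zeta>)) o\<^sub>L P o\<^sub>L R H (tobj C K L) (V \<xi>) \<in> closed_span (outer_slices H L K M)"
        using closed_span_superset[of "outer_slices H L K M"] by (auto simp: \<sigma>_def)
    qed (use that clP unitary_opD(4)[OF U] unitary_opD(4)[OF V] in \<open>simp_all add: dense\<close>)
    \<comment> \<open>U (h' \<otimes> l0) and the preimage of k \<otimes> l0 under V are inserted to
      undo the unitaries; the scalar <l0, l0> that appears is invertible.\<close>
    have "\<sigma> (tvec C H L h' l0) (tvec C K L k l0) \<in> closed_span (outer_slices H L K M)"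
      using *[of "U (tvec C H L h' l0)" "adj V (tvec C K L k l0)"] hk l0(1)
      by (simp add: \<sigma>_def unitary_op_apply_adj[OF _ _ U] unitary_op_apply_adj[OF _ _ V] uni_mem[OF U] uni_mem[OF uni_adj[OF _ _ V]])
    then have "scaleC_oper (cinner l0 l0) S \<in> closed_span (outer_slices H L K M)"
      using hk l0(1) by (simp add: \<sigma>_vec S)
    from closed_span_scale[OF this, of "1 / cinner l0 l0"] show "S \<in> closed_span (outer_slices H L K M)"
      using l0(2) by simp
  qed
qed

text \<open>The functional on the third leg sees the middle factor only and turns it into an
  amplified slice; the functional on the leg L attaches to the outer factors V and U.\<close>

lemma outer_slice_product:
  assumes obj [simp]: "H \<in> Obj C" "L \<in> Obj C" "K \<in> Obj C"
    and U [simp]: "uni (tobj C H L) (tobj C L H) U" and V [simp]: "uni (tobj C L K) (tobj C K L) V"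
    and d [simp]: "uni (tobj C H K) (tobj C K H) d"
    and [simp]: "h' \<in> Hilb C H" "k \<in> Hilb C K"
  shows "adj (R K L l') o\<^sub>L adj (R (tobj C K L) H h') o\<^sub>L
      (leg12 C L K K L H V o\<^sub>L leg23_gen L H K K H d o\<^sub>L leg12 C H L L H K U) o\<^sub>L R (tobj C H L) K k o\<^sub>L R H L l
    = (adj (R K L l') o\<^sub>L V) o\<^sub>L amp L H K (adj (R K H h') o\<^sub>L d o\<^sub>L R H K k) o\<^sub>L (U o\<^sub>L R H L l)"
proof -
  have "adj (R (tobj C L K) H h') o\<^sub>L assoc_inv C L K H = adj (assoc C L K H o\<^sub>L R (tobj C L K) H h')"
    by (rule adj_comp[symmetric]) (simp_all add: unitary_opD(4)[OF assoc_unitary(1)])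
  also have "\<dots> = amp L (tobj C K H) K (adj (R K H h'))"
    by (simp add: assoc_R amp_adj)
  finally have 1: "adj (R (tobj C L K) H h') o\<^sub>L assoc_inv C L K H = amp L (tobj C K H) K (adj (R K H h'))" .
  have "adj (R (tobj C L K) H h') o\<^sub>L leg23_gen L H K K H d o\<^sub>L R (tobj C L H) K k
    = (adj (R (tobj C L K) H h') o\<^sub>L assoc_inv C L K H) o\<^sub>L amp L (tobj C H K) (tobj C K H) d o\<^sub>L
      (assoc C L H K o\<^sub>L R (tobj C L H) K k)"
    by (simp add: leg23_gen_def oper_comp_assoc)
  also have "\<dots> = amp L H K (adj (R K H h') o\<^sub>L d o\<^sub>L R H K k)"
    by (simp add: 1 assoc_R amp_comp unitary_opD(1)[OF d] bounded_ops_comp[OF unitary_opD(1)[OF d] adj_R_bounded_ops])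
  finally have 2: "adj (R (tobj C L K) H h') o\<^sub>L leg23_gen L H K K H d o\<^sub>L R (tobj C L H) K k
    = amp L H K (adj (R K H h') o\<^sub>L d o\<^sub>L R H K k)" .
  have "adj (R K L l') o\<^sub>L adj (R (tobj C K L) H h') o\<^sub>L
      (leg12 C L K K L H V o\<^sub>L leg23_gen L H K K H d o\<^sub>L leg12 C H L L H K U) o\<^sub>L R (tobj C H L) K k o\<^sub>L R H L l
    = adj (R K L l') o\<^sub>L (adj (R (tobj C K L) H h') o\<^sub>L leg12 C L K K L H V) o\<^sub>L leg23_gen L H K K H d o\<^sub>L
      (leg12 C H L L H K U o\<^sub>L R (tobj C H L) K k) o\<^sub>L R H L l"
    by (simp only: oper_comp_assoc)
  also have "\<dots> = (adj (R K L l') o\<^sub>L V) o\<^sub>L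
      (adj (R (tobj C L K) H h') o\<^sub>L leg23_gen L H K K H d o\<^sub>L R (tobj C L H) K k) o\<^sub>L (U o\<^sub>L R H L l)"
    by (simp add: leg12_R adj_R_leg12 oper_comp_assoc)
  finally show ?thesis by (simp only: 2)
qed

end

section \<open>Regularity of the Yetter-Drinfeld braiding\<close>

lemma closed_span_zero [simp]: "0 \<in> closed_span M"
  using closed_osubspace_closed_span[of M] by (simp add: closed_osubspace_def coper.subspace_0)

context unitarily_braided_category
begin

text \<open>Generators of the space S(X): here the functionals are restricted to vector
  functionals.\<close>

abbreviation braid_slices :: "'o \<Rightarrow> 'o \<Rightarrow> 'v oper \<Rightarrow> 'v oper set" where
  "braid_slices H K X \<equiv> vslices H K K H (w K H o\<^sub>L X)"

abbreviation rank1_ops :: "'o \<Rightarrow> 'o \<Rightarrow> 'v oper set" where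
  "rank1_ops H K \<equiv> rank1s (Hilb C H) (Hilb C K)"

abbreviation braid_side :: "'o \<Rightarrow> 'o \<Rightarrow> 'o \<Rightarrow> 'v oper \<Rightarrow> 'v oper \<Rightarrow> 'v oper" where
  "braid_side H L K U V \<equiv> leg12 C L K K L H (w K L o\<^sub>L V) o\<^sub>L leg23_gen L H K K H (w K H) o\<^sub>L leg12 C H L L H K (w L H o\<^sub>L U)"

text \<open>The common shape of the module axioms for U and V and of the equation that determines V
  * U once it is solved for V_23 U_12.\<close>

definition pentagonal :: "'o \<Rightarrow> 'o \<Rightarrow> 'o \<Rightarrow> 'v oper \<Rightarrow> 'v oper \<Rightarrow> 'v oper \<Rightarrow> bool" where
  "pentagonal H L K U V X \<longleftrightarrow> U \<in> unitaries C (tobj C H L) \<and> V \<in> unitaries C (tobj C L K) \<and>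
    X \<in> unitaries C (tobj C H K) \<and>
    leg23 C H L K V o\<^sub>L leg12 C H L H L K U = leg12 C H L H L K U o\<^sub>L leg13 C c H L K X o\<^sub>L leg23 C H L K V"

lemma wX_uni [simp]:
  assumes [simp]: "H \<in> Obj C" "K \<in> Obj C" and X: "X \<in> unitaries C (tobj C H K)"
  shows "uni (tobj C H K) (tobj C K H) (w K H o\<^sub>L X)"
  by (rule uni_comp[of _ "tobj C H K"]) (use X in \<open>simp_all add: unitaries_iff\<close>)

lemma braid_slices_bounded_ops:
  assumes "H \<in> Obj C" "K \<in> Obj C" "X \<in> unitaries C (tobj C H K)"
  shows "braid_slices H K X \<subseteq> bounded_ops (Hilb C H) (Hilb C K)"
  using assms by (intro vslices_bounded_ops unitary_opD(1)[OF wX_uni])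

lemma w_slices_bounded_ops:
  assumes "H \<in> Obj C" "K \<in> Obj C"
  shows "vslices H K K H (w K H) \<subseteq> bounded_ops (Hilb C H) (Hilb C K)"
  using assms by (intro vslices_bounded_ops unitary_opD(1)[OF w_uni])

lemma closed_span_slices:
  assumes obj: "H \<in> Obj C" "L \<in> Obj C" "K \<in> Obj C" and p: "pentagonal H L K U V X"
    and l0: "l0 \<in> Hilb C L" "l0 \<noteq> 0"
  shows "closed_span (outer_slices H L K (braid_side H L K U V)) = closed_span (braid_slices H K X)"
proof -
  have u: "U \<in> unitaries C (tobj C H L)" "V \<in> unitaries C (tobj C L K)" "X \<in> unitaries C (tobj C H K)"
    using p by (auto simp: pentagonal_def)
  show ?thesis
    using p unfolding pentagonal_def
    by (subst braid_pentagon[OF obj u], blast) (rule closed_span_outer_slices[OF obj wX_uni wX_uni wX_uni l0], use obj u in simp_all)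
qed

lemma outer_slice_mem:
  assumes [simp]: "H \<in> Obj C" "L \<in> Obj C" "K \<in> Obj C" and p: "pentagonal H L K U V X"
    and s: "s \<in> vslices H K K H (w K H)" and l: "l \<in> Hilb C L" "l' \<in> Hilb C L"
  shows "(adj (R K L l') o\<^sub>L (w K L o\<^sub>L V)) o\<^sub>L amp L H K s o\<^sub>L ((w L H o\<^sub>L U) o\<^sub>L R H L l) \<in>
    outer_slices H L K (braid_side H L K U V)"
proof -
  obtain h' k where hk: "h' \<in> Hilb C H" "k \<in> Hilb C K" "s = adj (R K H h') o\<^sub>L w K H o\<^sub>L R H K k"
    using s unfolding vslices_def by blast
  have u: "U \<in> unitaries C (tobj C H L)" "V \<in> unitaries C (tobj C L K)"
    using p by (auto simp: pentagonal_def)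
  show ?thesis
    unfolding hk(3) outer_slice_product[OF assms(1-3) wX_uni[OF assms(1,2) u(1)] wX_uni[OF assms(2,3) u(2)]
        w_uni[OF assms(3,1)] hk(1,2), symmetric] outer_slices_def
    using hk(1,2) l by blast
qed

text \<open>The hypothesis puts |k><h| into the closed span of the slices of the inverse braiding.
  Inserted in the middle of the sliced left side, it gives exactly the product v u.\<close>

lemma slice_product_mem:
  assumes obj [simp]: "H \<in> Obj C" "L \<in> Obj C" "K \<in> Obj C" and p: "pentagonal H L K U V X"
    and l0: "l0 \<in> Hilb C L" "l0 \<noteq> 0" and reg: "rank1_ops H K \<subseteq> closed_span (vslices H K K H (w K H))"
    and v: "v \<in> braid_slices L K V" and u: "u \<in> braid_slices H L U"
  shows "v o\<^sub>L u \<in> closed_span (braid_slices H K X)"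
proof -
  obtain l' k where v: "l' \<in> Hilb C L" "k \<in> Hilb C K" "v = adj (R K L l') o\<^sub>L (w K L o\<^sub>L V) o\<^sub>L R L K k"
    using v unfolding vslices_def by blast
  obtain h l where u: "h \<in> Hilb C H" "l \<in> Hilb C L" "u = adj (R L H h) o\<^sub>L (w L H o\<^sub>L U) o\<^sub>L R H L l"
    using u unfolding vslices_def by blast
  have V: "V \<in> unitaries C (tobj C L K)" using p by (simp add: pentagonal_def)
  let ?N = "{s \<in> bounded_ops (Hilb C H) (Hilb C K).
    (adj (R K L l') o\<^sub>L (w K L o\<^sub>L V)) o\<^sub>L amp L H K s o\<^sub>L ((w L H o\<^sub>L U) o\<^sub>L R H L l) \<in> closed_span (outer_slices H L K (braid_side H L K U V))}"
  have "closed_osubspace ?N"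
    by (intro closed_osubspace_amp closed_osubspace_closed_span clin_intros(5) unitary_opD(4)[OF wX_uni] V) simp_all
  moreover have "vslices H K K H (w K H) \<subseteq> ?N"
    using w_slices_bounded_ops[OF obj(1,3)] outer_slice_mem[OF obj p _ u(2) v(1)]
      closed_span_superset[of "outer_slices H L K (braid_side H L K U V)"] by blast
  \<comment> \<open>k is the input vector of v and h the output vector of u, so that |k><h| joins
    the two slices.\<close>
  moreover have "rank1 k h \<in> rank1_ops H K" using u v by (auto simp: rank1s_def)
  ultimately have "rank1 k h \<in> ?N"
    using reg closed_span_minimal[of ?N "vslices H K K H (w K H)"] by blast
  then have "(adj (R K L l') o\<^sub>L (w K L o\<^sub>L V)) o\<^sub>L amp L H K (rank1 k h) o\<^sub>L ((w L H o\<^sub>L U) o\<^sub>L R H L l) \<in> closed_span (braid_slices H K X)"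
    unfolding closed_span_slices[OF obj p l0] by blast
  then show ?thesis
    using u v by (simp add: amp_rank1 oper_comp_assoc)
qed

text \<open>The reverse approximation: the slice of the inverse braiding in the middle is
  approximated by combinations of rank-one operators, and each rank-one operator splits the
  expression into a product v u.\<close>

lemma slices_subset_products:
  assumes obj [simp]: "H \<in> Obj C" "L \<in> Obj C" "K \<in> Obj C" and p: "pentagonal H L K U V X"
    and l0: "l0 \<in> Hilb C L" "l0 \<noteq> 0" and reg: "vslices H K K H (w K H) \<subseteq> closed_span (rank1_ops H K)"
    and prod: "\<And>v u. v \<in> braid_slices L K V \<Longrightarrow> u \<in> braid_slices H L U \<Longrightarrow> v o\<^sub>L u \<in> closed_span N"
  shows "closed_span (braid_slices H K X) \<subseteq> closed_span N"
  unfolding closed_span_slices[OF obj p l0, symmetric]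
proof (intro closed_span_le subsetI)
  have V: "V \<in> unitaries C (tobj C L K)" and U: "U \<in> unitaries C (tobj C H L)"
    using p by (simp_all add: pentagonal_def)
  fix S assume "S \<in> outer_slices H L K (braid_side H L K U V)"
  then obtain l' h' k l where v: "l' \<in> Hilb C L" "h' \<in> Hilb C H" "k \<in> Hilb C K" "l \<in> Hilb C L"
    and S: "S = (adj (R K L l') o\<^sub>L (w K L o\<^sub>L V)) o\<^sub>L amp L H K (adj (R K H h') o\<^sub>L w K H o\<^sub>L R H K k) o\<^sub>L ((w L H o\<^sub>L U) o\<^sub>L R H L l)"
    unfolding outer_slices_def using outer_slice_product[OF obj wX_uni[OF _ _ U] wX_uni[OF _ _ V] w_uni] obj by auto
  let ?N = "{s \<in> bounded_ops (Hilb C H) (Hilb C K).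
    (adj (R K L l') o\<^sub>L (w K L o\<^sub>L V)) o\<^sub>L amp L H K s o\<^sub>L ((w L H o\<^sub>L U) o\<^sub>L R H L l) \<in> closed_span N}"
  have N: "closed_osubspace ?N"
    by (intro closed_osubspace_amp closed_osubspace_closed_span clin_intros(5) unitary_opD(4)[OF wX_uni] V) simp_all
  have "rank1_ops H K \<subseteq> ?N"
  proof
    fix s assume "s \<in> rank1_ops H K"
    then obtain k h where s: "s = rank1 k h" "k \<in> Hilb C K" "h \<in> Hilb C H" by (auto simp: rank1s_def)
    have "adj (R K L l') o\<^sub>L (w K L o\<^sub>L V) o\<^sub>L R L K k \<in> braid_slices L K V" "adj (R L H h) o\<^sub>L (w L H o\<^sub>L U) o\<^sub>L R H L l \<in> braid_slices H L U"
      using v s unfolding vslices_def by blast+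
    from prod[OF this] show "s \<in> ?N"
      using s by (simp add: amp_rank1 oper_comp_assoc rank1_bounded_ops)
  qed
  from closed_span_minimal[OF N this]
  have "adj (R K H h') o\<^sub>L w K H o\<^sub>L R H K k \<in> ?N"
    using reg v(2,3) unfolding vslices_def by blast
  then show "S \<in> closed_span N" by (simp add: S)
qed

text \<open>|k><a| u = |k><u^* a|, and u^* a lies in H. With its mirror image below this is the
  ideal property of the compact operators.\<close>

lemma rank1_comp_mem:
  assumes obj [simp]: "H \<in> Obj C" "K \<in> Obj C" "A \<in> Obj C" and u: "u \<in> bounded_ops (Hilb C H) (Hilb C A)"
    and v: "v \<in> closed_span (rank1_ops A K)"
  shows "v o\<^sub>L u \<in> closed_span (rank1_ops H K)"
proof (rule closed_span_comp_right[OF _ v])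
  fix T assume "T \<in> rank1_ops A K"
  then obtain a k where T: "T = rank1 k a" "a \<in> Hilb C A" "k \<in> Hilb C K" by (auto simp: rank1s_def)
  have "adj u a \<in> Hilb C H"
    by (rule bounded_opsD(2)[OF bounded_ops_adj[OF _ _ u] T(2)]) simp_all
  then have "T o\<^sub>L u \<in> rank1_ops H K"
    using T by (auto simp: rank1_comp[OF bounded_opsD(1)[OF u]] rank1s_def)
  then show "T o\<^sub>L u \<in> closed_span (rank1_ops H K)" using closed_span_superset by blast
qed

lemma comp_rank1_mem:
  assumes v: "v \<in> bounded_ops (Hilb C A) (Hilb C K)" and u: "u \<in> closed_span (rank1_ops H A)"
  shows "v o\<^sub>L u \<in> closed_span (rank1_ops H K)"
proof (rule closed_span_comp_left[OF bounded_opsD(1)[OF v] _ u])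
  fix T assume "T \<in> rank1_ops H A"
  then obtain a h where T: "T = rank1 a h" "a \<in> Hilb C A" "h \<in> Hilb C H" by (auto simp: rank1s_def)
  then have "v o\<^sub>L T \<in> rank1_ops H K"
    using bounded_opsD(2)[OF v T(2)] by (auto simp: comp_rank1[OF bounded_opsD(1)[OF v]] rank1s_def)
  then show "v o\<^sub>L T \<in> closed_span (rank1_ops H K)" using closed_span_superset by blast
qed

text \<open>For a slice u, |l><l''| u is |l><u^* l''|, and u^* l'' arises from the vector l''
  \<otimes> h' by bounded operators that do not depend on it. By totality l'' \<otimes> h' may be
  replaced by any vector of L \<otimes> H, in particular by U' (h \<otimes> l0), for which the
  result is a multiple of h.\<close>

lemma rank1s_subset_slices_left:
  assumes obj [simp]: "H \<in> Obj C" "L \<in> Obj C" and p: "pentagonal H L L U F U"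
    and l0: "l0 \<in> Hilb C L" "l0 \<noteq> 0" and reg: "rank1_ops H L \<subseteq> closed_span (vslices H L L H (w L H))"
    and F: "rank1_ops L L \<subseteq> closed_span (braid_slices L L F)"
  shows "rank1_ops H L \<subseteq> closed_span (braid_slices H L U)"
proof
  fix S assume "S \<in> rank1_ops H L"
  then obtain l h where S: "S = rank1 l h" and l: "l \<in> Hilb C L" and h: "h \<in> Hilb C H" by (auto simp: rank1s_def)
  have U: "U \<in> unitaries C (tobj C H L)" using p by (simp add: pentagonal_def)
  let ?U = "w L H o\<^sub>L U"
  note uU = wX_uni[OF obj U]
  have "rank1 l (adj (R H L l0) (adj ?U \<zeta>)) \<in> closed_span (braid_slices H L U)" if "\<zeta> \<in> Hilb2 C L H" for \<zeta>
  proof (rule closed_span_vector_image[where \<phi> = "\<lambda>\<zeta>. rank1 l (adj (R H L l0) (adj ?U \<zeta>))"])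
    show "bounded_linear (\<lambda>\<zeta>. rank1 l (adj (R H L l0) (adj ?U \<zeta>)))"
      by (intro bounded_linear_compose[OF bounded_linear_rank1(2)] bounded_linear_compose[OF blinfun.bounded_linear_right]
          blinfun.bounded_linear_right)
    show "\<exists>b. rank1 l (adj (R H L l0) (adj ?U (a *\<^sub>C x))) = scaleC_oper b (rank1 l (adj (R H L l0) (adj ?U x)))" for a x
      using unitary_opD(4)[OF uU] by (intro exI[of _ "cnj a"]) (simp add: clinD rank1_expand)
    show "\<zeta> \<in> closure (cvec.span ((\<lambda>(a, b). tvec C L H a b) ` (Hilb C L \<times> Hilb C H)))"
      using that by (simp add: hilbert_tensor.dense[OF tensor_obj])
    fix x assume "x \<in> (\<lambda>(a, b). tvec C L H a b) ` (Hilb C L \<times> Hilb C H)"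
    then obtain l'' h' where x: "x = tvec C L H l'' h'" "l'' \<in> Hilb C L" "h' \<in> Hilb C H" by auto
    let ?u = "adj (R L H h') o\<^sub>L ?U o\<^sub>L R H L l0"
    have u: "?u \<in> braid_slices H L U" using x l0 unfolding vslices_def by blast
    have "rank1 l l'' \<in> closed_span (braid_slices L L F)" using F l x by (auto simp: rank1s_def)
    then have "rank1 l l'' o\<^sub>L ?u \<in> closed_span (braid_slices H L U)"
      by (rule closed_span_comp_right[rotated]) (rule slice_product_mem[OF obj obj(2) p l0 reg _ u])
    moreover have "adj ?u l'' = adj (R H L l0) (adj ?U x)"
      using x unitary_opD(4)[OF uU] by (simp add: adj_comp)
    moreover have "clin ?u" using unitary_opD(4)[OF uU] by simp
    ultimately show "rank1 l (adj (R H L l0) (adj ?U x)) \<in> closed_span (braid_slices H L U)"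
      by (simp only: rank1_comp)
  qed
  from this[of "?U (tvec C H L h l0)"] have "scaleC_oper (cnj (cinner l0 l0)) S \<in> closed_span (braid_slices H L U)"
    using h l0 uni_mem[OF uU] unitary_op_apply_adj(2)[OF _ _ uU] by (simp add: S rank1_expand del: blinfun_apply_blinfun_compose)
  from closed_span_scale[OF this, of "1 / cnj (cinner l0 l0)"] show "S \<in> closed_span (braid_slices H L U)"
    using l0(2) by simp
qed

text \<open>The mirror image: v |l><l'| is |v l><l'|, and v l depends on l \<otimes> k' through
  bounded operators. The vector inserted at the end is the preimage of k \<otimes> l0 under
  V'.\<close>

lemma rank1s_subset_slices_right:
  assumes obj [simp]: "L \<in> Obj C" "K \<in> Obj C" and p: "pentagonal L L K F V V"
    and l0: "l0 \<in> Hilb C L" "l0 \<noteq> 0" and reg: "rank1_ops L K \<subseteq> closed_span (vslices L K K L (w K L))"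
    and F: "rank1_ops L L \<subseteq> closed_span (braid_slices L L F)"
  shows "rank1_ops L K \<subseteq> closed_span (braid_slices L K V)"
proof
  fix S assume "S \<in> rank1_ops L K"
  then obtain l' k where S: "S = rank1 k l'" and l': "l' \<in> Hilb C L" and k: "k \<in> Hilb C K" by (auto simp: rank1s_def)
  have V: "V \<in> unitaries C (tobj C L K)" using p by (simp add: pentagonal_def)
  let ?V = "w K L o\<^sub>L V"
  note uV = wX_uni[OF obj V]
  have "rank1 (adj (R K L l0) (?V \<zeta>)) l' \<in> closed_span (braid_slices L K V)" if "\<zeta> \<in> Hilb2 C L K" for \<zeta>
  proof (rule closed_span_vector_image[where \<phi> = "\<lambda>\<zeta>. rank1 (adj (R K L l0) (?V \<zeta>)) l'"])
    show "bounded_linear (\<lambda>\<zeta>. rank1 (adj (R K L l0) (?V \<zeta>)) l')"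
      by (intro bounded_linear_compose[OF bounded_linear_rank1(1)] bounded_linear_compose[OF blinfun.bounded_linear_right]
          blinfun.bounded_linear_right)
    show "\<exists>b. rank1 (adj (R K L l0) (?V (a *\<^sub>C x))) l' = scaleC_oper b (rank1 (adj (R K L l0) (?V x)) l')" for a x
      using clinD[OF unitary_opD(4)[OF uV]]
      by (intro exI[of _ a]) (simp add: clinD rank1_expand del: blinfun_apply_blinfun_compose)
    show "\<zeta> \<in> closure (cvec.span ((\<lambda>(a, b). tvec C L K a b) ` (Hilb C L \<times> Hilb C K)))"
      using that by (simp add: hilbert_tensor.dense[OF tensor_obj])
    fix x assume "x \<in> (\<lambda>(a, b). tvec C L K a b) ` (Hilb C L \<times> Hilb C K)"
    then obtain l k' where x: "x = tvec C L K l k'" "l \<in> Hilb C L" "k' \<in> Hilb C K" by auto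
    let ?v = "adj (R K L l0) o\<^sub>L ?V o\<^sub>L R L K k'"
    have v: "?v \<in> braid_slices L K V" using x l0 unfolding vslices_def by blast
    have cv: "clin ?v" using unitary_opD(4)[OF uV] by simp
    have "rank1 l l' \<in> closed_span (braid_slices L L F)" using F l' x by (auto simp: rank1s_def)
    then have "?v o\<^sub>L rank1 l l' \<in> closed_span (braid_slices L K V)"
      by (rule closed_span_comp_left[OF cv, rotated]) (rule slice_product_mem[OF obj(1) obj p l0 reg v])
    moreover have "?v l = adj (R K L l0) (?V x)"
      using x by simp
    ultimately show "rank1 (adj (R K L l0) (?V x)) l' \<in> closed_span (braid_slices L K V)"
      by (simp only: comp_rank1[OF cv])
  qed
  from this[of "adj ?V (tvec C K L k l0)"] have "scaleC_oper (cinner l0 l0) S \<in> closed_span (braid_slices L K V)"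
    using k l0 uni_mem[OF uni_adj[OF _ _ uV]] unitary_op_apply_adj(1)[OF _ _ uV]
    by (simp add: S rank1_expand del: blinfun_apply_blinfun_compose)
  from closed_span_scale[OF this, of "1 / cinner l0 l0"] show "S \<in> closed_span (braid_slices L K V)"
    using l0(2) by simp
qed

text \<open>|k><l0| |l0><h| is <l0, l0> |k><h|, a product of elements of the closed spans S(V) and
  S(U).\<close>

lemma rank1s_subset_slices:
  assumes obj [simp]: "H \<in> Obj C" "L \<in> Obj C" "K \<in> Obj C" and p: "pentagonal H L K U V X"
    and l0: "l0 \<in> Hilb C L" "l0 \<noteq> 0" and reg: "rank1_ops H K \<subseteq> closed_span (vslices H K K H (w K H))"
    and U: "rank1_ops H L \<subseteq> closed_span (braid_slices H L U)" and V: "rank1_ops L K \<subseteq> closed_span (braid_slices L K V)"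
  shows "rank1_ops H K \<subseteq> closed_span (braid_slices H K X)"
proof
  fix S assume "S \<in> rank1_ops H K"
  then obtain k h where S: "S = rank1 k h" "k \<in> Hilb C K" "h \<in> Hilb C H" by (auto simp: rank1s_def)
  have v: "rank1 k l0 \<in> closed_span (braid_slices L K V)" and u: "rank1 l0 h \<in> closed_span (braid_slices H L U)"
    using S l0 U V by (auto simp: rank1s_def)
  have "rank1 k l0 o\<^sub>L rank1 l0 h \<in> closed_span (braid_slices H K X)"
  proof (rule closed_span_comp_left[OF clin_rank1 _ u])
    fix T assume T: "T \<in> braid_slices H L U"
    show "rank1 k l0 o\<^sub>L T \<in> closed_span (braid_slices H K X)"
      by (rule closed_span_comp_right[OF _ v]) (rule slice_product_mem[OF obj p l0 reg _ T])
  qed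
  moreover have "rank1 k l0 o\<^sub>L rank1 l0 h = scaleC_oper (cinner l0 l0) S"
    by (simp add: comp_rank1 S rank1_expand)
  ultimately have "scaleC_oper (cinner l0 l0) S \<in> closed_span (braid_slices H K X)" by simp
  from closed_span_scale[OF this, of "1 / cinner l0 l0"] show "S \<in> closed_span (braid_slices H K X)"
    using l0(2) by simp
qed

section \<open>From slices of the braiding to slices of its inverse\<close>

lemma adj_vslices:
  assumes [simp]: "X \<in> Obj C" "Y \<in> Obj C" "X' \<in> Obj C" "Y' \<in> Obj C" and T: "clin T"
  shows "adj ` vslices X Y X' Y' T \<subseteq> vslices X' Y' X Y (adj T)"
  using T unfolding vslices_def by (auto simp: adj_comp oper_comp_assoc) blast

lemma c_slices:
  "H \<in> Obj C \<Longrightarrow> K \<in> Obj C \<Longrightarrow> slice_span C H K K H (c H K) = closed_span (vslices H K K H (c H K))"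
  by (rule slice_span_eq) (simp_all add: unitary_opD(1)[OF c_uni])

text \<open>Slices of the adjoint are adjoints of slices, with source and target exchanged; so the
  hypothesis is taken for the pair in reverse order.\<close>

lemma rank1s_subset_w_slices:
  assumes [simp]: "H \<in> Obj C" "K \<in> Obj C"
    and c: "compact_ops (Hilb C K) (Hilb C H) \<subseteq> slice_span C K H H K (c K H)"
  shows "rank1_ops H K \<subseteq> closed_span (vslices H K K H (w K H))"
proof
  note c_bounded = unitary_opD(1)[OF c_uni[OF assms(2,1)]]
  fix S assume "S \<in> rank1_ops H K"
  then obtain k h where S: "S = rank1 k h" "k \<in> Hilb C K" "h \<in> Hilb C H" by (auto simp: rank1s_def)
  have "rank1 h k \<in> compact_ops (Hilb C K) (Hilb C H)"
    using rank1s_subset_compact_ops[of "Hilb C H" "Hilb C K"] S by (auto simp: rank1s_def)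
  then have "rank1 h k \<in> closed_span (vslices K H H K (c K H))"
    using c c_slices[of K H] by auto
  then have "adj (rank1 h k) \<in> closed_span (adj ` vslices K H H K (c K H))"
    by (rule closed_span_adj[rotated]) (use vslices_bounded_ops[OF _ _ _ _ c_bounded] bounded_opsD(1) in auto)
  also have "\<dots> \<subseteq> closed_span (vslices H K K H (w K H))"
    by (rule closed_span_le[OF order_trans[OF adj_vslices closed_span_superset]])
      (simp_all add: bounded_opsD(1)[OF c_bounded])
  finally show "S \<in> closed_span (vslices H K K H (w K H))" by (simp add: S)
qed

text \<open>The adjoint of a slice of the inverse braiding is a slice of c_{K,H}, hence compact and
  a limit of combinations of rank-one operators; taking adjoints again exchanges the two vectors of
  each.\<close>

lemma w_slices_subset_rank1s:
  assumes [simp]: "H \<in> Obj C" "K \<in> Obj C"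
    and c: "slice_span C K H H K (c K H) \<subseteq> compact_ops (Hilb C K) (Hilb C H)"
  shows "vslices H K K H (w K H) \<subseteq> closed_span (rank1_ops H K)"
proof
  note c_bounded = unitary_opD(1)[OF c_uni[OF assms(2,1)]]
  fix S assume S: "S \<in> vslices H K K H (w K H)"
  have cS: "clin S"
    using w_slices_bounded_ops[OF assms(1,2)] S bounded_opsD(1) by blast
  have "adj S \<in> vslices K H H K (c K H)"
    using adj_vslices[of H K K H "w K H"] unitary_opD(4)[OF w_uni[OF assms(2,1)]] S bounded_opsD(1)[OF c_bounded] by auto
  then have "adj S \<in> closed_span (rank1_ops K H)"
    using c closed_span_superset[of "vslices K H H K (c K H)"]
      compact_ops_subset_closed_span[of "Hilb C K" "Hilb C H"] c_slices[of K H] by auto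
  then have "adj (adj S) \<in> closed_span (adj ` rank1_ops K H)"
    by (rule closed_span_adj[rotated]) (auto simp: rank1s_def)
  moreover have "adj ` rank1_ops K H \<subseteq> rank1_ops H K" by (auto simp: rank1s_def) blast
  ultimately show "S \<in> closed_span (rank1_ops H K)"
    using cS closed_span_superset[of "rank1_ops H K"] closed_span_le[of "adj ` rank1_ops K H" "rank1_ops H K"] by auto
qed

section \<open>The degenerate case of a zero Hilbert space\<close>

lemma zero_space:
  assumes "X \<in> Obj C" "Hilb C X = {0}" "T \<in> bounded_ops (Hilb C X) B"
  shows "T = 0"
proof (rule blinfun_eqI)
  fix x
  have "idm C X x = 0" using id_op(3)[OF Hilb_closed[OF assms(1)], of x] assms(2) by simp
  then show "T x = blinfun_apply 0 x"
    using bounded_ops_apply_id[OF Hilb_closed[OF assms(1)] assms(3), of x] by (simp add: blinfun.zero_right)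
qed

text \<open>All operators on \<open>(H \<otimes> L) \<otimes> K\<close> vanish, so \<open>- W\<close> has the characterizing property of \<open>W\<close>.\<close>

lemma unique_unitary_zero:
  assumes obj [simp]: "H \<in> Obj C" "L \<in> Obj C" "K \<in> Obj C" and L: "Hilb C L = {0}"
    and ex: "\<exists>!W. yd_star_eq C c L (H, U, VH) (K, UK, V) W"
    and W: "yd_star_eq C c L (H, U, VH) (K, UK, V) W"
  shows "W = 0"
proof -
  have "closed_csubspace {0 :: 'v}" by (simp add: closed_csubspace_def cvec.subspace_def)
  note sub = hilbert_tensor.subset_closedI[OF tensor_obj this]
  have "Hilb2 C H L \<subseteq> {0}"
    by (rule sub) (use L in \<open>auto simp: hilbert_tensor.zero_right[OF tensor_obj]\<close>)
  then have "Hilb2 C (tobj C H L) K \<subseteq> {0}"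
    by (intro sub) (auto simp: hilbert_tensor.zero_left[OF tensor_obj])
  then have z: "Hilb2 C (tobj C H L) K = {0}" using closed_csubspaceD(1)[OF Hilb_closed, of "tobj C (tobj C H L) K"] by auto
  have W': "W \<in> unitaries C (tobj C H K)" using W by (simp add: yd_star_eq_def)
  then have Hom: "W \<in> Hom C (tobj C H K) (tobj C H K)" and uW: "uni (tobj C H K) (tobj C H K) W"
    by (simp_all add: unitaries_iff)
  have "- W \<in> Hom C (tobj C H K) (tobj C H K)"
    using Hom Hom_subspace[of "tobj C H K" "tobj C H K"] coper.subspace_neg by simp
  moreover have "uni (tobj C H K) (tobj C H K) (- W)"
  proof -
    have "adj (- W) = - adj W"
      by (rule adj_eqI) (simp add: blinfun.minus_left cinner_minus_left cinner_minus_right cinner_adj[OF unitary_opD(4)[OF uW]])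
    moreover have "(- S) o\<^sub>L (- T) = S o\<^sub>L T" for S T :: "'v oper"
      by (rule blinfun_eqI) (simp add: blinfun.minus_left blinfun.minus_right)
    moreover have "- W \<in> bounded_ops (Hilb2 C H K) (Hilb2 C H K)"
      using unitary_opD(1)[OF uW] closed_osubspace_bounded_ops[OF Hilb_closed[of "tobj C H K"], of "Hilb2 C H K"]
      by (simp add: closed_osubspace_def coper.subspace_neg)
    ultimately show ?thesis using uW by (simp add: unitary_op_def)
  qed
  ultimately have nW: "- W \<in> unitaries C (tobj C H K)" by (simp add: unitaries_iff)
  \<comment> \<open>\<open>leg13\<close> factors through the zero space, so both sides of the
    equation for W are independent of W.\<close>
  have lhs: "leg13 C c H L K X = 0" for X
  proof -
    have "leg12 C H L L H K (c H L) = 0"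
      by (rule zero_space[OF _ z unitary_opD(1)[OF leg12_unitary]]) simp_all
    then show ?thesis by (simp add: leg13_def bounded_bilinear.zero_right[OF bounded_bilinear_blinfun_compose])
  qed
  have "yd_star_eq C c L (H, U, VH) (K, UK, V) (- W)"
    using W nW lhs by (simp add: yd_star_eq_def)
  then have "W = - W" using ex W by blast
  then have "2 *\<^sub>R W = 0" by (simp add: scaleR_2 eq_neg_iff_add_eq_0)
  then show ?thesis by simp
qed

end

section \<open>Transfer to the category of Yetter-Drinfeld modules\<close>

context unitarily_braided_category
begin

text \<open>Slicing uses only the Hilbert spaces and the tensor of vectors, which the module
  category takes over from C.\<close>

lemma yd_slice_span:
  "slice_span (yd C c L F) (H, U, V) (K, U', V') (K', U'', V'') (H', U''', V''') T = slice_span C H K K' H' T"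
proof -
  have lc: "lcreate (yd C c L F) (H, U, V) (K, U', V') = lcreate C H K" for H U V K U' V'
    by (intro ext) (simp add: lcreate_def yd_def yd_tensor_def)
  show ?thesis
    unfolding slice_span_def slice_def lc by (simp add: yd_def)
qed

text \<open>If 0 is unitary on H \<otimes> K, then every h \<otimes> k is 0, so its norm |h| |k|
  vanishes.\<close>

lemma zero_tensor_rank1s:
  assumes obj: "H \<in> Obj C" "K \<in> Obj C" and z: "uni (tobj C H K) (tobj C H K) 0"
  shows "rank1_ops H K \<subseteq> {0}"
proof
  fix S assume "S \<in> rank1_ops H K"
  then obtain k h where S: "S = rank1 k h" "k \<in> Hilb C K" "h \<in> Hilb C H" by (auto simp: rank1s_def)
  have "tvec C H K h k = 0"
    using unitary_op_apply_adj(2)[OF _ _ z, of "tvec C H K h k"] S obj by simp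
  then have "norm h * norm k = 0"
    using hilbert_tensor.norm_t[OF tensor_obj[OF obj] S(3,2)] by simp
  then show "S \<in> {0}" by (auto simp: S(1) intro!: blinfun_eqI)
qed

text \<open>The lower and the upper bound share the case distinction and the pentagon equation for
  W; they are proved as one conjunction and then separated.\<close>

lemma yd_rank1s:
  assumes obj: "H \<in> Obj C" "L \<in> Obj C" "K \<in> Obj C"
    and x: "yd_module C c L F (H, U, VH)" and y: "yd_module C c L F (K, UK, V)"
    and ex: "\<exists>!W. yd_star_eq C c L (H, U, VH) (K, UK, V) W"
    and W: "yd_star_eq C c L (H, U, VH) (K, UK, V) W"
    and F: "F \<in> unitaries C (tobj C L L)"
    and c_reg: "\<And>X Y. X \<in> Obj C \<Longrightarrow> Y \<in> Obj C \<Longrightarrow> compact_ops (Hilb C X) (Hilb C Y) \<subseteq> slice_span C X Y Y X (c X Y)"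
    and F_reg: "compact_ops (Hilb C L) (Hilb C L) \<subseteq> mu_algebra C c L F"
  shows "rank1_ops H K \<subseteq> closed_span (braid_slices H K W)"
    and "\<lbrakk>\<And>X Y. X \<in> Obj C \<Longrightarrow> Y \<in> Obj C \<Longrightarrow> slice_span C X Y Y X (c X Y) \<subseteq> compact_ops (Hilb C X) (Hilb C Y);
      mu_algebra C c L F \<subseteq> compact_ops (Hilb C L) (Hilb C L)\<rbrakk>
      \<Longrightarrow> closed_span (braid_slices H K W) \<subseteq> closed_span (rank1_ops H K)"
proof -
  have U: "U \<in> unitaries C (tobj C H L)" and V: "V \<in> unitaries C (tobj C L K)"
    and pU: "pentagonal H L L U F U" and pV: "pentagonal L L K F V V"
    using x y F by (auto simp: yd_module_def pentagonal_def)
  have Wu: "W \<in> unitaries C (tobj C H K)" using W by (simp add: yd_star_eq_def)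
  have uW: "uni (tobj C H K) (tobj C H K) W" using Wu by (simp add: unitaries_iff)
  have mu: "mu_algebra C c L F = closed_span (braid_slices L L F)"
    unfolding mu_algebra_def binv_eq[OF obj(2,2)]
    by (rule slice_span_eq[OF obj(2,2,2,2) unitary_opD(1)[OF wX_uni[OF obj(2,2) F]]])
  have "rank1_ops H K \<subseteq> closed_span (braid_slices H K W) \<and>
    ((\<forall>X\<in>Obj C. \<forall>Y\<in>Obj C. slice_span C X Y Y X (c X Y) \<subseteq> compact_ops (Hilb C X) (Hilb C Y)) \<and>
      mu_algebra C c L F \<subseteq> compact_ops (Hilb C L) (Hilb C L)
      \<longrightarrow> closed_span (braid_slices H K W) \<subseteq> closed_span (rank1_ops H K))"
  \<comment> \<open>A nonzero vector of L makes the slice spans comparable; where there is none, W =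
    0 settles the claim.\<close>
  proof (cases "Hilb C L = {0}")
    case True
    have W0: "W = 0" by (rule unique_unitary_zero[OF obj True ex W])
    have "rank1_ops H K \<subseteq> {0}" by (rule zero_tensor_rank1s[OF obj(1,3)]) (use uW W0 in simp)
    moreover have "braid_slices H K W \<subseteq> {0}"
      by (auto simp: vslices_def W0 bounded_bilinear.zero_right[OF bounded_bilinear_blinfun_compose]
          bounded_bilinear.zero_left[OF bounded_bilinear_blinfun_compose])
    ultimately show ?thesis
      by (intro conjI impI closed_span_le) auto
  next
    case False
    then obtain l0 where l0: "l0 \<in> Hilb C L" "l0 \<noteq> 0"
      using closed_csubspaceD(1)[OF Hilb_closed[OF obj(2)]] by blast
    let ?U = "leg12 C H L H L K U" and ?V = "leg23 C H L K V"
    have uU': "uni (tobj C (tobj C H L) K) (tobj C (tobj C H L) K) ?U"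
      and uV': "uni (tobj C (tobj C H L) K) (tobj C (tobj C H L) K) ?V"
      using U V obj by (simp_all add: leg23_eq unitaries_iff)
    \<comment> \<open>The defining equation of W, multiplied by U_12 from the left and by V_23 from
      the right, becomes the pentagon equation.\<close>
    have "?U o\<^sub>L leg13 C c H L K W o\<^sub>L ?V = (?U o\<^sub>L adj ?U) o\<^sub>L ?V o\<^sub>L ?U o\<^sub>L (adj ?V o\<^sub>L ?V)"
      using W by (simp add: yd_star_eq_def oper_comp_assoc)
    also have "\<dots> = (idm C (tobj C (tobj C H L) K) o\<^sub>L ?V) o\<^sub>L (?U o\<^sub>L idm C (tobj C (tobj C H L) K))"
      unfolding unitary_opD(3)[OF uU'] unitary_opD(2)[OF uV'] by (simp add: oper_comp_assoc)
    also have "\<dots> = ?V o\<^sub>L ?U"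
      using uni_id_left[OF _ _ uV'] uni_id_right[OF _ uU'] obj by simp
    finally have p: "pentagonal H L K U V W"
      using U V Wu by (simp add: pentagonal_def)
    have w: "rank1_ops X Y \<subseteq> closed_span (vslices X Y Y X (w Y X))" if "X \<in> Obj C" "Y \<in> Obj C" for X Y
      by (rule rank1s_subset_w_slices[OF that c_reg[OF that(2,1)]])
    have f: "rank1_ops L L \<subseteq> closed_span (braid_slices L L F)"
      using rank1s_subset_compact_ops[OF Hilb_closed[OF obj(2)]] F_reg mu by blast
    have 1: "rank1_ops H K \<subseteq> closed_span (braid_slices H K W)"
      by (rule rank1s_subset_slices[OF obj p l0 w[OF obj(1,3)]
            rank1s_subset_slices_left[OF obj(1,2) pU l0 w[OF obj(1,2)] f]
            rank1s_subset_slices_right[OF obj(2,3) pV l0 w[OF obj(2,3)] f]])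
    moreover have "closed_span (braid_slices H K W) \<subseteq> closed_span (rank1_ops H K)"
      if c: "\<forall>X\<in>Obj C. \<forall>Y\<in>Obj C. slice_span C X Y Y X (c X Y) \<subseteq> compact_ops (Hilb C X) (Hilb C Y)"
        and F': "mu_algebra C c L F \<subseteq> compact_ops (Hilb C L) (Hilb C L)"
    proof -
      have w': "vslices X Y Y X (w Y X) \<subseteq> closed_span (rank1_ops X Y)" if "X \<in> Obj C" "Y \<in> Obj C" for X Y
        by (rule w_slices_subset_rank1s[OF that]) (use c that in blast)
      have f': "braid_slices L L F \<subseteq> closed_span (rank1_ops L L)"
        using closed_span_superset[of "braid_slices L L F"] F' mu
          compact_ops_subset_closed_span[OF Hilb_closed[OF obj(2)] Hilb_closed[OF obj(2)]] by blast
      \<comment> \<open>A bound for S(V) is enough, since it makes the left factors of the next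
        products compact.\<close>
      have v': "closed_span (braid_slices L K V) \<subseteq> closed_span (rank1_ops L K)"
      proof (rule slices_subset_products[OF obj(2,2,3) pV l0 w'[OF obj(2,3)]])
        \<comment> \<open>Here compactness comes from u, a slice of F.\<close>
        fix v u assume "v \<in> braid_slices L K V" "u \<in> braid_slices L L F"
        then show "v o\<^sub>L u \<in> closed_span (rank1_ops L K)"
          using comp_rank1_mem braid_slices_bounded_ops[OF obj(2,3) V] f' by blast
      qed
      show ?thesis
      proof (rule slices_subset_products[OF obj p l0 w'[OF obj(1,3)]])
        \<comment> \<open>Here compactness comes from v; of u only boundedness is used.\<close>
        fix v u assume "v \<in> braid_slices L K V" "u \<in> braid_slices H L U"
        then show "v o\<^sub>L u \<in> closed_span (rank1_ops H K)"
          using rank1_comp_mem[OF obj(1,3,2)] braid_slices_bounded_ops[OF obj(1,2) U] v' closed_span_superset[of "braid_slices L K V"] by blast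
      qed
    qed
    ultimately show ?thesis by blast
  qed
  then show "rank1_ops H K \<subseteq> closed_span (braid_slices H K W)"
    "\<lbrakk>\<And>X Y. X \<in> Obj C \<Longrightarrow> Y \<in> Obj C \<Longrightarrow> slice_span C X Y Y X (c X Y) \<subseteq> compact_ops (Hilb C X) (Hilb C Y);
      mu_algebra C c L F \<subseteq> compact_ops (Hilb C L) (Hilb C L)\<rbrakk>
      \<Longrightarrow> closed_span (braid_slices H K W) \<subseteq> closed_span (rank1_ops H K)"
    by blast+
qed

end

text \<open>Existence and uniqueness of V * U among the unitary morphisms enter as a hypothesis, so
  that the definite description in \<open>yd_star\<close> denotes. Regularity of F enters through
  its slices.\<close>

theorem proposition16:
  fixes C :: "('o, 'v :: complex_hilbert_space) cmcat"
    and c :: "'o \<Rightarrow> 'o \<Rightarrow> 'v oper"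
    and L :: 'o
    and F :: "'v oper"
  assumes "concrete_monoidal_wstar_category C"
    and "braiding C c"
    and "L \<in> Obj C"
    and "multiplicative_unitary C c L F"
    and "\<And>x y. \<lbrakk>x \<in> Obj (yd C c L F); y \<in> Obj (yd C c L F)\<rbrakk> \<Longrightarrow> \<exists>!W. yd_star_eq C c L x y W"
  shows "(semi_regular_braiding C c \<and> semi_regular_mu C c L F
            \<longrightarrow> semi_regular_braiding (yd C c L F) (yd_braiding C c L)) \<and>
         (regular_braiding C c \<and> regular_mu C c L F
            \<longrightarrow> regular_braiding (yd C c L F) (yd_braiding C c L))"
proof -
  have F: "F \<in> unitaries C (tobj C L L)" using assms(4) by (simp add: multiplicative_unitary_def)
  \<comment> \<open>The upper bound is also stated under the semi-regular hypotheses, since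
    regularity implies them.\<close>
  have yd: "unitary_op (Hilb2 (yd C c L F) x y) (Hilb2 (yd C c L F) y x) (yd_braiding C c L x y) \<and>
      compact_ops (Hilb (yd C c L F) x) (Hilb (yd C c L F) y) \<subseteq> slice_span (yd C c L F) x y y x (yd_braiding C c L x y)"
    "regular_braiding C c \<and> regular_mu C c L F \<Longrightarrow>
      slice_span (yd C c L F) x y y x (yd_braiding C c L x y) \<subseteq> compact_ops (Hilb (yd C c L F) x) (Hilb (yd C c L F) y)"
    if c: "semi_regular_braiding C c" and f: "semi_regular_mu C c L F"
      and xy: "x \<in> Obj (yd C c L F)" "y \<in> Obj (yd C c L F)" for x y
  proof -
    interpret unitarily_braided_category C c
      using assms(1,2) c
      by (auto simp: unitarily_braided_category_def unitarily_braided_category_axioms_def semi_regular_braiding_def)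
    obtain H U VH K UK V where x: "x = (H, U, VH)" and y: "y = (K, UK, V)" by (metis prod_cases3)
    have mod: "yd_module C c L F (H, U, VH)" "yd_module C c L F (K, UK, V)"
      using xy by (simp_all add: x y yd_def)
    then have obj: "H \<in> Obj C" "L \<in> Obj C" "K \<in> Obj C"
      using assms(3) by (simp_all add: yd_module_def)
    define W where "W = yd_star C c L x y"
    have ex: "\<exists>!W. yd_star_eq C c L (H, U, VH) (K, UK, V) W"
      using assms(5)[OF xy] by (simp add: x y)
    have W: "yd_star_eq C c L (H, U, VH) (K, UK, V) W"
      unfolding W_def yd_star_def x y by (rule theI'[OF ex])
    have Wu: "W \<in> unitaries C (tobj C H K)" using W by (simp add: yd_star_eq_def)
    have \<Phi>: "yd_braiding C c L x y = w K H o\<^sub>L W"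
      by (simp add: yd_braiding_def W_def[symmetric]) (simp add: x y binv_eq obj)
    have sp: "slice_span (yd C c L F) x y y x (w K H o\<^sub>L W) = closed_span (braid_slices H K W)"
      unfolding x y yd_slice_span
      by (rule slice_span_eq[OF obj(1,3,3,1) unitary_opD(1)[OF wX_uni[OF obj(1,3) Wu]]])
    have hilb: "Hilb (yd C c L F) x = Hilb C H" "Hilb (yd C c L F) y = Hilb C K"
      "Hilb2 (yd C c L F) x y = Hilb2 C H K" "Hilb2 (yd C c L F) y x = Hilb2 C K H"
      by (simp_all add: x y yd_def yd_tensor_def)
    have c': "\<And>X Y. X \<in> Obj C \<Longrightarrow> Y \<in> Obj C \<Longrightarrow> compact_ops (Hilb C X) (Hilb C Y) \<subseteq> slice_span C X Y Y X (c X Y)"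
      using c by (simp add: semi_regular_braiding_def)
    have f': "compact_ops (Hilb C L) (Hilb C L) \<subseteq> mu_algebra C c L F"
      using f by (simp add: semi_regular_mu_def)
    have 1: "rank1_ops H K \<subseteq> closed_span (braid_slices H K W)"
      by (rule yd_rank1s(1)[OF obj mod ex W F c' f'])
    have "compact_ops (Hilb C H) (Hilb C K) \<subseteq> closed_span (rank1_ops H K)"
      by (rule compact_ops_subset_closed_span[OF Hilb_closed[OF obj(1)] Hilb_closed[OF obj(3)]])
    also have "\<dots> \<subseteq> closed_span (braid_slices H K W)" by (rule closed_span_le[OF 1])
    finally show "unitary_op (Hilb2 (yd C c L F) x y) (Hilb2 (yd C c L F) y x) (yd_braiding C c L x y) \<and>
      compact_ops (Hilb (yd C c L F) x) (Hilb (yd C c L F) y) \<subseteq> slice_span (yd C c L F) x y y x (yd_braiding C c L x y)"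
      unfolding hilb \<Phi> sp using wX_uni[OF obj(1,3) Wu] by simp
    assume r: "regular_braiding C c \<and> regular_mu C c L F"
    have "closed_span (braid_slices H K W) \<subseteq> closed_span (rank1_ops H K)"
      by (rule yd_rank1s(2)[OF obj mod ex W F c' f']) (use r in \<open>auto simp: regular_braiding_def regular_mu_def\<close>)
    \<comment> \<open>That limits of rank-one combinations are compact is read off from regularity
      itself, which identifies the compact operators with a closed span.\<close>
    also have "\<dots> \<subseteq> slice_span C H K K H (c H K)"
      unfolding c_slices[OF obj(1,3)]
      using rank1s_subset_compact_ops[OF Hilb_closed[OF obj(3)], of "Hilb C H"] c'[OF obj(1,3)] c_slices[OF obj(1,3)]
      by (intro closed_span_le) auto
    also have "\<dots> = compact_ops (Hilb C H) (Hilb C K)"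
      using r obj by (simp add: regular_braiding_def)
    finally show "slice_span (yd C c L F) x y y x (yd_braiding C c L x y)
        \<subseteq> compact_ops (Hilb (yd C c L F) x) (Hilb (yd C c L F) y)"
      unfolding hilb \<Phi> sp .
  qed
  have semi: "regular_braiding C c \<Longrightarrow> semi_regular_braiding C c" "regular_mu C c L F \<Longrightarrow> semi_regular_mu C c L F"
    by (simp_all add: regular_braiding_def semi_regular_braiding_def regular_mu_def semi_regular_mu_def)
  show ?thesis
    unfolding semi_regular_braiding_def[of "yd C c L F"] regular_braiding_def[of "yd C c L F"]
    using yd semi by (metis subset_antisym)
qed

end
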